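(* There exists an algorithm which, given a word $w=(x_1,\ldots,x_n)$ listing each of the integers $1,\ldots,n$ exactly once, decides whether $w$ is realizable as (the straight word of a straight diagram of) a classical knot.
   Context: Given a knot diagram with $n$ crossings, choose a non-crossing starting point and a direction and traverse the knot, labeling the crossings $1,2,\ldots,n$ in the order in which they are first encountered; listing the labels of the crossings met in one full traversal gives a $2n$-tuple, a knot word of the diagram. The diagram is straight if, for some choice of starting point and direction, its knot word has the form $(1,2,\ldots,n,\sigma(1),\ldots,\sigma(n))$ with $\sigma\in S_n$; the $n$-tuple $(\sigma(1),\ldots,\sigma(n))$ is then the straight word (or straight code) of the diagram. Over/under information at crossings is ignored in the word. A word that is a permutation of $1,\ldots,n$ is realizable as a classical knot if it is the straight word of some straight classical knot diagram in the plane with exactly $n$ crossings; otherwise drawing it requires additional virtual crossings, and it represents only a virtual knot. *)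

theory Defs
  imports "HOL-Analysis.Analysis" "HOL-Library.Nat_Bijection"
begin

section \<open>Classical knot diagrams\<close>

text \<open>
  Knots are taken to be tame, in the piecewise linear sense: a classical knot diagram is a closed
  polygon in the plane in regular position, together with over/under information at its crossings.
  The polygon with vertices \<open>P ! 0, \<dots>, P ! (m - 1)\<close> is traversed with period \<open>m\<close>,
  the parameters in \<open>[k, k + 1]\<close> running along the edge that starts at \<open>P ! (k mod m)\<close>.
\<close>

definition closed_polygon :: "complex list \<Rightarrow> real \<Rightarrow> complex" where
  "closed_polygon P t =
     (let k = nat (\<lfloor>t\<rfloor> mod int (length P))
      in linepath (P ! k) (P ! (Suc k mod length P)) (frac t))"

definition polygon_fibre :: "complex list \<Rightarrow> complex \<Rightarrow> real set" where
  "polygon_fibre P x = {t \<in> {0..<real (length P)}. closed_polygon P t = x}"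

definition multiple_points :: "complex list \<Rightarrow> complex set" where
  "multiple_points P =
     {x. \<exists>s \<in> polygon_fibre P x. \<exists>t \<in> polygon_fibre P x. s \<noteq> t}"

text \<open>
  Regular position: finitely many multiple points, all of them double points, and none of them a
  vertex. A double point then lies in the interior of two edges, and these are not parallel (they
  would otherwise overlap in a segment), so the two strands cross transversally there.
\<close>

definition regular_polygon :: "complex list \<Rightarrow> bool" where
  "regular_polygon P \<longleftrightarrow>
     3 \<le> length P \<and>
     finite (multiple_points P) \<and>
     (\<forall>x \<in> multiple_points P. card (polygon_fibre P x) = 2) \<and>
     set P \<inter> multiple_points P = {}"

text \<open>The field \<open>over\<close> holds the parameters at which the curve passes over a crossing.\<close>

record diagram =
  vertices :: "complex list"
  over :: "real set"

definition crossings :: "diagram \<Rightarrow> complex set" where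
  "crossings D = multiple_points (vertices D)"

definition knot_diagram :: "diagram \<Rightarrow> bool" where
  "knot_diagram D \<longleftrightarrow>
     regular_polygon (vertices D) \<and>
     over D \<subseteq> (\<Union>x \<in> crossings D. polygon_fibre (vertices D) x) \<and>
     (\<forall>x \<in> crossings D. \<exists>!t. t \<in> over D \<inter> polygon_fibre (vertices D) x)"


section \<open>Knot words\<close>

text \<open>
  The label of an entry is one more than the number of distinct entries met before its first
  occurrence.
\<close>

definition encounter_labels :: "'a list \<Rightarrow> nat list" where
  "encounter_labels xs = map (\<lambda>x. Suc (card (set (takeWhile (\<lambda>y. y \<noteq> x) xs)))) xs"

definition crossings_met :: "(real \<Rightarrow> complex) \<Rightarrow> real \<Rightarrow> complex set \<Rightarrow> real \<Rightarrow> complex list" where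
  "crossings_met g p X s = map g (sorted_list_of_set {t \<in> {s<..<s + p}. g t \<in> X})"

text \<open>Here \<open>g\<close> is the curve run through in one of its two directions, and \<open>g s\<close> the start.\<close>

definition knot_word_of :: "diagram \<Rightarrow> nat list \<Rightarrow> bool" where
  "knot_word_of D u \<longleftrightarrow>
     (\<exists>g s. g \<in> {closed_polygon (vertices D), \<lambda>t. closed_polygon (vertices D) (- t)} \<and>
        g s \<notin> crossings D \<and>
        u = encounter_labels (crossings_met g (real (length (vertices D))) (crossings D) s))"

definition permutation_word :: "nat list \<Rightarrow> bool" where
  "permutation_word w \<longleftrightarrow> distinct w \<and> set w = {1..length w}"

definition straight_word_of :: "diagram \<Rightarrow> nat list \<Rightarrow> bool" where
  "straight_word_of D w \<longleftrightarrow>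
     permutation_word w \<and> length w = card (crossings D) \<and>
     knot_word_of D ([1..<Suc (card (crossings D))] @ w)"

definition classically_realizable :: "nat list \<Rightarrow> bool" where
  "classically_realizable w \<longleftrightarrow> (\<exists>D. knot_diagram D \<and> straight_word_of D w)"


section \<open>Computability\<close>

text \<open>
  \<open>recursive k f\<close>: the \<open>k\<close>-ary function \<open>f\<close> is (total) general recursive in the sense of
  Goedel and Kleene. A \<open>k\<close>-ary function is represented by a function on lists of which only the
  values at lists of length \<open>k\<close> matter; this is what the rule \<open>ext\<close> expresses.
\<close>

inductive recursive :: "nat \<Rightarrow> (nat list \<Rightarrow> nat) \<Rightarrow> bool" where
  zero: "recursive k (\<lambda>xs. 0)"
| succ: "recursive 1 (\<lambda>xs. Suc (xs ! 0))"
| proj: "i < k \<Longrightarrow> recursive k (\<lambda>xs. xs ! i)"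
| comp: "recursive (length gs) f \<Longrightarrow> \<forall>g \<in> set gs. recursive k g \<Longrightarrow>
    recursive k (\<lambda>xs. f (map (\<lambda>g. g xs) gs))"
| prim_rec: "recursive k f \<Longrightarrow> recursive (Suc (Suc k)) g \<Longrightarrow>
    recursive (Suc k) (\<lambda>xs. rec_nat (f (tl xs)) (\<lambda>i r. g (i # r # tl xs)) (hd xs))"
| minimize: "recursive (Suc k) f \<Longrightarrow> \<forall>xs. length xs = k \<longrightarrow> (\<exists>y. f (y # xs) = 0) \<Longrightarrow>
    recursive k (\<lambda>xs. LEAST y. f (y # xs) = 0)"
| ext: "recursive k f \<Longrightarrow> \<forall>xs. length xs = k \<longrightarrow> f xs = g xs \<Longrightarrow> recursive k g"

end

(*
  In a straight diagram the first half of the curve is a simple arc, the slit, which meets the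
  crossings 1, ..., n in this order. The second half is cut by the crossings into n + 1 chords, which
  are disjoint and run in the complement of the slit. On the sphere this complement is a disc; its
  boundary circle carries two points for every crossing (the two sides of the slit) and one for each
  end of the slit, and the second half leaves every crossing on the side opposite to the one on which
  it arrives. So a realizable word admits a choice of sides for which the n + 1 chords of the circle
  do not cross, and conversely a non-crossing choice can be drawn as a polygon with horizontal and
  vertical edges: a chord is drawn at a height equal to the distance of its end points on the circle
  cut open at one point, so that nested chords lie below each other. Since there are only finitely
  many choices of sides, the criterion is recursive.

  That the chords of a diagram do not cross is seen from the Jordan curve formed by one chord and the
  part of the slit between its feet: along the slit its winding number jumps by one from the right to
  the left, hence all left sides of the slit lie in one component and all right sides in the other.
*)

theory Submission
  imports Defs "HOL-Complex_Analysis.Complex_Analysis"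
begin

section \<open>The two sides of a simple loop\<close>

text \<open>A side is therefore read beside a point of the slit slightly further along the loop and
  carried to the wanted strand through half-balls around the crossing that miss the loop. From a
  foot off the loop one walks along the slit to the nearest corner. So all sides become signs of
  \<open>turn\<close>, and \<open>between_position\<close> is the same case distinction for
  positions on the cut circle. One Boolean per crossing suffices: it says on which side a chord
  starts and hence on which the preceding chord ends, so the two ends never share a position. In the
  drawing the slit is a segment of the real axis and height is measured by
  \<open>max \<bar>Im p\<bar> (Re p - N)\<close>, the second term serving chords that pass around
  the end of the slit. Points of different height are distinct, and chords of equal height have
  disjoint spans of positions.\<close>

lemma Im_cnj_mult_of_real_self: "z = of_real s * d \<Longrightarrow> Im (cnj d * z) = 0"
  by (simp add: algebra_simps)

text \<open>The segment from \<open>c - h\<close> to \<open>c + h\<close> is pushed off to the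
  right, to the corner \<open>e\<close>. The detoured loop \<open>q\<close> misses
  \<open>ball c (r/2)\<close>, so its winding number agrees at \<open>l\<close> and
  \<open>l'\<close>. The whole difference comes from the triangle between segment and detour, which
  is run through clockwise and contains \<open>l'\<close> but not \<open>l\<close>.\<close>

lemma winding_number_jump_join:
  assumes p: "path p1" "path p2" "pathfinish p1 = c - h" "pathstart p2 = c + h"
      "pathfinish p2 = pathstart p1"
    and r: "0 < r" "r \<le> norm h" "ball c r \<inter> (path_image p1 \<union> path_image p2) = {}"
    and l: "l \<in> ball c (r/2)" "Im (cnj h * (l - c)) > 0"
    and l': "l' \<in> ball c (r/2)" "Im (cnj h * (l' - c)) < 0"
  shows "winding_number p1 l + winding_number (linepath (c - h) (c + h)) l + winding_number p2 l
       = winding_number p1 l' + winding_number (linepath (c - h) (c + h)) l' + winding_number p2 l' + 1"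
proof -
  define e where "e = c - \<i> * h"
  define q where "q = (p1 +++ (linepath (c - h) e +++ linepath e (c + h))) +++ p2"
  have h0: "h \<noteq> 0" using r by auto
  \<comment> \<open>In the coordinates \<open>u\<close>, \<open>v\<close> the detour is the set
    \<open>\<bar>u\<bar> + \<bar>v\<bar> = 1\<close> with \<open>v \<le> 0\<close>, while the ball
    of radius \<open>r/2 \<le> norm h / 2\<close> satisfies \<open>\<bar>u\<bar> < 1/2\<close> and
    \<open>\<bar>v\<bar> < 1/2\<close>.\<close>
  have coord: "\<exists>u v. z = c + h * Complex u v \<and> \<bar>u\<bar> < 1/2 \<and> \<bar>v\<bar> < 1/2 \<and> (Im (cnj h * (z - c)) = v * (norm h)^2)"
    if "z \<in> ball c (r/2)" for z
  proof (intro exI conjI)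
    define y where "y = (z - c) / h"
    have z: "z = c + h * y" using h0 by (simp add: y_def)
    have "norm (z - c) < norm h / 2" using that r by (simp add: dist_norm norm_minus_commute)
    then have "norm y < 1/2" using h0 by (simp add: y_def norm_divide divide_simps)
    then show "\<bar>Re y\<bar> < 1/2" "\<bar>Im y\<bar> < 1/2"
      using abs_Re_le_cmod[of y] abs_Im_le_cmod[of y] by linarith+
    show "z = c + h * Complex (Re y) (Im y)" using z by simp
    have "cnj h * (z - c) = of_real ((norm h)^2) * y"
      by (simp add: z complex_norm_square mult_ac flip: of_real_power)
    then show "Im (cnj h * (z - c)) = Im y * (norm h)^2" by simp
  qed
  have notseg: "z \<notin> closed_segment (c - h) e \<union> closed_segment e (c + h)" if z: "z \<in> ball c (r/2)" for z
  proof -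
    obtain u v where uv: "z = c + h * Complex u v" "\<bar>u\<bar> < 1/2" "\<bar>v\<bar> < 1/2" using coord[OF z] by blast
    have 1: "z \<noteq> (1 - t) *\<^sub>R (c - h) + t *\<^sub>R e" for t
    proof
      assume "z = (1 - t) *\<^sub>R (c - h) + t *\<^sub>R e"
      then have "h * Complex u v = h * Complex (t - 1) (- t)"
        by (simp add: uv e_def complex_eq_iff algebra_simps)
      then have "Complex u v = Complex (t - 1) (- t)" using h0 by (metis mult_cancel_left)
      then show False using uv by simp
    qed
    have 2: "z \<noteq> (1 - t) *\<^sub>R e + t *\<^sub>R (c + h)" for t
    proof
      assume "z = (1 - t) *\<^sub>R e + t *\<^sub>R (c + h)"
      then have "h * Complex u v = h * Complex t (t - 1)"
        by (simp add: uv e_def complex_eq_iff algebra_simps)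
      then have "Complex u v = Complex t (t - 1)" using h0 by (metis mult_cancel_left)
      then show False using uv by simp
    qed
    show ?thesis using 1 2 by (auto simp: in_segment)
  qed
  have notp: "z \<notin> path_image p1" "z \<notin> path_image p2" if "z \<in> ball c (r/2)" for z
    using that r by (auto simp: disjoint_iff)
  have pq: "path q" "pathfinish q = pathstart q" using p by (auto simp: q_def)
  have "ball c (r/2) \<inter> path_image q = {}"
    using notseg notp p by (auto simp: q_def path_image_join)
  then have eq: "winding_number q l = winding_number q l'"
    by (intro winding_number_eq[OF pq, where S = "ball c (r/2)"]) (use l l' in auto)
  have wq: "winding_number q z = winding_number p1 z + winding_number (linepath (c - h) e) z
       + winding_number (linepath e (c + h)) z + winding_number p2 z" if z: "z \<in> ball c (r/2)" for z
    using notseg[OF z] notp[OF z] p unfolding q_def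
    by (subst winding_number_join; simp add: path_image_join)+
  define T where "T z = winding_number (linepath (c - h) (c + h) +++ linepath (c + h) e +++ linepath e (c - h)) z" for z
  have Teq: "T z = winding_number (linepath (c - h) (c + h)) z - winding_number (linepath e (c + h)) z
       - winding_number (linepath (c - h) e) z" if z: "z \<in> ball c (r/2)" and i: "Im (cnj h * (z - c)) \<noteq> 0" for z
  proof -
    have "z \<notin> closed_segment (c - h) (c + h)"
    proof
      assume "z \<in> closed_segment (c - h) (c + h)"
      then obtain t where "z = (1 - t) *\<^sub>R (c - h) + t *\<^sub>R (c + h)" by (auto simp: in_segment)
      then have "z - c = of_real (2 * t - 1) * h" by (simp add: algebra_simps complex_eq_iff)
      then show False using i Im_cnj_mult_of_real_self by blast
    qed
    moreover have "winding_number (linepath (c + h) e) z = - winding_number (linepath e (c + h)) z"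
      "winding_number (linepath e (c - h)) z = - winding_number (linepath (c - h) e) z"
      using notseg[OF z] winding_number_reversepath[of "linepath e (c + h)" z]
        winding_number_reversepath[of "linepath (c - h) e" z] by auto
    ultimately show ?thesis
      using notseg[OF z] unfolding T_def
      by (simp add: winding_number_join path_image_join closed_segment_commute)
  qed
  have T0: "T l = 0" unfolding T_def
  proof (rule winding_number_zero_outside[where s = "{z. Im (cnj h * (z - c)) \<le> 0}"])
    have "{z. Im (cnj h * (z - c)) \<le> 0} = {z. inner (\<i> * h) z \<le> Im (cnj h * c)}"
      by (auto simp: inner_complex_def algebra_simps)
    then show "convex {z. Im (cnj h * (z - c)) \<le> 0}" by (simp add: convex_halfspace_le)
    moreover have "{c - h, c + h, e} \<subseteq> {z. Im (cnj h * (z - c)) \<le> 0}"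
      by (auto simp: e_def mult.commute)
    ultimately show "path_image (linepath (c - h) (c + h) +++ linepath (c + h) e +++ linepath e (c - h))
        \<subseteq> {z. Im (cnj h * (z - c)) \<le> 0}"
      by (simp add: path_image_join closed_segment_subset)
  qed (use l in auto)
  have T1: "T l' = -1"
  proof -
    have sub: "ball c (r/2) \<inter> {z. Im (cnj h * (z - c)) < 0} \<subseteq> convex hull {c - h, c + h, e}"
    proof clarify
      fix z assume z: "z \<in> ball c (r/2)" "Im (cnj h * (z - c)) < 0"
      obtain u v where uv: "z = c + h * Complex u v" "\<bar>u\<bar> < 1/2" "\<bar>v\<bar> < 1/2"
        "Im (cnj h * (z - c)) = v * (norm h)^2" using coord[OF z(1)] by blast
      have "v * (norm h)^2 < 0" using z(2) uv(4) by linarith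
      then have "v < 0" by (simp add: mult_less_0_iff)
      have "z = ((1 + v - u)/2) *\<^sub>R (c - h) + ((1 + v + u)/2) *\<^sub>R (c + h) + (- v) *\<^sub>R e"
        by (simp add: uv e_def complex_eq_iff field_simps)
      moreover have "(1 + v - u)/2 \<ge> 0" "(1 + v + u)/2 \<ge> 0" "- v \<ge> 0"
        using uv \<open>v < 0\<close> by auto
      moreover have "(1 + v - u)/2 + (1 + v + u)/2 + (- v) = 1" by (simp add: field_simps)
      ultimately show "z \<in> convex hull {c - h, c + h, e}"
        unfolding convex_hull_3 by blast
    qed
    have "{z. Im (cnj h * (z - c)) < 0} = {z. inner (\<i> * h) z < Im (cnj h * c)}"
      by (auto simp: inner_complex_def algebra_simps)
    then have "open (ball c (r/2) \<inter> {z. Im (cnj h * (z - c)) < 0})"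
      by (simp add: open_halfspace_lt open_Int)
    then have "l' \<in> interior (convex hull {c - h, c + h, e})"
      using sub l' interior_maximal by blast
    moreover have "\<not> 0 < Im ((c + h - (c - h)) * cnj (c + h - l'))"
      using l'(2) by (simp add: algebra_simps)
    ultimately show ?thesis unfolding T_def by (simp add: winding_number_triangle)
  qed
  show ?thesis using eq wq[OF l(1)] wq[OF l'(1)] Teq[OF l(1)] Teq[OF l'(1)] T0 T1 l(2) l'(2)
    by (simp add: algebra_simps)
qed

text \<open>Reduction to the segment case with \<open>h = \<delta> * d\<close>: by
  \<open>lin\<close> the middle piece of the loop is a straight segment, and the two outer pieces
  join at the base point because the loop is closed.\<close>

lemma winding_number_jump:
  fixes \<gamma> :: "real \<Rightarrow> complex"
  assumes g: "path \<gamma>" "pathfinish \<gamma> = pathstart \<gamma>"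
    and t: "0 < \<delta>" "0 \<le> t - \<delta>" "t + \<delta> \<le> 1"
    and lin: "\<And>s. \<bar>s\<bar> \<le> \<delta> \<Longrightarrow> \<gamma> (t + s) = \<gamma> t + of_real s * d"
    and r: "0 < r" "r \<le> \<delta> * norm d" "ball (\<gamma> t) r \<inter> \<gamma> ` ({0..t - \<delta>} \<union> {t + \<delta>..1}) = {}"
    and l: "l \<in> ball (\<gamma> t) (r/2)" "Im (cnj d * (l - \<gamma> t)) > 0"
    and l': "l' \<in> ball (\<gamma> t) (r/2)" "Im (cnj d * (l' - \<gamma> t)) < 0"
  shows "l \<notin> path_image \<gamma>" "l' \<notin> path_image \<gamma>"
    "winding_number \<gamma> l = winding_number \<gamma> l' + 1"
proof -
  have notin: "z \<notin> path_image \<gamma>" if z: "z \<in> ball (\<gamma> t) (r/2)" "Im (cnj d * (z - \<gamma> t)) \<noteq> 0" for z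
  proof
    assume "z \<in> path_image \<gamma>"
    then obtain s where s: "s \<in> {0..1}" "z = \<gamma> s" by (auto simp: path_image_def)
    have "z \<in> ball (\<gamma> t) r" using z(1) r(1) by auto
    then have "\<bar>s - t\<bar> \<le> \<delta>" using r(3) s by (force simp: abs_le_iff disjoint_iff)
    from lin[OF this] have "z - \<gamma> t = of_real (s - t) * d" using s by simp
    then show False using z(2) Im_cnj_mult_of_real_self by blast
  qed
  show n: "l \<notin> path_image \<gamma>" "l' \<notin> path_image \<gamma>" using notin l l' by auto
  define h where "h = of_real \<delta> * d"
  have e: "\<gamma> (t - \<delta>) = \<gamma> t - h" "\<gamma> (t + \<delta>) = \<gamma> t + h"
    using lin[of "- \<delta>"] lin[of \<delta>] t by (auto simp: h_def)
  have mid: "subpath (t - \<delta>) (t + \<delta>) \<gamma> x = linepath (\<gamma> t - h) (\<gamma> t + h) x" if "x \<in> {0..1}" for x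
  proof -
    have "\<gamma> (t + (2 * x - 1) * \<delta>) = \<gamma> t + of_real ((2 * x - 1) * \<delta>) * d"
    proof (rule lin)
      have "\<bar>2 * x - 1\<bar> \<le> 1" using that by auto
      then show "\<bar>(2 * x - 1) * \<delta>\<bar> \<le> \<delta>" using t mult_right_mono[of "\<bar>2 * x - 1\<bar>" 1 \<delta>] by (simp add: abs_mult)
    qed
    moreover have "t + (2 * x - 1) * \<delta> = (t + \<delta> - (t - \<delta>)) * x + (t - \<delta>)" by (simp add: algebra_simps)
    ultimately show ?thesis
      by (simp add: subpath_def linepath_def h_def scaleR_conv_of_real algebra_simps)
  qed
  have mid': "winding_number (subpath (t - \<delta>) (t + \<delta>) \<gamma>) z = winding_number (linepath (\<gamma> t - h) (\<gamma> t + h)) z"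
    for z using mid by (intro winding_number_cong) auto
  have dec: "winding_number (subpath 0 (t - \<delta>) \<gamma>) z + winding_number (linepath (\<gamma> t - h) (\<gamma> t + h)) z
      + winding_number (subpath (t + \<delta>) 1 \<gamma>) z = winding_number \<gamma> z"
    if "z \<notin> path_image \<gamma>" for z
    using winding_number_subpath_combine[OF g(1) that, of 0 "t - \<delta>" "t + \<delta>"]
      winding_number_subpath_combine[OF g(1) that, of 0 "t + \<delta>" 1] t
    by (simp add: mid')
  have "winding_number (subpath 0 (t - \<delta>) \<gamma>) l + winding_number (linepath (\<gamma> t - h) (\<gamma> t + h)) l
      + winding_number (subpath (t + \<delta>) 1 \<gamma>) l =
      winding_number (subpath 0 (t - \<delta>) \<gamma>) l' + winding_number (linepath (\<gamma> t - h) (\<gamma> t + h)) l'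
      + winding_number (subpath (t + \<delta>) 1 \<gamma>) l' + 1"
  proof (rule winding_number_jump_join[where r = r])
    show "r \<le> norm h" using r t by (simp add: h_def norm_mult)
    show "ball (\<gamma> t) r \<inter> (path_image (subpath 0 (t - \<delta>) \<gamma>) \<union> path_image (subpath (t + \<delta>) 1 \<gamma>)) = {}"
      using r(3) t by (simp add: path_image_subpath image_Un)
    have im: "Im (cnj h * z) = \<delta> * Im (cnj d * z)" for z
      by (simp add: h_def algebra_simps)
    show "Im (cnj h * (l - \<gamma> t)) > 0" "Im (cnj h * (l' - \<gamma> t)) < 0"
      unfolding im using t l(2) l'(2) by (auto simp: mult_pos_neg)
    show "path (subpath 0 (t - \<delta>) \<gamma>)" "path (subpath (t + \<delta>) 1 \<gamma>)" using g t by auto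
  qed (use g t e r l l' in \<open>auto simp: pathstart_def pathfinish_def subpath_def\<close>)
  then show "winding_number \<gamma> l = winding_number \<gamma> l' + 1"
    by (simp add: dec n)
qed

section \<open>Side functions of a simple loop\<close>

text \<open>An abstract two-colouring of the complement of \<open>C\<close>. The later argument
  needs only that the label cannot change without meeting \<open>C\<close>, not which of the two
  components is the inside.\<close>

definition side_function :: "complex set \<Rightarrow> (complex \<Rightarrow> bool) \<Rightarrow> bool" where
  "side_function C side \<longleftrightarrow>
     (\<forall>S z w. connected S \<longrightarrow> S \<inter> C = {} \<longrightarrow> z \<in> S \<longrightarrow> w \<in> S \<longrightarrow> side z = side w)"

definition left_side :: "complex set \<Rightarrow> (complex \<Rightarrow> bool) \<Rightarrow> complex \<Rightarrow> complex \<Rightarrow> bool" where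
  "left_side C side p d \<longleftrightarrow>
     (\<exists>r>0. \<forall>z\<in>ball p r. (Im (cnj d * (z - p)) > 0 \<longrightarrow> z \<notin> C \<and> side z) \<and>
        (Im (cnj d * (z - p)) < 0 \<longrightarrow> z \<notin> C \<and> \<not> side z))"

text \<open>The winding number of a simple loop takes the values \<open>1, 0\<close> or
  \<open>0, -1\<close> according to its orientation. In both cases the larger value \<open>M\<close>
  is the one on the left, since crossing from right to left adds one; so the orientation of the loop
  never has to be known.\<close>

lemma simple_loop_sides:
  fixes \<gamma> :: "real \<Rightarrow> complex"
  assumes "simple_path \<gamma>" "pathfinish \<gamma> = pathstart \<gamma>"
  obtains side where "side_function (path_image \<gamma>) side"
    "\<forall>t \<delta> d. 0 < \<delta> \<longrightarrow> 0 < t - \<delta> \<longrightarrow> t + \<delta> < 1 \<longrightarrow> d \<noteq> 0 \<longrightarrow>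
       (\<forall>s. \<bar>s\<bar> \<le> \<delta> \<longrightarrow> \<gamma> (t + s) = \<gamma> t + of_real s * d) \<longrightarrow> left_side (path_image \<gamma>) side (\<gamma> t) d"
proof -
  have p: "path \<gamma>" using assms simple_path_imp_path by blast
  have "\<exists>M. \<forall>z. z \<notin> path_image \<gamma> \<longrightarrow> winding_number \<gamma> z \<in> {M, M - 1}"
  proof -
    have out: "winding_number \<gamma> z = 0" if "z \<notin> path_image \<gamma>" "z \<notin> inside (path_image \<gamma>)" for z
      using that winding_number_zero_in_outside[OF p assms(2)] inside_Un_outside[of "path_image \<gamma>"] by blast
    show ?thesis
    proof (cases rule: simple_closed_path_winding_number_inside[OF assms(1)])
      case 1
      then show ?thesis using out by (intro exI[of _ 1]) auto
    next
      case 2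
      then show ?thesis using out by (intro exI[of _ 0]) auto
    qed
  qed
  then obtain M where M: "\<And>z. z \<notin> path_image \<gamma> \<Longrightarrow> winding_number \<gamma> z \<in> {M, M - 1}" by blast
  show thesis
  proof (rule that[of "\<lambda>z. winding_number \<gamma> z = M"])
    show "side_function (path_image \<gamma>) (\<lambda>z. winding_number \<gamma> z = M)"
      unfolding side_function_def using winding_number_eq[OF p assms(2)] by metis
  next
    show "\<forall>t \<delta> d. 0 < \<delta> \<longrightarrow> 0 < t - \<delta> \<longrightarrow> t + \<delta> < 1 \<longrightarrow> d \<noteq> 0 \<longrightarrow>
       (\<forall>s. \<bar>s\<bar> \<le> \<delta> \<longrightarrow> \<gamma> (t + s) = \<gamma> t + of_real s * d) \<longrightarrow>
       left_side (path_image \<gamma>) (\<lambda>z. winding_number \<gamma> z = M) (\<gamma> t) d"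
    proof (intro allI impI)
      fix t \<delta> :: real and d :: complex
      assume t: "0 < \<delta>" "0 < t - \<delta>" "t + \<delta> < 1" "d \<noteq> 0"
        and lin': "\<forall>s. \<bar>s\<bar> \<le> \<delta> \<longrightarrow> \<gamma> (t + s) = \<gamma> t + of_real s * d"
      have lin: "\<And>s. \<bar>s\<bar> \<le> \<delta> \<Longrightarrow> \<gamma> (t + s) = \<gamma> t + of_real s * d" using lin' by blast
      define K where "K = \<gamma> ` ({0..t - \<delta>} \<union> {t + \<delta>..1})"
      have "compact K" unfolding K_def
        using p t by (intro compact_continuous_image) (auto simp: path_def intro: continuous_on_subset)
      moreover have "\<gamma> t \<notin> K"
      proof
        assume "\<gamma> t \<in> K"
        then obtain s where s: "s \<in> {0..t - \<delta>} \<union> {t + \<delta>..1}" "\<gamma> t = \<gamma> s" unfolding K_def by blast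
        have "t \<in> {0..1}" "s \<in> {0..1}" using s t by auto
        then have "t = s \<or> t = 0 \<and> s = 1 \<or> t = 1 \<and> s = 0"
          using s(2) assms(1) unfolding simple_path_def loop_free_def by blast
        then show False using t s by auto
      qed
      ultimately obtain r0 where r0: "r0 > 0" "ball (\<gamma> t) r0 \<inter> K = {}"
        using compact_imp_closed open_Compl open_contains_ball by (metis ComplI Compl_disjoint2 disjoint_eq_subset_Compl inf_commute)
      define r where "r = min r0 (\<delta> * norm d)"
      have r: "0 < r" "r \<le> \<delta> * norm d" "ball (\<gamma> t) r \<inter> \<gamma> ` ({0..t - \<delta>} \<union> {t + \<delta>..1}) = {}"
        using r0 t by (auto simp: r_def K_def)
      note J = winding_number_jump[OF p assms(2) t(1) _ _ lin r]
      \<comment> \<open>The test points \<open>L\<close> and \<open>L'\<close> have distance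
        \<open>r / 4\<close> from the curve point, hence lie in
        \<open>ball (\<gamma> t) (r/2)\<close>. An arbitrary point on one side is compared with the
        test point on the other; a difference of one within \<open>{M, M - 1}\<close> determines
        both values.\<close>
      define \<kappa> where "\<kappa> = r / (4 * norm d)"
      define L where "L = \<gamma> t + \<i> * d * of_real \<kappa>"
      define L' where "L' = \<gamma> t - \<i> * d * of_real \<kappa>"
      have pos: "(Im d)\<^sup>2 + (Re d)\<^sup>2 > 0" using t(4) by (auto simp: complex_eq_iff sum_power2_gt_zero_iff)
      have 1: "Im (cnj d * (L - \<gamma> t)) = ((Im d)^2 + (Re d)^2) * \<kappa>"
           "Im (cnj d * (L' - \<gamma> t)) = - (((Im d)^2 + (Re d)^2) * \<kappa>)"
        by (auto simp: L_def L'_def algebra_simps power2_eq_square)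
      have q: "\<kappa> > 0" using t r by (simp add: \<kappa>_def)
      have LL: "Im (cnj d * (L - \<gamma> t)) > 0" "Im (cnj d * (L' - \<gamma> t)) < 0"
        unfolding 1 using mult_pos_pos[OF pos q] by simp_all
      have LB: "L \<in> ball (\<gamma> t) (r/2)" "L' \<in> ball (\<gamma> t) (r/2)"
      proof -
        have "norm d * \<kappa> = r / 4" using t by (simp add: \<kappa>_def)
        then show "L \<in> ball (\<gamma> t) (r/2)" "L' \<in> ball (\<gamma> t) (r/2)"
          using q r by (auto simp: L_def L'_def dist_norm norm_mult)
      qed
      show "left_side (path_image \<gamma>) (\<lambda>z. winding_number \<gamma> z = M) (\<gamma> t) d"
        unfolding left_side_def
      proof (intro exI[of _ "r/2"] conjI ballI impI)
        show "r / 2 > 0" using r by simp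
        fix z assume z: "z \<in> ball (\<gamma> t) (r/2)"
        { assume i: "Im (cnj d * (z - \<gamma> t)) > 0"
          note j = J[OF _ _ _ z i LB(2) LL(2)]
          show "z \<notin> path_image \<gamma>" using j t by auto
          show "winding_number \<gamma> z = M" using j t M[of z] M[of L'] by auto }
        { assume i: "Im (cnj d * (z - \<gamma> t)) < 0"
          note j = J[OF _ _ _ LB(1) LL(1) z i]
          show "z \<notin> path_image \<gamma>" using j t by auto
          show "winding_number \<gamma> z \<noteq> M" using j t M[of z] M[of L] by auto }
      qed
    qed
  qed
qed


section \<open>Chords in the complement of a slit\<close>

lemma le_half_imp_less: "a \<le> c / 2 \<Longrightarrow> 0 < a \<Longrightarrow> a < c" for a c :: real
  by simp

text \<open>The boundary of the complement of the slit is a circle, which is cut open at the start of the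
  slit: first come the points \<open>1, \<dots>, n\<close> on the left side of the slit, then its end point \<open>n + 1\<close>,
  then the points \<open>n, \<dots>, 1\<close> on the right side.\<close>

definition position :: "nat \<Rightarrow> nat \<Rightarrow> bool \<Rightarrow> nat" where
  "position n m b = (if b then m else 2 * n + 2 - m)"

definition between :: "nat \<Rightarrow> nat \<Rightarrow> nat \<Rightarrow> bool" where
  "between a b c \<longleftrightarrow> min a b < c \<and> c < max a b"

lemma between_commute: "between a b c = between b a c"
  by (auto simp: between_def min_def max_def)

text \<open>The conditional on the right is the rule by which \<open>chord_label\<close> computes
  sides of the loop. Beyond the feet \<open>i\<close> and \<open>j\<close> both sides of the slit
  lie on the same side of the chord, whereas between them left and right are separated. The
  conditions for \<open>0\<close> select position \<open>0\<close> rather than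
  \<open>2 * n + 2\<close> for the start of the slit; the end \<open>Suc n\<close> has a single
  position.\<close>

lemma between_position:
  assumes "i < j" "j \<le> Suc n" "m \<le> Suc n" "i = 0 \<Longrightarrow> lbi" "m = 0 \<Longrightarrow> b"
    "m = i \<Longrightarrow> i \<noteq> 0 \<and> b = (\<not> lbi)" "m = j \<Longrightarrow> j \<noteq> Suc n \<and> b = (\<not> lbj)"
  shows "between (position n i lbi) (position n j lbj) (position n m b) =
    ((if m < i then \<not> lbi else if j < m then \<not> lbj else b) = lbi)"
proof -
  consider "m < i" | "m = i" | "i < m" "m < j" | "m = j" | "j < m" by linarith
  then show ?thesis
    using assms unfolding between_def position_def by cases (auto simp: min_def max_def)
qed

text \<open>The slit is \<open>G\<close> on \<open>[0, z 0]\<close>, with crossings at the parameters \<open>y 1, \<dots>, y n\<close>; the rest of the curve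
  passes the crossing with number \<open>x q\<close> at the parameter \<open>z q\<close>. The ends of the slit count as points
  \<open>0\<close> and \<open>n + 1\<close>. At the \<open>q\<close>-th crossing of the second half, \<open>d q\<close> and \<open>e q\<close> are the directions of the
  slit and of the second half.\<close>

locale straight_curve =
  fixes G :: "real \<Rightarrow> complex" and n :: nat and x :: "nat \<Rightarrow> nat" and y z :: "nat \<Rightarrow> real"
    and d e :: "nat \<Rightarrow> complex"
  assumes path_G: "path G"
    and y_0: "y 0 = 0" and y_last: "y (Suc n) = z 0" and z_last: "z (Suc n) = 1"
    and y_mono: "\<And>i j. i < j \<Longrightarrow> j \<le> Suc n \<Longrightarrow> y i < y j"
    and z_mono: "\<And>i j. i < j \<Longrightarrow> j \<le> Suc n \<Longrightarrow> z i < z j"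
    and x_0: "x 0 = Suc n" and x_last: "x (Suc n) = 0"
    and x_le: "\<And>q. q \<le> Suc n \<Longrightarrow> x q \<le> Suc n"
    and x_inj: "inj_on x {..Suc n}"
    and inj_y: "inj_on G {0..z 0}" and inj_z: "inj_on G {z 0..1}"
    and meet: "\<And>a b. a \<in> {0..z 0} \<Longrightarrow> b \<in> {z 0..1} \<Longrightarrow> G a = G b \<Longrightarrow> \<exists>q\<le>Suc n. a = y (x q) \<and> b = z q"
    and G_meet: "\<And>q. q \<le> Suc n \<Longrightarrow> G (y (x q)) = G (z q)"
    and transversal: "\<And>q. 1 \<le> q \<Longrightarrow> q \<le> n \<Longrightarrow> Im (cnj (d q) * e q) \<noteq> 0"
    and local_G: "\<And>q. 1 \<le> q \<Longrightarrow> q \<le> n \<Longrightarrow> \<exists>\<epsilon>>0. \<forall>s. \<bar>s\<bar> \<le> \<epsilon> \<longrightarrow>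
        G (y (x q) + s) = G (z q) + of_real s * d q \<and> G (z q + s) = G (z q) + of_real s * e q"
begin

abbreviation turn :: "nat \<Rightarrow> real" where "turn q \<equiv> Im (cnj (d q) * e q)"

lemma y_le: "i \<le> j \<Longrightarrow> j \<le> Suc n \<Longrightarrow> y i \<le> y j"
  using y_mono[of i j] by (cases "i = j") auto

lemma z_le: "i \<le> j \<Longrightarrow> j \<le> Suc n \<Longrightarrow> z i \<le> z j"
  using z_mono[of i j] by (cases "i = j") auto

lemma y_less_iff: "i \<le> Suc n \<Longrightarrow> j \<le> Suc n \<Longrightarrow> y i < y j \<longleftrightarrow> i < j"
  using y_mono y_le by (meson linorder_not_less)

lemma z_less_iff: "i \<le> Suc n \<Longrightarrow> j \<le> Suc n \<Longrightarrow> z i < z j \<longleftrightarrow> i < j"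
  using z_mono z_le by (meson linorder_not_less)

lemma z_eq_iff: "i \<le> Suc n \<Longrightarrow> j \<le> Suc n \<Longrightarrow> z i = z j \<longleftrightarrow> i = j"
  using z_less_iff by (metis linorder_neq_iff)

lemma y_range: "i \<le> Suc n \<Longrightarrow> 0 \<le> y i \<and> y i \<le> z 0"
  using y_le[of 0 i] y_le[of i "Suc n"] y_0 y_last by auto

lemma z_range: "i \<le> Suc n \<Longrightarrow> z 0 \<le> z i \<and> z i \<le> 1"
  using z_le[of 0 i] z_le[of i "Suc n"] z_last by auto

lemma z0: "0 < z 0" "z 0 < 1"
  using y_mono[of 0 "Suc n"] z_mono[of 0 "Suc n"] y_0 y_last z_last by auto

lemma x_eq_iff: "p \<le> Suc n \<Longrightarrow> q \<le> Suc n \<Longrightarrow> x p = x q \<longleftrightarrow> p = q"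
  using x_inj by (auto simp: inj_on_def)

section \<open>The loop closed by a chord and a piece of the slit\<close>

definition lo :: "nat \<Rightarrow> nat" where "lo k = min (x k) (x (Suc k))"
definition hi :: "nat \<Rightarrow> nat" where "hi k = max (x k) (x (Suc k))"

definition loop_image :: "nat \<Rightarrow> complex set" where
  "loop_image k = G ` {y (lo k)..y (hi k)} \<union> G ` {z k..z (Suc k)}"

lemma lo_hi: "k \<le> n \<Longrightarrow> lo k < hi k" "k \<le> n \<Longrightarrow> hi k \<le> Suc n"
  using x_eq_iff[of k "Suc k"] x_le[of k] x_le[of "Suc k"] by (auto simp: lo_def hi_def)

text \<open>The slit is run through upwards whatever the direction of the chord; \<open>a\<close>
  and \<open>b\<close> are the parameters of the chord ends, exchanged if the chord has to be
  reversed. Thus left of the loop is left of the slit, and the last clause locates the slit in the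
  first half of the loop.\<close>

lemma loop_path:
  assumes k: "k \<le> n"
  obtains \<gamma> where "simple_path \<gamma>" "pathfinish \<gamma> = pathstart \<gamma>" "path_image \<gamma> = loop_image k"
    "\<forall>s\<in>{0..1/2}. \<gamma> s = G ((y (hi k) - y (lo k)) * (2 * s) + y (lo k))"
proof -
  note lh = lo_hi[OF k]
  define a where "a = (if x k = hi k then z k else z (Suc k))"
  define b where "b = (if x k = hi k then z (Suc k) else z k)"
  define qa where "qa = (if x k = hi k then k else Suc k)"
  define qb where "qb = (if x k = hi k then Suc k else k)"
  have q: "a = z qa" "b = z qb" "x qa = hi k" "x qb = lo k" "qa \<le> Suc n" "qb \<le> Suc n" "qa \<noteq> qb"
    using k lh x_eq_iff[of k "Suc k"]
    by (cases "x k < x (Suc k)"; simp add: a_def b_def qa_def qb_def lo_def hi_def)+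
  have cs: "closed_segment a b = {z k..z (Suc k)}"
    using k z_less_iff[of k "Suc k"] by (auto simp: a_def b_def closed_segment_eq_real_ivl)
  have csy: "closed_segment (y (lo k)) (y (hi k)) = {y (lo k)..y (hi k)}"
    using lh y_less_iff[of "lo k" "hi k"] by (auto simp: closed_segment_eq_real_ivl)
  define \<gamma> where "\<gamma> = subpath (y (lo k)) (y (hi k)) G +++ subpath a b G"
  have yr: "{y (lo k)..y (hi k)} \<subseteq> {0..z 0}" using lh y_range[of "lo k"] y_range[of "hi k"] by auto
  have zr: "{z k..z (Suc k)} \<subseteq> {z 0..1}" using k z_range[of k] z_range[of "Suc k"] by auto
  have ab: "a \<in> {z 0..1}" "b \<in> {z 0..1}" "y (lo k) \<in> {0..z 0}" "y (hi k) \<in> {0..z 0}"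
    using k lh z_range[of k] z_range[of "Suc k"] y_range[of "lo k"] y_range[of "hi k"] by (auto simp: a_def b_def)
  show thesis
  proof (rule that[of \<gamma>])
    show "simple_path \<gamma>" unfolding \<gamma>_def
    proof (rule simple_path_join_loop)
      show "arc (subpath (y (lo k)) (y (hi k)) G)"
        unfolding arc_subpath_eq csy
      proof (intro conjI)
        show "path (subpath (y (lo k)) (y (hi k)) G)" using path_G ab z0 by (intro path_subpath) auto
        show "y (lo k) \<noteq> y (hi k)" using y_mono[OF lh] by simp
        show "inj_on G {y (lo k)..y (hi k)}" using inj_on_subset[OF inj_y yr] .
      qed
      show "arc (subpath a b G)"
        unfolding arc_subpath_eq cs
      proof (intro conjI)
        show "path (subpath a b G)" using path_G ab z0 by (intro path_subpath) auto
        show "a \<noteq> b" using z_eq_iff[of qa qb] q by simp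
        show "inj_on G {z k..z (Suc k)}" using inj_on_subset[OF inj_z zr] .
      qed
      show "pathfinish (subpath (y (lo k)) (y (hi k)) G) = pathstart (subpath a b G)"
        "pathfinish (subpath a b G) = pathstart (subpath (y (lo k)) (y (hi k)) G)"
        using G_meet[of qa] G_meet[of qb] q by auto
      show "path_image (subpath (y (lo k)) (y (hi k)) G) \<inter> path_image (subpath a b G)
          \<subseteq> {pathstart (subpath (y (lo k)) (y (hi k)) G), pathstart (subpath a b G)}"
      proof
        fix w assume "w \<in> path_image (subpath (y (lo k)) (y (hi k)) G) \<inter> path_image (subpath a b G)"
        then obtain s t where st: "s \<in> {y (lo k)..y (hi k)}" "t \<in> {z k..z (Suc k)}" "w = G s" "w = G t"
          unfolding path_image_subpath_gen csy cs by auto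
        then have "s \<in> {0..z 0}" "t \<in> {z 0..1}" using yr zr by auto
        then obtain p where p: "p \<le> Suc n" "s = y (x p)" "t = z p" using meet[of s t] st by auto
        then have "\<not> p < k" "\<not> Suc k < p" using st k z_less_iff[of p k] z_less_iff[of "Suc k" p] by auto
        then have "p = k \<or> p = Suc k" by linarith
        then have "p = qa \<or> p = qb" by (auto simp: qa_def qb_def)
        then show "w \<in> {pathstart (subpath (y (lo k)) (y (hi k)) G), pathstart (subpath a b G)}"
          using st p q by auto
      qed
    qed
    show "pathfinish \<gamma> = pathstart \<gamma>" using G_meet[of qb] q by (simp add: \<gamma>_def)
    show "path_image \<gamma> = loop_image k"
    proof -
      have pf: "pathfinish (subpath (y (lo k)) (y (hi k)) G) = pathstart (subpath a b G)"
        using G_meet[of qa] q by simp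
      show ?thesis
        by (simp only: \<gamma>_def loop_image_def path_image_join[OF pf] path_image_subpath_gen csy cs)
    qed
    show "\<forall>s\<in>{0..1/2}. \<gamma> s = G ((y (hi k) - y (lo k)) * (2 * s) + y (lo k))"
      by (simp add: \<gamma>_def joinpaths_def subpath_def)
  qed
qed

lemma loop_sides:
  assumes k: "k \<le> n"
  obtains side where "side_function (loop_image k) side"
    "\<forall>t \<delta> d. 0 < \<delta> \<longrightarrow> y (lo k) < t - \<delta> \<longrightarrow> t + \<delta> < y (hi k) \<longrightarrow> d \<noteq> 0 \<longrightarrow>
       (\<forall>s. \<bar>s\<bar> \<le> \<delta> \<longrightarrow> G (t + s) = G t + of_real s * d) \<longrightarrow> left_side (loop_image k) side (G t) d"
proof -
  obtain \<gamma> where g: "simple_path \<gamma>" "pathfinish \<gamma> = pathstart \<gamma>" "path_image \<gamma> = loop_image k"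
    "\<forall>s\<in>{0..1/2}. \<gamma> s = G ((y (hi k) - y (lo k)) * (2 * s) + y (lo k))"
    by (rule loop_path[OF k])
  obtain side where side: "side_function (loop_image k) side"
    "\<forall>t \<delta> d. 0 < \<delta> \<longrightarrow> 0 < t - \<delta> \<longrightarrow> t + \<delta> < 1 \<longrightarrow> d \<noteq> 0 \<longrightarrow>
       (\<forall>s. \<bar>s\<bar> \<le> \<delta> \<longrightarrow> \<gamma> (t + s) = \<gamma> t + of_real s * d) \<longrightarrow> left_side (loop_image k) side (\<gamma> t) d"
    unfolding g(3)[symmetric] by (rule simple_loop_sides[OF g(1,2)])
  show thesis
  proof (rule that[OF side(1)], intro allI impI)
    fix t \<delta> :: real and d :: complex
    assume t: "0 < \<delta>" "y (lo k) < t - \<delta>" "t + \<delta> < y (hi k)" "d \<noteq> 0"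
      and lin: "\<forall>s. \<bar>s\<bar> \<le> \<delta> \<longrightarrow> G (t + s) = G t + of_real s * d"
    \<comment> \<open>The factor 2 comes from \<open>+++\<close>, which runs through the slit piece
      on \<open>{0..1/2}\<close>. Rescaling the velocity by \<open>L > 0\<close> does not change the
      sign that defines left.\<close>
    define L where "L = 2 * (y (hi k) - y (lo k))"
    have L: "L > 0" using t by (simp add: L_def)
    define t' where "t' = (t - y (lo k)) / L"
    define \<delta>' where "\<delta>' = \<delta> / L"
    have "(t - \<delta> - y (lo k)) / L > 0" "(t + \<delta> - y (lo k)) / L < 1/2"
      using t L by (simp_all add: divide_simps) (simp add: L_def)
    then have t': "0 < \<delta>'" "0 < t' - \<delta>'" "t' + \<delta>' < 1/2"
      using t L by (auto simp: t'_def \<delta>'_def diff_divide_distrib add_divide_distrib)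
    have gs: "\<gamma> (t' + s) = G (t + L * s)" if "\<bar>s\<bar> \<le> \<delta>'" for s
    proof -
      have "\<gamma> (t' + s) = G ((y (hi k) - y (lo k)) * (2 * (t' + s)) + y (lo k))"
        by (rule g(4)[rule_format]) (use that t' in auto)
      also have "(y (hi k) - y (lo k)) * (2 * (t' + s)) = L * (t' + s)" by (simp add: L_def algebra_simps)
      also have "\<dots> = t - y (lo k) + L * s" using L by (simp add: t'_def distrib_left)
      finally show ?thesis by (simp add: algebra_simps)
    qed
    have gs': "\<gamma> (t' + s) = \<gamma> t' + of_real s * (of_real L * d)" if "\<bar>s\<bar> \<le> \<delta>'" for s
    proof -
      have "\<bar>L * s\<bar> \<le> \<delta>" using that L by (simp add: abs_mult \<delta>'_def field_simps)
      then show ?thesis using gs[OF that] gs[of 0] lin t' by simp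
    qed
    have gt: "\<gamma> t' = G t" using gs[of 0] t' by simp
    have im: "Im (cnj (of_real L * d) * w) = L * Im (cnj d * w)" for w by (simp add: algebra_simps)
    have "of_real L * d \<noteq> 0" using L t by simp
    then have "left_side (loop_image k) side (\<gamma> t') (of_real L * d)"
      using side(2) t' gs' by (smt (verit) field_sum_of_halves)
    then show "left_side (loop_image k) side (G t) d"
      unfolding left_side_def im gt using L by (simp add: zero_less_mult_iff mult_less_0_iff)
  qed
qed

section \<open>Local pictures at a crossing\<close>

text \<open>A crossing has no preimages besides \<open>y (x q)\<close> and \<open>z q\<close>, so
  the part of the curve outside the two parameter windows is a compact set that misses it.\<close>

lemma near_crossing:
  assumes q: "1 \<le> q" "q \<le> n" and "\<epsilon> > 0"
  obtains r where "r > 0" "\<forall>a\<in>{0..1}. G a \<in> ball (G (z q)) r \<longrightarrow>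
     \<bar>a - y (x q)\<bar> < \<epsilon> \<or> \<bar>a - z q\<bar> < \<epsilon>"
proof -
  define K where "K = {0..1} - ball (y (x q)) \<epsilon> - ball (z q) \<epsilon>"
  have "compact K" unfolding K_def by (intro compact_diff) auto
  then have "compact (G ` K)"
    using path_G by (intro compact_continuous_image) (auto simp: path_def K_def intro: continuous_on_subset)
  moreover have "G (z q) \<notin> G ` K"
  proof
    assume "G (z q) \<in> G ` K"
    then obtain a where a: "a \<in> K" "G (z q) = G a" by blast
    have a01: "a \<in> {0..1}" using a by (simp add: K_def)
    have qr: "z q \<in> {z 0..1}" "y (x q) \<in> {0..z 0}" using q z_range[of q] y_range[of "x q"] x_le[of q] by auto
    show False
    proof (cases "a \<le> z 0")
      case True
      have "G a = G (y (x q))" using a(2) G_meet[of q] q by simp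
      then have "a = y (x q)" by (rule inj_onD[OF inj_y]) (use True a01 qr in auto)
      then show False using a \<open>\<epsilon> > 0\<close> by (simp add: K_def)
    next
      case False
      have "a = z q" by (rule inj_onD[OF inj_z]) (use False a01 qr a in auto)
      then show False using a \<open>\<epsilon> > 0\<close> by (simp add: K_def)
    qed
  qed
  ultimately have "open (- (G ` K))" "G (z q) \<in> - (G ` K)"
    by (auto intro: open_Compl compact_imp_closed)
  then obtain r where r: "r > 0" "ball (G (z q)) r \<subseteq> - (G ` K)"
    by (rule openE)
  show thesis
  proof (rule that[OF r(1)], intro ballI impI)
    fix a assume "a \<in> {0..1}" "G a \<in> ball (G (z q)) r"
    then have "a \<notin> K" using r by auto
    then show "\<bar>a - y (x q)\<bar> < \<epsilon> \<or> \<bar>a - z q\<bar> < \<epsilon>" using \<open>a \<in> {0..1}\<close>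
      by (auto simp: K_def dist_real_def abs_minus_commute)
  qed
qed

text \<open>\<open>\<epsilon>\<close> is at most half of the gap to each neighbouring marked
  parameter, so the windows around \<open>y (x q)\<close> and \<open>z q\<close> contain no other
  marked point.\<close>

lemma local_picture:
  assumes q: "1 \<le> q" "q \<le> n"
  obtains \<epsilon> r where "\<epsilon> > 0" "r > 0"
    "\<forall>s. \<bar>s\<bar> \<le> \<epsilon> \<longrightarrow> G (y (x q) + s) = G (z q) + of_real s * d q"
    "\<forall>s. \<bar>s\<bar> \<le> \<epsilon> \<longrightarrow> G (z q + s) = G (z q) + of_real s * e q"
    "\<forall>a\<in>{0..1}. G a \<in> ball (G (z q)) r \<longrightarrow> \<bar>a - y (x q)\<bar> < \<epsilon> \<or> \<bar>a - z q\<bar> < \<epsilon>"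
    "z (q - 1) < z q - \<epsilon>" "z q + \<epsilon> < z (Suc q)"
    "y (x q - 1) < y (x q) - \<epsilon>" "y (x q) + \<epsilon> < y (Suc (x q))"
    "1 \<le> x q" "x q \<le> n"
proof -
  have xq: "1 \<le> x q" "x q \<le> n"
    using q x_eq_iff[of q 0] x_eq_iff[of q "Suc n"] x_le[of q] x_0 x_last by auto
  obtain \<epsilon>0 where e0: "\<epsilon>0 > 0" "\<And>s. \<bar>s\<bar> \<le> \<epsilon>0 \<Longrightarrow>
      G (y (x q) + s) = G (z q) + of_real s * d q \<and> G (z q + s) = G (z q) + of_real s * e q"
    using local_G[OF q] by blast
  define \<epsilon> where "\<epsilon> = Min {\<epsilon>0, (z q - z (q - 1))/2, (z (Suc q) - z q)/2,
      (y (x q) - y (x q - 1))/2, (y (Suc (x q)) - y (x q))/2}"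
  have pos: "z (q - 1) < z q" "z q < z (Suc q)" "y (x q - 1) < y (x q)" "y (x q) < y (Suc (x q))"
    using q xq by (auto intro!: z_mono y_mono)
  have "\<epsilon> > 0" using e0 pos by (simp add: \<epsilon>_def)
  have le: "\<epsilon> \<le> \<epsilon>0" "\<epsilon> \<le> (z q - z (q - 1))/2" "\<epsilon> \<le> (z (Suc q) - z q)/2"
      "\<epsilon> \<le> (y (x q) - y (x q - 1))/2" "\<epsilon> \<le> (y (Suc (x q)) - y (x q))/2"
    unfolding \<epsilon>_def by (rule Min_le; simp)+
  obtain r where r: "r > 0" "\<forall>a\<in>{0..1}. G a \<in> ball (G (z q)) r \<longrightarrow>
     \<bar>a - y (x q)\<bar> < \<epsilon> \<or> \<bar>a - z q\<bar> < \<epsilon>"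
    by (rule near_crossing[OF q \<open>\<epsilon> > 0\<close>])
  show thesis
  proof (rule that[of \<epsilon> r])
    show "\<forall>s. \<bar>s\<bar> \<le> \<epsilon> \<longrightarrow> G (y (x q) + s) = G (z q) + of_real s * d q"
      "\<forall>s. \<bar>s\<bar> \<le> \<epsilon> \<longrightarrow> G (z q + s) = G (z q) + of_real s * e q"
      using e0(2) le by auto
    note * = le(2-5)[THEN le_half_imp_less, OF \<open>\<epsilon> > 0\<close>]
    show "z (q - 1) < z q - \<epsilon>" "z q + \<epsilon> < z (Suc q)"
      "y (x q - 1) < y (x q) - \<epsilon>" "y (x q) + \<epsilon> < y (Suc (x q))" using * by (auto simp: algebra_simps)
  qed (fact \<open>\<epsilon> > 0\<close> r xq)+
qed

text \<open>The pair \<open>(q, s)\<close> with \<open>s = 1\<close> or \<open>s = -1\<close> stands for the end of a chord that leaves the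
  crossing \<open>q\<close> forwards or backwards along the second strand.\<close>

definition chord_end :: "nat \<Rightarrow> nat \<Rightarrow> real \<Rightarrow> bool" where
  "chord_end l q s \<longleftrightarrow> (s = 1 \<and> q = l) \<or> (s = -1 \<and> q = Suc l)"

lemma convex_side: "convex {w. a * Im (cnj u * (w - c)) > 0}"
proof -
  have "{w. a * Im (cnj u * (w - c)) > 0} = {w. inner (of_real a * (\<i> * u)) w > a * Im (cnj u * c)}"
    by (auto simp: inner_complex_def algebra_simps)
  then show ?thesis by (simp add: convex_halfspace_gt)
qed

definition sided_on_slit :: "nat \<Rightarrow> (complex \<Rightarrow> bool) \<Rightarrow> bool" where
  "sided_on_slit k side \<longleftrightarrow>
     (\<forall>t \<delta> d. 0 < \<delta> \<longrightarrow> y (lo k) < t - \<delta> \<longrightarrow> t + \<delta> < y (hi k) \<longrightarrow> d \<noteq> 0 \<longrightarrow>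
       (\<forall>s. \<bar>s\<bar> \<le> \<delta> \<longrightarrow> G (t + s) = G t + of_real s * d) \<longrightarrow> left_side (loop_image k) side (G t) d)"

lemma side_beside_slit:
  assumes k: "k \<le> n" and lin: "sided_on_slit k side"
    and q: "1 \<le> q" "q \<le> n" "lo k \<le> x q" "x q \<le> hi k"
    and \<rho>: "\<rho> = 1 \<and> x q < hi k \<or> \<rho> = - 1 \<and> lo k < x q"
    and E: "\<epsilon> > 0" "r > 0"
    "\<forall>s. \<bar>s\<bar> \<le> \<epsilon> \<longrightarrow> G (y (x q) + s) = G (z q) + of_real s * d q"
    "y (x q - 1) < y (x q) - \<epsilon>" "y (x q) + \<epsilon> < y (Suc (x q))"
    "1 \<le> x q" "x q \<le> n"
  obtains \<tau> \<eta> where "\<tau> > 0" "\<tau> < \<epsilon>" "\<eta> > 0" "\<tau> * norm (e q) < r" "\<tau> * norm (d q) + \<eta> * norm (e q) < r"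
    "\<forall>\<sigma>\<in>{1,-1}. side (G (z q) + of_real (\<rho> * \<tau>) * d q + of_real (\<sigma> * \<eta>) * e q)
       = (\<sigma> * turn q > 0)"
proof -
  note lh = lo_hi[OF k]
  define c where "c = G (z q)"
  define J where "J = turn q"
  have J0: "J \<noteq> 0" using transversal[OF q(1,2)] by (auto simp: J_def)
  have d0: "d q \<noteq> 0" and e0: "e q \<noteq> 0" using transversal[OF q(1,2)] by auto
  obtain \<tau> where tau: "\<tau> > 0" "\<tau> < \<epsilon>" "\<tau> * norm (d q) < r" "\<tau> * norm (e q) < r"
  proof -
    define \<tau> where "\<tau> = Min {\<epsilon>/2, r / norm (d q) / 2, r / norm (e q) / 2}"
    have 1: "\<tau> > 0" using E d0 e0 by (simp add: \<tau>_def)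
    have "\<tau> \<le> \<epsilon>/2" "\<tau> \<le> r / norm (d q) / 2" "\<tau> \<le> r / norm (e q) / 2"
      unfolding \<tau>_def by (rule Min_le; simp)+
    then have "\<tau> < \<epsilon>" "\<tau> < r / norm (d q)" "\<tau> < r / norm (e q)" using 1 by (auto intro: le_half_imp_less)
    then have "\<tau> < \<epsilon>" "\<tau> * norm (d q) < r" "\<tau> * norm (e q) < r" using d0 e0
      by (auto simp: pos_less_divide_eq)
    then show thesis using that 1 by blast
  qed
  define t where "t = y (x q) + \<rho> * \<tau>"
  have trange: "y (lo k) < t" "t < y (hi k)" "\<bar>\<rho>\<bar> = 1"
  proof -
    have a: "y (x q) \<le> y (hi k)" using q lh by (intro y_le) auto
    have a': "y (lo k) \<le> y (x q)" using q lh by (intro y_le) auto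
    have b: "y (Suc (x q)) \<le> y (hi k)" if "x q < hi k" using q lh that by (intro y_le) auto
    have c: "y (lo k) \<le> y (x q - 1)" if "lo k < x q" using q lh that E by (intro y_le) auto
    show "y (lo k) < t" "t < y (hi k)" "\<bar>\<rho>\<bar> = 1" using a a' b c E(4,5) tau \<rho> by (auto simp: t_def)
  qed
  define \<delta> where "\<delta> = Min {\<epsilon> - \<tau>, (t - y (lo k))/2, (y (hi k) - t)/2}"
  have dpos: "\<delta> > 0" using tau trange by (simp add: \<delta>_def)
  have dle: "\<delta> \<le> \<epsilon> - \<tau>" "\<delta> \<le> (t - y (lo k))/2" "\<delta> \<le> (y (hi k) - t)/2"
    unfolding \<delta>_def by (rule Min_le; simp)+
  have gt: "G t = c + of_real (\<rho> * \<tau>) * d q" using E(3)[rule_format, of "\<rho> * \<tau>"] tau trange by (simp add: t_def c_def abs_mult)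
  have lint: "G (t + w) = G t + of_real w * d q" if "\<bar>w\<bar> \<le> \<delta>" for w
  proof -
    have "\<bar>\<rho> * \<tau> + w\<bar> \<le> \<epsilon>" using that dle tau \<rho> by auto
    then show ?thesis using E(3)[rule_format, of "\<rho> * \<tau> + w"] unfolding gt by (simp add: t_def c_def algebra_simps)
  qed
  have "left_side (loop_image k) side (G t) (d q)"
    by (rule lin[unfolded sided_on_slit_def, rule_format, of \<delta>]) (use dle trange dpos d0 lint in auto)
  then obtain r' where r': "r' > 0" "\<forall>z\<in>ball (G t) r'.
      (Im (cnj (d q) * (z - G t)) > 0 \<longrightarrow> z \<notin> loop_image k \<and> side z) \<and>
      (Im (cnj (d q) * (z - G t)) < 0 \<longrightarrow> z \<notin> loop_image k \<and> \<not> side z)"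
    unfolding left_side_def by blast
  \<comment> \<open>Small enough for the local sides at \<open>G t\<close> to apply, and for the
    point to stay in the ball of radius \<open>r\<close> after the shift by
    \<open>\<tau> * d q\<close>.\<close>
  define \<eta> where "\<eta> = min (r' / norm (e q) / 2) ((r - \<tau> * norm (d q)) / norm (e q) / 2)"
  have eta: "\<eta> > 0" "\<eta> * norm (e q) < r'" "\<eta> * norm (e q) < r - \<tau> * norm (d q)"
  proof -
    show 1: "\<eta> > 0" using r' tau e0 by (simp add: \<eta>_def)
    have "\<eta> \<le> r' / norm (e q) / 2" "\<eta> \<le> (r - \<tau> * norm (d q)) / norm (e q) / 2" by (auto simp: \<eta>_def)
    then have "\<eta> < r' / norm (e q)" "\<eta> < (r - \<tau> * norm (d q)) / norm (e q)" using 1 by (auto intro: le_half_imp_less)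
    then show "\<eta> * norm (e q) < r'" "\<eta> * norm (e q) < r - \<tau> * norm (d q)" using e0
      by (auto simp: pos_less_divide_eq)
  qed
  show thesis
  proof (rule that[OF tau(1,2) eta(1) tau(4)])
    show "\<tau> * norm (d q) + \<eta> * norm (e q) < r" using eta by simp
    show "\<forall>\<sigma>\<in>{1,-1}. side (G (z q) + of_real (\<rho> * \<tau>) * d q + of_real (\<sigma> * \<eta>) * e q)
       = (\<sigma> * turn q > 0)"
    proof
      fix \<sigma> :: real assume s: "\<sigma> \<in> {1, - 1}"
      define p where "p = G t + of_real (\<sigma> * \<eta>) * e q"
      have pt: "Im (cnj (d q) * (p - G t)) = \<eta> * (\<sigma> * J)" by (simp add: p_def J_def algebra_simps)
      have "p \<in> ball (G t) r'" using eta s by (auto simp: p_def dist_norm norm_mult)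
      then have "side p = (\<sigma> * J > 0)" using r'(2)[rule_format, of p] eta J0 s unfolding pt
        by (auto simp: zero_less_mult_iff mult_less_0_iff)
      then show "side (G (z q) + of_real (\<rho> * \<tau>) * d q + of_real (\<sigma> * \<eta>) * e q)
        = (\<sigma> * turn q > 0)"
        by (simp add: p_def gt c_def J_def)
    qed
  qed
qed

lemma loop_near_crossing:
  assumes kl: "k \<le> n" and q: "1 \<le> q" "q \<le> n"
    and E: "\<epsilon> > 0" "r > 0"
    "\<forall>s. \<bar>s\<bar> \<le> \<epsilon> \<longrightarrow> G (y (x q) + s) = G (z q) + of_real s * d q"
    "\<forall>s. \<bar>s\<bar> \<le> \<epsilon> \<longrightarrow> G (z q + s) = G (z q) + of_real s * e q"
    "\<forall>a\<in>{0..1}. G a \<in> ball (G (z q)) r \<longrightarrow> \<bar>a - y (x q)\<bar> < \<epsilon> \<or> \<bar>a - z q\<bar> < \<epsilon>"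
    "z (q - 1) < z q - \<epsilon>" "y (x q) + \<epsilon> < y (Suc (x q))" "x q \<le> n"
    and p: "p \<in> loop_image k" "p \<in> ball (G (z q)) r"
  obtains (slit) s where "\<bar>s\<bar> < \<epsilon>" "y (lo k) \<le> y (x q) + s" "y (x q) + s \<le> y (hi k)"
      "p = G (z q) + of_real s * d q"
  | (chord) s where "\<bar>s\<bar> < \<epsilon>" "z k \<le> z q + s" "z q + s \<le> z (Suc k)" "p = G (z q) + of_real s * e q"
proof -
  note lh = lo_hi[OF kl]
  obtain a where a: "a \<in> {y (lo k)..y (hi k)} \<union> {z k..z (Suc k)}" "p = G a"
    using p unfolding loop_image_def by blast
  have yz: "y (hi k) \<le> z 0" "y (lo k) \<ge> 0" "z k \<ge> z 0" "z (Suc k) \<le> 1"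
    using y_range[of "hi k"] y_range[of "lo k"] z_range[of k] z_range[of "Suc k"] kl lh by auto
  have "a \<in> {0..1}" using a yz z0 by auto
  then consider "\<bar>a - y (x q)\<bar> < \<epsilon>" | "\<bar>a - z q\<bar> < \<epsilon>"
    using E(5)[rule_format, of a] a p by auto
  then show thesis
  proof cases
    case 1
    \<comment> \<open>The window around \<open>y (x q)\<close> stays below \<open>z 0\<close>, so
      \<open>a\<close> belongs to the slit piece of the loop and not to its chord. The other case is
      symmetric.\<close>
    have "y (Suc (x q)) \<le> z 0" using E(8) y_range[of "Suc (x q)"] by auto
    then have "a < z 0" using 1 E(7) by (simp add: abs_less_iff)
    then have "y (lo k) \<le> a" "a \<le> y (hi k)" using a yz by auto
    then show thesis using that(1)[of "a - y (x q)"] 1 E(3)[rule_format, of "a - y (x q)"] a by simp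
  next
    case 2
    have "z 0 \<le> z (q - 1)" using q z_range[of "q - 1"] by auto
    then have "a > z 0" using 2 E(6) by (simp add: abs_less_iff)
    then have "z k \<le> a" "a \<le> z (Suc k)" using a yz by auto
    then show thesis using that(2)[of "a - z q"] 2 E(4)[rule_format, of "a - z q"] a by simp
  qed
qed

text \<open>The half-ball \<open>H\<close> on the side of the slit to which chord \<open>l\<close>
  leaves is free of the loop: the slit runs in its boundary line, and if chord \<open>k\<close> ends
  at the same crossing, it leaves to the other side because \<open>k \<noteq> l\<close>. Inside
  \<open>H\<close> the chord is connected to a point whose side is known.\<close>

lemma chord_label_on_arc:
  assumes kl: "k \<le> n" "l \<le> n" "k \<noteq> l"
    and side: "side_function (loop_image k) side" and lin: "sided_on_slit k side"
    and q: "1 \<le> q" "q \<le> n" "chord_end l q s" "lo k \<le> x q" "x q \<le> hi k"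
  shows "\<exists>t. z l < t \<and> t < z (Suc l) \<and> side (G t) = (s * turn q > 0)"
proof -
  obtain \<epsilon> r where E: "\<epsilon> > 0" "r > 0"
    "\<forall>s. \<bar>s\<bar> \<le> \<epsilon> \<longrightarrow> G (y (x q) + s) = G (z q) + of_real s * d q"
    "\<forall>s. \<bar>s\<bar> \<le> \<epsilon> \<longrightarrow> G (z q + s) = G (z q) + of_real s * e q"
    "\<forall>a\<in>{0..1}. G a \<in> ball (G (z q)) r \<longrightarrow> \<bar>a - y (x q)\<bar> < \<epsilon> \<or> \<bar>a - z q\<bar> < \<epsilon>"
    "z (q - 1) < z q - \<epsilon>" "z q + \<epsilon> < z (Suc q)"
    "y (x q - 1) < y (x q) - \<epsilon>" "y (x q) + \<epsilon> < y (Suc (x q))"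
    "1 \<le> x q" "x q \<le> n"
    by (rule local_picture[OF q(1,2)])
  note lh = lo_hi[OF kl(1)]
  have s: "s = 1 \<or> s = -1" using q by (auto simp: chord_end_def)
  define c where "c = G (z q)"
  define J where "J = s * turn q"
  have J0: "J \<noteq> 0" using transversal[OF q(1,2)] s by (auto simp: J_def)
  define H where "H = ball c r \<inter> {w. J * Im (cnj (d q) * (w - c)) > 0}"
  have conH: "connected H" unfolding H_def
    by (intro convex_connected convex_Int convex_ball convex_side)
  have HC: "H \<inter> loop_image k = {}"
  proof (rule ccontr)
    assume "H \<inter> loop_image k \<noteq> {}"
    then obtain p where p: "p \<in> loop_image k" "p \<in> H" by blast
    then have pb: "p \<in> ball (G (z q)) r" by (simp add: H_def c_def)
    show False
    proof (rule loop_near_crossing[OF kl(1) q(1,2) E(1-6,9,11) p(1) pb])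
      fix w assume 1: "p = G (z q) + of_real w * d q"
      then have "Im (cnj (d q) * (p - c)) = 0" by (intro Im_cnj_mult_of_real_self[of _ w]) (simp add: c_def)
      then show False using p by (simp add: H_def)
    next
      fix w assume 2: "\<bar>w\<bar> < \<epsilon>" "z k \<le> z q + w" "z q + w \<le> z (Suc k)" "p = G (z q) + of_real w * e q"
      \<comment> \<open>A piece of chord \<open>k\<close> near the crossing belongs to the neighbour
        of chord \<open>l\<close> there, which is chord \<open>q - 1\<close> if \<open>l = q\<close>
        and chord \<open>q\<close> if \<open>q = Suc l\<close>. So it runs away from the crossing in
        the opposite direction.\<close>
      have "s * w \<le> 0"
      proof (cases "s = 1")
        case True
        then have "q = l" using q(3) by (auto simp: chord_end_def)
        moreover have "z k < z (Suc q)" using 2 E(7) by linarith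
        then have "k < Suc q" using z_less_iff[of k "Suc q"] kl q by auto
        ultimately have "k < q" using kl by auto
        then have "z (Suc k) \<le> z q" using q by (intro z_le) auto
        then show ?thesis using 2 True by simp
      next
        case False
        then have s': "s = -1" using s by simp
        then have "q = Suc l" using q(3) by (auto simp: chord_end_def)
        moreover have "z (q - 1) < z (Suc k)" using 2 E(6) by simp
        then have "q - 1 < Suc k" using z_less_iff[of "q - 1" "Suc k"] kl q by auto
        ultimately have "q \<le> k" using kl by auto
        then have "z q \<le> z k" using kl by (intro z_le) auto
        then show ?thesis using 2 s' by simp
      qed
      then have "s * w * (turn q)^2 \<le> 0" by (simp add: mult_le_0_iff)
      moreover have "Im (cnj (d q) * (p - c)) = w * turn q"
        unfolding 2(4) c_def by (simp add: algebra_simps)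
      ultimately have "J * Im (cnj (d q) * (p - c)) \<le> 0"
        by (simp add: J_def power2_eq_square mult_ac)
      then show False using p by (simp add: H_def)
    qed
  qed
  define \<rho> where "\<rho> = (if x q = lo k then 1 else - 1 :: real)"
  have rho: "\<rho> = 1 \<and> x q < hi k \<or> \<rho> = - 1 \<and> lo k < x q" using lh q by (auto simp: \<rho>_def)
  obtain \<tau> \<eta> where te: "\<tau> > 0" "\<tau> < \<epsilon>" "\<eta> > 0" "\<tau> * norm (e q) < r" "\<tau> * norm (d q) + \<eta> * norm (e q) < r"
    "\<forall>\<sigma>\<in>{1,-1}. side (G (z q) + of_real (\<rho> * \<tau>) * d q + of_real (\<sigma> * \<eta>) * e q)
       = (\<sigma> * turn q > 0)"
    by (rule side_beside_slit[OF kl(1) lin q(1,2,4,5) rho E(1-3,8-11)])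
  have p1: "G (z q + s * \<tau>) \<in> H"
  proof -
    have g: "G (z q + s * \<tau>) = c + of_real (s * \<tau>) * e q" using E(4)[rule_format, of "s * \<tau>"] s te by (auto simp: c_def)
    have "J * Im (cnj (d q) * (G (z q + s * \<tau>) - c)) = \<tau> * J^2"
      unfolding g by (simp add: J_def power2_eq_square algebra_simps)
    moreover have "G (z q + s * \<tau>) \<in> ball c r" unfolding g using s te by (auto simp: dist_norm norm_mult)
    ultimately show ?thesis using te J0 by (simp add: H_def)
  qed
  define p where "p = c + of_real (\<rho> * \<tau>) * d q + of_real (s * \<eta>) * e q"
  have sp: "side p = (J > 0)" using te(6) s by (auto simp: p_def c_def J_def)
  have "p \<in> H"
  proof -
    have pc: "p - c = of_real (\<rho> * \<tau>) * d q + of_real (s * \<eta>) * e q" by (simp add: p_def)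
    have "norm (p - c) \<le> \<tau> * norm (d q) + \<eta> * norm (e q)"
      unfolding pc by (rule norm_triangle_le) (use rho te s in \<open>auto simp: norm_mult abs_mult\<close>)
    then have "p \<in> ball c r" using te by (simp add: dist_norm norm_minus_commute)
    moreover have "J * Im (cnj (d q) * (p - c)) = \<eta> * J^2"
      unfolding pc by (simp add: J_def power2_eq_square algebra_simps)
    then have "J * Im (cnj (d q) * (p - c)) > 0" using te J0 by simp
    ultimately show ?thesis by (simp add: H_def)
  qed
  then have "side (G (z q + s * \<tau>)) = (J > 0)" using side[unfolded side_function_def] conH HC p1 sp by blast
  moreover have "z l < z q + s * \<tau>" "z q + s * \<tau> < z (Suc l)"
    using q(3) te E(6,7) by (auto simp: chord_end_def)
  ultimately show ?thesis unfolding J_def by blast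
qed

text \<open>Beyond a foot of chord \<open>k\<close> the slit lies in the outer angle of the corner.
  It is reached from a point beside the arc, on the side away from the chord, through two half-balls
  that miss the loop: \<open>H\<close>, across the slit line from the chord, and \<open>H'\<close>,
  across the chord line from the arc. The point with coordinates \<open>- \<rho> * \<tau>\<close>
  along the slit and \<open>- s * \<eta>\<close> along the chord lies in both.\<close>

lemma slit_label_off_arc:
  assumes k: "k \<le> n" and side: "side_function (loop_image k) side" and lin: "sided_on_slit k side"
    and q: "1 \<le> q" "q \<le> n" "chord_end k q s"
    and \<rho>: "\<rho> = 1 \<and> x q = lo k \<or> \<rho> = - 1 \<and> x q = hi k"
  shows "\<exists>\<tau>>0. y (x q - 1) < y (x q) - \<tau> \<and> y (x q) + \<tau> < y (Suc (x q)) \<and>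
     side (G (y (x q) - \<rho> * \<tau>)) = (s * turn q < 0)"
proof -
  obtain \<epsilon> r where E: "\<epsilon> > 0" "r > 0"
    "\<forall>s. \<bar>s\<bar> \<le> \<epsilon> \<longrightarrow> G (y (x q) + s) = G (z q) + of_real s * d q"
    "\<forall>s. \<bar>s\<bar> \<le> \<epsilon> \<longrightarrow> G (z q + s) = G (z q) + of_real s * e q"
    "\<forall>a\<in>{0..1}. G a \<in> ball (G (z q)) r \<longrightarrow> \<bar>a - y (x q)\<bar> < \<epsilon> \<or> \<bar>a - z q\<bar> < \<epsilon>"
    "z (q - 1) < z q - \<epsilon>" "z q + \<epsilon> < z (Suc q)"
    "y (x q - 1) < y (x q) - \<epsilon>" "y (x q) + \<epsilon> < y (Suc (x q))"
    "1 \<le> x q" "x q \<le> n"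
    by (rule local_picture[OF q(1,2)])
  note lh = lo_hi[OF k]
  have s: "s = 1 \<or> s = -1" using q by (auto simp: chord_end_def)
  define c where "c = G (z q)"
  define J where "J = s * turn q"
  define K where "K = Im (cnj (e q) * d q)"
  have J0: "J \<noteq> 0" using transversal[OF q(1,2)] s by (auto simp: J_def)
  have KJ: "K = - s * J" using s by (auto simp: K_def J_def algebra_simps)
  have K0: "K \<noteq> 0" using J0 s KJ by auto
  have rho: "\<rho> = 1 \<and> x q < hi k \<or> \<rho> = - 1 \<and> lo k < x q" and rho1: "\<rho> = 1 \<or> \<rho> = -1"
    and xq: "lo k \<le> x q" "x q \<le> hi k" using lh \<rho> by auto
  obtain \<tau> \<eta> where te: "\<tau> > 0" "\<tau> < \<epsilon>" "\<eta> > 0" "\<tau> * norm (e q) < r" "\<tau> * norm (d q) + \<eta> * norm (e q) < r"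
    "\<forall>\<sigma>\<in>{1,-1}. side (G (z q) + of_real (\<rho> * \<tau>) * d q + of_real (\<sigma> * \<eta>) * e q)
       = (\<sigma> * turn q > 0)"
    by (rule side_beside_slit[OF k lin q(1,2) xq rho E(1-3,8-11)])
  define H where "H = ball c r \<inter> {w. (- J) * Im (cnj (d q) * (w - c)) > 0}"
  define H' where "H' = ball c r \<inter> {w. (- \<rho> * K) * Im (cnj (e q) * (w - c)) > 0}"
  have conH: "connected H" "connected H'" unfolding H_def H'_def
    by (intro convex_connected convex_Int convex_ball convex_side)+
  have off: "H \<inter> loop_image k = {}" "H' \<inter> loop_image k = {}"
  proof -
    have "p \<notin> H \<and> p \<notin> H'" if p: "p \<in> loop_image k" for p
    proof (rule ccontr)
      assume h: "\<not> (p \<notin> H \<and> p \<notin> H')"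
      then have pb: "p \<in> ball (G (z q)) r" by (auto simp: H_def H'_def c_def)
      show False
      proof (rule loop_near_crossing[OF k q(1,2) E(1-6,9,11) p pb])
        fix w assume 1: "\<bar>w\<bar> < \<epsilon>" "y (lo k) \<le> y (x q) + w" "y (x q) + w \<le> y (hi k)"
          "p = G (z q) + of_real w * d q"
        then have "Im (cnj (d q) * (p - c)) = 0" by (intro Im_cnj_mult_of_real_self[of _ w]) (simp add: c_def)
        moreover have "\<rho> * w \<ge> 0" using \<rho> 1 by auto
        then have "\<rho> * w * K^2 \<ge> 0" by simp
        moreover have "Im (cnj (e q) * (p - c)) = w * K"
          unfolding 1(4) c_def K_def by (simp add: algebra_simps)
        ultimately show False using h by (auto simp: H_def H'_def power2_eq_square mult_ac)
      next
        fix w assume 2: "\<bar>w\<bar> < \<epsilon>" "z k \<le> z q + w" "z q + w \<le> z (Suc k)" "p = G (z q) + of_real w * e q"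
        then have "Im (cnj (e q) * (p - c)) = 0" by (intro Im_cnj_mult_of_real_self[of _ w]) (simp add: c_def)
        moreover have "s * w \<ge> 0" using q(3) 2 by (auto simp: chord_end_def)
        then have "s * w * (turn q)^2 \<ge> 0" by simp
        moreover have "Im (cnj (d q) * (p - c)) = w * turn q"
          unfolding 2(4) c_def by (simp add: algebra_simps)
        ultimately show False using h by (auto simp: H_def H'_def J_def power2_eq_square mult_ac)
      qed
    qed
    then show "H \<inter> loop_image k = {}" "H' \<inter> loop_image k = {}" by auto
  qed
  have inball: "c + of_real a * d q + of_real b * e q \<in> ball c r" if "\<bar>a\<bar> = \<tau>" "\<bar>b\<bar> \<le> \<eta>" for a b
  proof -
    have "norm (of_real a * d q + of_real b * e q) \<le> \<tau> * norm (d q) + \<eta> * norm (e q)"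
      by (rule norm_triangle_le) (use that in \<open>auto simp: norm_mult intro!: add_mono mult_right_mono\<close>)
    moreover have "dist c (c + of_real a * d q + of_real b * e q) = norm (of_real a * d q + of_real b * e q)"
      by (metis add.assoc add_diff_cancel_left' dist_commute dist_norm)
    ultimately show ?thesis using te(5) by simp
  qed
  have inH: "c + of_real a * d q + of_real (- s * \<eta>) * e q \<in> H" if "\<bar>a\<bar> = \<tau>" for a
  proof -
    have "(- J) * Im (cnj (d q) * (c + of_real a * d q + of_real (- s * \<eta>) * e q - c)) = \<eta> * J^2"
      by (simp add: J_def power2_eq_square algebra_simps)
    then have "(- J) * Im (cnj (d q) * (c + of_real a * d q + of_real (- s * \<eta>) * e q - c)) > 0"
      using te J0 by simp
    then show ?thesis unfolding H_def using inball[of a "- s * \<eta>"] that s te by auto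
  qed
  have inH': "c + of_real (- \<rho> * \<tau>) * d q + of_real b * e q \<in> H'" if "\<bar>b\<bar> \<le> \<eta>" for b
  proof -
    have "(- \<rho> * K) * Im (cnj (e q) * (c + of_real (- \<rho> * \<tau>) * d q + of_real b * e q - c)) = \<rho>^2 * \<tau> * K^2"
      by (simp add: K_def power2_eq_square algebra_simps)
    then have "(- \<rho> * K) * Im (cnj (e q) * (c + of_real (- \<rho> * \<tau>) * d q + of_real b * e q - c)) > 0"
      using te K0 rho1 by auto
    then show ?thesis unfolding H'_def using inball[of "- \<rho> * \<tau>" b] that rho1 te by auto
  qed
  have "side (c + of_real (\<rho> * \<tau>) * d q + of_real (- s * \<eta>) * e q)
      = side (c + of_real (- \<rho> * \<tau>) * d q + of_real (- s * \<eta>) * e q)"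
    by (rule side[unfolded side_function_def, rule_format, OF conH(1) off(1)]; rule inH)
      (use rho1 te(1) in \<open>auto simp: abs_mult\<close>)
  also have "\<dots> = side (c + of_real (- \<rho> * \<tau>) * d q + of_real 0 * e q)"
    by (rule side[unfolded side_function_def, rule_format, OF conH(2) off(2)]; rule inH')
      (use s te(3) in \<open>auto simp: abs_mult\<close>)
  also have "c + of_real (- \<rho> * \<tau>) * d q + of_real 0 * e q = G (y (x q) - \<rho> * \<tau>)"
    using E(3)[rule_format, of "- \<rho> * \<tau>"] rho1 te by (auto simp: c_def)
  finally have "side (G (y (x q) - \<rho> * \<tau>)) = (s * turn q < 0)"
    using te(6) s by (auto simp: c_def)
  then show ?thesis using te E(8,9) by (intro exI[of _ \<tau>]) auto
qed

section \<open>Sides of whole chords\<close>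

lemma slit_off_loop:
  assumes k: "k \<le> n" and t: "t \<in> {0..z 0}" "t < y (lo k) \<or> y (hi k) < t"
  shows "G t \<notin> loop_image k"
proof
  note lh = lo_hi[OF k]
  assume "G t \<in> loop_image k"
  then consider a where "a \<in> {y (lo k)..y (hi k)}" "G t = G a" | a where "a \<in> {z k..z (Suc k)}" "G t = G a"
    unfolding loop_image_def by blast
  then show False
  proof cases
    case 1
    then have "a \<in> {0..z 0}" using y_range[of "lo k"] y_range[of "hi k"] lh by auto
    then have "t = a" using inj_onD[OF inj_y 1(2)] t by blast
    then show False using 1 t by auto
  next
    case 2
    then have "a \<in> {z 0..1}" using z_range[of k] z_range[of "Suc k"] k by auto
    then obtain q where q: "q \<le> Suc n" "t = y (x q)" "a = z q" using meet[OF t(1) _ 2(2)] by blast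
    then have "\<not> q < k" "\<not> Suc k < q" using 2 z_less_iff[of q k] z_less_iff[of "Suc k" q] k by auto
    then have "q = k \<or> q = Suc k" by linarith
    then have "lo k \<le> x q" "x q \<le> hi k" by (auto simp: lo_def hi_def)
    then have "y (lo k) \<le> t" "t \<le> y (hi k)" using q lh by (auto intro!: y_le)
    then show False using t by auto
  qed
qed

lemma chord_off_loop:
  assumes k: "k \<le> n" "l \<le> n" "k \<noteq> l" and t: "z l < t" "t < z (Suc l)"
  shows "G t \<notin> loop_image k"
proof
  note lh = lo_hi[OF k(1)]
  have t01: "t \<in> {z 0..1}" using t z_range[of l] z_range[of "Suc l"] k by auto
  assume "G t \<in> loop_image k"
  then consider a where "a \<in> {y (lo k)..y (hi k)}" "G a = G t" | a where "a \<in> {z k..z (Suc k)}" "G a = G t"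
    unfolding loop_image_def by (metis UnE imageE)
  then show False
  proof cases
    case 1
    then have "a \<in> {0..z 0}" using y_range[of "lo k"] y_range[of "hi k"] lh by auto
    then obtain q where q: "q \<le> Suc n" "a = y (x q)" "t = z q" using meet[OF _ t01 1(2)] by blast
    then have "l < q" "q < Suc l" using t z_less_iff[of l q] z_less_iff[of q "Suc l"] k by auto
    then show False by simp
  next
    case 2
    then have "a \<in> {z 0..1}" using z_range[of k] z_range[of "Suc k"] k by auto
    then have "a = t" using inj_onD[OF inj_z 2(2)] t01 by blast
    then have "z l < z (Suc k)" "z k < z (Suc l)" using 2 t by auto
    then have "l < Suc k" "k < Suc l" using z_less_iff[of l "Suc k"] z_less_iff[of k "Suc l"] k by auto
    then show False using k by simp
  qed
qed

text \<open>\<open>turn q > 0\<close> means that the second strand crosses the slit from right to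
  left. At the ends of the slit the values are conventions; false at \<open>Suc n\<close> makes the
  last chord arrive at position \<open>0\<close> and not at \<open>2 * n + 2\<close>.\<close>

definition leftwards :: "nat \<Rightarrow> bool" where
  "leftwards q \<longleftrightarrow> q = 0 \<or> q \<le> n \<and> turn q > 0"

definition left_end :: "nat \<Rightarrow> real \<Rightarrow> bool" where
  "left_end q s \<longleftrightarrow> (if s = 1 then leftwards q else \<not> leftwards q)"

lemma left_end_iff:
  assumes "1 \<le> q" "q \<le> n" "s = 1 \<or> s = - 1"
  shows "left_end q s \<longleftrightarrow> s * turn q > 0" "\<not> left_end q s \<longleftrightarrow> s * turn q < 0"
  using transversal[OF assms(1,2)] assms by (auto simp: left_end_def leftwards_def)

lemma connected_G_image: "connected S \<Longrightarrow> S \<subseteq> {0..1} \<Longrightarrow> connected (G ` S)"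
  using path_G by (auto simp: path_def intro!: connected_continuous_image intro: continuous_on_subset)

text \<open>A foot on the arc gives the side directly. From any other foot one walks along the slit,
  off the loop, to the nearest corner; the slit just outside a corner lies opposite to the side on
  which chord \<open>k\<close> leaves it, hence the negations in the outer cases.\<close>

lemma chord_label:
  assumes kl: "k \<le> n" "l \<le> n" "k \<noteq> l"
    and side: "side_function (loop_image k) side" and lin: "sided_on_slit k side"
    and a: "chord_end k qa sa" "x qa = lo k" and b: "chord_end k qb sb" "x qb = hi k"
    and q: "chord_end l q s" and t: "z l < t" "t < z (Suc l)"
  shows "side (G t) = (if x q < lo k then \<not> left_end qa sa else if hi k < x q then \<not> left_end qb sb else left_end q s)"
proof -
  note lh = lo_hi[OF kl(1)]
  note side' = side[unfolded side_function_def, rule_format]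
  have qn: "q \<le> Suc n" "qa \<le> Suc n" "qb \<le> Suc n" using q a b kl by (auto simp: chord_end_def)
  have s1: "s = 1 \<or> s = -1" "sa = 1 \<or> sa = -1" "sb = 1 \<or> sb = -1" using q a b by (auto simp: chord_end_def)
  have zl: "{z l<..<z (Suc l)} \<subseteq> {0..1}" "z l \<ge> 0" "z (Suc l) \<le> 1"
    using z_range[of l] z_range[of "Suc l"] kl z0 by auto
  have open_chord: "side (G t') = side (G t)" if "z l < t'" "t' < z (Suc l)" for t'
    by (rule side'[OF connected_G_image[of "{z l<..<z (Suc l)}"]]) (use chord_off_loop[OF kl] zl that t in auto)
  have foot: "side (G t) = side (G (y (x q)))" if "x q < lo k \<or> hi k < x q"
  proof -
    have xn: "x q \<le> Suc n" using x_le qn by auto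
    have "y (x q) < y (lo k) \<or> y (hi k) < y (x q)"
      using that y_less_iff[of "x q" "lo k"] y_less_iff[of "hi k" "x q"] xn lh by auto
    then have off: "G (y (x q)) \<notin> loop_image k" using slit_off_loop[OF kl(1), of "y (x q)"] y_range[OF xn] by auto
    \<comment> \<open>Adding the foot to the open parameter interval of the chord gives a half-open
      interval, so the label passes from the chord to its foot.\<close>
    have S: "{z l<..<z (Suc l)} \<union> {z q} = {z l..<z (Suc l)} \<or> {z l<..<z (Suc l)} \<union> {z q} = {z l<..z (Suc l)}"
      using q t by (auto simp: chord_end_def)
    then have "connected ({z l<..<z (Suc l)} \<union> {z q})" by (metis connected_Ico connected_Ioc)
    moreover have "{z l<..<z (Suc l)} \<union> {z q} \<subseteq> {0..1}" using zl z_range[OF qn(1)] z0 by auto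
    moreover have "G ` ({z l<..<z (Suc l)} \<union> {z q}) \<inter> loop_image k = {}"
      using chord_off_loop[OF kl] off G_meet[OF qn(1)] by auto
    ultimately have "side (G t) = side (G (z q))"
      by (intro side'[OF connected_G_image]) (use t in auto)
    then show ?thesis using G_meet[OF qn(1)] by simp
  qed
  consider "x q < lo k" | "hi k < x q" | "lo k \<le> x q" "x q \<le> hi k" by linarith
  then show ?thesis
  proof cases
    case 1
    then have "lo k \<noteq> 0" "lo k \<noteq> Suc n" using lh by auto
    then have qa: "1 \<le> qa" "qa \<le> n" using a qn x_0 x_last by (auto simp: Suc_le_eq le_Suc_eq intro: gr0I)
    obtain \<tau> where tau: "\<tau> > 0" "y (lo k - 1) < y (lo k) - \<tau>"
        "side (G (y (lo k) - \<tau>)) = (sa * Im (cnj (d qa) * e qa) < 0)"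
      using slit_label_off_arc[OF kl(1) side lin qa a(1), of 1] a(2) by auto
    have "y (lo k - 1) \<ge> 0" "y (lo k) \<le> z 0" using y_range[of "lo k - 1"] y_range[of "lo k"] lh by auto
    then have r: "y (lo k) - \<tau> \<in> {0..<y (lo k)}" "y (x q) \<in> {0..<y (lo k)}" "{0..<y (lo k)} \<subseteq> {0..z 0}" "{0..<y (lo k)} \<subseteq> {0..1}"
      using tau y_range[of "x q"] y_mono[OF 1] lh z0 1 by auto
    have "side (G (y (x q))) = side (G (y (lo k) - \<tau>))"
      by (rule side'[OF connected_G_image[OF _ r(4)]]) (use r slit_off_loop[OF kl(1)] in auto)
    then show ?thesis using foot 1 tau left_end_iff(2)[OF qa s1(2)] by auto
  next
    case 2
    have "x q \<le> Suc n" using x_le qn by auto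
    then have "hi k \<noteq> 0" "hi k \<noteq> Suc n" using lh 2 by auto
    then have qb: "1 \<le> qb" "qb \<le> n" using b qn x_0 x_last by (auto simp: Suc_le_eq le_Suc_eq intro: gr0I)
    obtain \<tau> where tau: "\<tau> > 0" "y (hi k) + \<tau> < y (Suc (hi k))"
        "side (G (y (hi k) + \<tau>)) = (sb * Im (cnj (d qb) * e qb) < 0)"
      using slit_label_off_arc[OF kl(1) side lin qb b(1), of "-1"] b(2) by auto
    have "y (Suc (hi k)) \<le> z 0" "0 \<le> y (hi k)" using y_range[of "Suc (hi k)"] y_range[of "hi k"] lh \<open>hi k \<noteq> Suc n\<close> by auto
    then have r: "y (hi k) + \<tau> \<in> {y (hi k)<..z 0}" "y (x q) \<in> {y (hi k)<..z 0}" "{y (hi k)<..z 0} \<subseteq> {0..z 0}" "{y (hi k)<..z 0} \<subseteq> {0..1}"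
      using tau y_range[of "x q"] y_mono[OF 2] \<open>x q \<le> Suc n\<close> lh z0 2 by auto
    have "side (G (y (x q))) = side (G (y (hi k) + \<tau>))"
      by (rule side'[OF connected_G_image[OF _ r(4)]]) (use r slit_off_loop[OF kl(1)] in auto)
    then show ?thesis using foot 2 tau left_end_iff(2)[OF qb s1(3)] lh by auto
  next
    case 3
    \<comment> \<open>Chord \<open>0\<close> starts at the end of the slit, which lies on the arc
      only as the upper foot of chord \<open>k\<close>; that would force \<open>k = 0 = l\<close>.
      Likewise for the start of the slit and the last chord.\<close>
    have "q \<noteq> 0"
    proof
      assume "q = 0"
      then have "x qb = x q" using 3 b lh x_0 by simp
      then have "qb = q" using x_eq_iff qn by blast
      then show False using \<open>q = 0\<close> q b kl by (auto simp: chord_end_def)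
    qed
    moreover have "q \<noteq> Suc n"
    proof
      assume "q = Suc n"
      then have "x qa = x q" using 3 a lh x_last by simp
      then have "qa = q" using x_eq_iff qn by blast
      then show False using \<open>q = Suc n\<close> q a kl by (auto simp: chord_end_def)
    qed
    ultimately have q1: "1 \<le> q" "q \<le> n" using qn by auto
    obtain t' where "z l < t'" "t' < z (Suc l)" "side (G t') = (s * turn q > 0)"
      using chord_label_on_arc[OF kl side lin q1 q 3] by blast
    then show ?thesis using open_chord[of t'] left_end_iff(1)[OF q1 s1(1)] 3 by simp
  qed
qed

text \<open>Both ends of chord \<open>l\<close> compute the side of the same point
  \<open>G t\<close>, and each of them is enclosed by chord \<open>k\<close> exactly if this side is
  the one on which chord \<open>k\<close> leaves its lower foot.\<close>

theorem chords_do_not_cross: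
  assumes kl: "k \<le> n" "l \<le> n" "k \<noteq> l"
  shows "between (position n (x k) (leftwards k)) (position n (x (Suc k)) (\<not> leftwards (Suc k))) (position n (x l) (leftwards l))
     = between (position n (x k) (leftwards k)) (position n (x (Suc k)) (\<not> leftwards (Suc k))) (position n (x (Suc l)) (\<not> leftwards (Suc l)))"
proof -
  note lh = lo_hi[OF kl(1)]
  obtain side where side: "side_function (loop_image k) side" and lin: "sided_on_slit k side"
    unfolding sided_on_slit_def by (rule loop_sides[OF kl(1)])
  define qa sa qb sb where "qa = (if x k = lo k then k else Suc k)" "sa = (if x k = lo k then 1 else -1 :: real)"
    "qb = (if x k = lo k then Suc k else k)" "sb = (if x k = lo k then -1 else 1 :: real)"
  note defs = this
  have ab: "chord_end k qa sa" "x qa = lo k" "chord_end k qb sb" "x qb = hi k"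
    by (auto simp: defs chord_end_def lo_def hi_def min_def max_def)
  define t where "t = (z l + z (Suc l)) / 2"
  have "z l < z (Suc l)" using kl by (intro z_mono) auto
  then have t: "z l < t" "t < z (Suc l)" by (auto simp: t_def)
  have K: "between (position n (x k) (leftwards k)) (position n (x (Suc k)) (\<not> leftwards (Suc k)))
     = between (position n (lo k) (left_end qa sa)) (position n (hi k) (left_end qb sb))"
  proof (cases "x k = lo k")
    case True
    then show ?thesis using ab by (simp add: defs left_end_def)
  next
    case False
    have comm: "between a b = between b a" for a b by (rule HOL.ext) (rule between_commute)
    show ?thesis by (subst comm) (use ab False in \<open>simp add: defs left_end_def\<close>)
  qed
  have "between (position n (lo k) (left_end qa sa)) (position n (hi k) (left_end qb sb)) (position n (x q) (left_end q s))
     = (side (G t) = left_end qa sa)" if q: "chord_end l q s" for q s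
  proof -
    have qn: "q \<le> Suc n" "qa \<le> Suc n" "qb \<le> Suc n" using q ab kl by (auto simp: chord_end_def)
    have zero: "left_end p s'" if "x p = 0" "chord_end m p s'" "p \<le> Suc n" "m \<le> n" for p s' m
    proof -
      have "p = Suc n" using x_eq_iff[of p "Suc n"] x_last that by auto
      moreover from this have "s' = - 1" using that by (auto simp: chord_end_def)
      ultimately show ?thesis by (simp add: left_end_def leftwards_def)
    qed
    \<comment> \<open>Chords that share a crossing meet it from opposite sides, one arriving and one
      leaving; an end of the slit belongs to one chord only.\<close>
    have opp: "q = p \<Longrightarrow> left_end q s = (\<not> left_end p s') \<and> p \<noteq> 0 \<and> p \<noteq> Suc n" if "chord_end k p s'" for p s'
      using that q kl by (auto simp: chord_end_def left_end_def)
    have "between (position n (lo k) (left_end qa sa)) (position n (hi k) (left_end qb sb)) (position n (x q) (left_end q s))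
      = ((if x q < lo k then \<not> left_end qa sa else if hi k < x q then \<not> left_end qb sb else left_end q s) = left_end qa sa)"
    proof (rule between_position[OF lh])
      show "x q \<le> Suc n" using x_le qn by auto
      show "left_end qa sa" if "lo k = 0" using zero[of qa k sa] ab that qn kl by auto
      show "left_end q s" if "x q = 0" using zero[of q l s] q that qn kl by auto
      show "lo k \<noteq> 0 \<and> left_end q s = (\<not> left_end qa sa)" if "x q = lo k"
      proof -
        have "q = qa" using that ab x_eq_iff[of q qa] qn by auto
        then show ?thesis using opp[OF ab(1)] ab(2) x_eq_iff[of qa "Suc n"] x_last qn by auto
      qed
      show "hi k \<noteq> Suc n \<and> left_end q s = (\<not> left_end qb sb)" if "x q = hi k"
      proof -
        have "q = qb" using that ab x_eq_iff[of q qb] qn by auto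
        then show ?thesis using opp[OF ab(3)] ab(4) x_eq_iff[of qb 0] x_0 qn by auto
      qed
    qed
    then show ?thesis using chord_label[OF kl side lin ab q t] by simp
  qed
  from this[of l 1] this[of "Suc l" "-1"] show ?thesis
    unfolding K by (simp add: chord_end_def left_end_def)
qed

end


section \<open>From diagrams to chord systems\<close>

text \<open>Of two distinct entries the one met later has the other among its predecessors, so its
  set of predecessors is strictly larger.\<close>

lemma encounter_label_inj:
  assumes "u \<in> set xs" "v \<in> set xs"
    "card (set (takeWhile (\<lambda>y. y \<noteq> u) xs)) = card (set (takeWhile (\<lambda>y. y \<noteq> v) xs))"
  shows "u = v"
proof (rule ccontr)
  assume ne: "u \<noteq> v"
  define pos where "pos x = length (takeWhile (\<lambda>y. y \<noteq> x) xs)" for x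
  have pos: "pos x < length xs" "xs ! pos x = x" "takeWhile (\<lambda>y. y \<noteq> x) xs = take (pos x) xs"
    if "x \<in> set xs" for x
  proof -
    show "pos x < length xs" unfolding pos_def using that
      by (metis (mono_tags, lifting) length_takeWhile_le linorder_neqE_nat not_less set_takeWhileD takeWhile_eq_all_conv takeWhile_eq_take take_all_iff)
    then show "xs ! pos x = x" unfolding pos_def using nth_length_takeWhile by blast
    show "takeWhile (\<lambda>y. y \<noteq> x) xs = take (pos x) xs" unfolding pos_def by (rule takeWhile_eq_take)
  qed
  have less: "card (set (take (pos a) xs)) < card (set (take (pos b) xs))"
    if "pos a < pos b" "a \<in> set xs" "b \<in> set xs" for a b
  proof (rule psubset_card_mono)
    have "a \<in> set (take (pos b) xs)" using pos[OF that(2)] that(1) by (auto simp: in_set_conv_nth intro!: exI[of _ "pos a"])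
    moreover have "a \<notin> set (take (pos a) xs)" using pos(3)[OF that(2)] by (metis (mono_tags, lifting) set_takeWhileD)
    moreover have "set (take (pos a) xs) \<subseteq> set (take (pos b) xs)" using that(1) by (intro set_take_subset_set_take) simp
    ultimately show "set (take (pos a) xs) \<subset> set (take (pos b) xs)" by blast
  qed simp
  have "pos u \<noteq> pos v" using pos[OF assms(1)] pos[OF assms(2)] ne by metis
  then show False using less[of u v] less[of v u] assms pos by (metis linorder_neqE_nat nat_less_le)
qed

lemma encounter_labels_eq_iff:
  assumes "i < length xs" "j < length xs"
  shows "encounter_labels xs ! i = encounter_labels xs ! j \<longleftrightarrow> xs ! i = xs ! j"
  using assms encounter_label_inj[of "xs ! i" xs "xs ! j"] by (auto simp: encounter_labels_def)

section \<open>Periodic curves with finitely many double points\<close>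

lemma window_unique:
  fixes m :: real and j :: int
  assumes m_pos: "m > 0" and "s \<in> {a..<a + m}" "t \<in> {a..<a + m}" "t = s + of_int j * m"
  shows "t = s"
proof -
  have "of_int j * m < 1 * m" "(- 1) * m < of_int j * m" using assms unfolding atLeastLessThan_iff by linarith+
  then have "of_int j < (1::real)" "(- 1 :: real) < of_int j" using mult_less_cancel_right_pos[OF m_pos] by blast+
  then have "j = 0" by linarith
  then show ?thesis using assms by simp
qed

lemma window_exists:
  fixes m :: real
  assumes m_pos: "m > 0"
  shows "\<exists>j::int. t + of_int j * m \<in> {a..<a + m}"
proof -
  define j where "j = \<lfloor>(t - a) / m\<rfloor>"
  have "of_int j \<le> (t - a) / m" "(t - a) / m < of_int j + 1" unfolding j_def by linarith+
  then have "of_int j * m \<le> t - a" "t - a < (of_int j + 1) * m" using m_pos by (auto simp: field_simps)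
  then have "t + of_int (- j) * m \<in> {a..<a + m}" by (auto simp: algebra_simps)
  then show ?thesis by blast
qed

text \<open>The second half runs from the end of the slit back to its start; these two points enter
  as labels \<open>Suc (length w)\<close> and \<open>0\<close>.\<close>

definition crossing_order :: "nat list \<Rightarrow> nat \<Rightarrow> nat" where
  "crossing_order w q =
     (if q = 0 then Suc (length w) else if q = Suc (length w) then 0 else w ! (q - 1))"

text \<open>Stated modulo the period and without reference to edges, so that the assumptions pass to
  the reversed curve; both directions allowed by \<open>knot_word_of\<close> are then treated at
  once.\<close>

locale double_curve =
  fixes g :: "real \<Rightarrow> complex" and m :: real and X :: "complex set"
  assumes m_pos: "m > 0"
    and cont: "continuous_on UNIV g"
    and periodic: "\<And>t j. g (t + of_int j * m) = g t"
    and finite_X: "finite X"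
    and only_X: "\<And>s t. g s = g t \<Longrightarrow> \<forall>j::int. t \<noteq> s + of_int j * m \<Longrightarrow> g s \<in> X"
    and double: "\<And>p. p \<in> X \<Longrightarrow> \<exists>s t. g s = p \<and> g t = p \<and> (\<forall>j::int. t \<noteq> s + of_int j * m) \<and>
        (\<forall>u. g u = p \<longrightarrow> (\<exists>j::int. u = s + of_int j * m \<or> u = t + of_int j * m))"
    and local_affine: "\<And>t. g t \<in> X \<Longrightarrow> \<exists>\<epsilon>>0. \<exists>d. \<forall>s. \<bar>s\<bar> \<le> \<epsilon> \<longrightarrow> g (t + s) = g t + of_real s * d"

lemma double_curve_reverse:
  assumes "double_curve g m X" shows "double_curve (\<lambda>t. g (- t)) m X"
proof -
  interpret double_curve g m X by fact
  show ?thesis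
  proof
    show "m > 0" by (rule m_pos)
    show "continuous_on UNIV (\<lambda>t. g (- t))"
      by (rule continuous_on_compose2[OF cont]) (auto intro: continuous_intros)
    show "g (- (t + of_int j * m)) = g (- t)" for t j
      using periodic[of "- t" "- j"] by (simp add: algebra_simps)
    show "finite X" by (rule finite_X)
    show "g (- s) \<in> X" if e: "g (- s) = g (- t)" and ne: "\<forall>j::int. t \<noteq> s + of_int j * m" for s t
    proof (rule only_X[OF e], intro allI notI)
      fix j :: int assume "- t = - s + of_int j * m"
      then have "t = s + of_int (- j) * m" by simp
      then show False using ne by blast
    qed
    show "\<exists>s t. g (- s) = p \<and> g (- t) = p \<and> (\<forall>j::int. t \<noteq> s + of_int j * m) \<and>
        (\<forall>u. g (- u) = p \<longrightarrow> (\<exists>j::int. u = s + of_int j * m \<or> u = t + of_int j * m))" if pX: "p \<in> X" for p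
    proof -
      obtain s t where st: "g s = p" "g t = p" "\<forall>j::int. t \<noteq> s + of_int j * m"
        "\<forall>u. g u = p \<longrightarrow> (\<exists>j::int. u = s + of_int j * m \<or> u = t + of_int j * m)" using double[OF pX] by blast
      have neg: "- a = - b + of_int (- j) * m \<longleftrightarrow> a = b + of_int j * m" for a b and j :: int by auto
      have "- t \<noteq> - s + of_int j * m" for j :: int using st(3) neg[of t s "- j"] by (metis minus_minus)
      moreover have "\<exists>j::int. u = - s + of_int j * m \<or> u = - t + of_int j * m" if "g (- u) = p" for u
        using st(4)[rule_format, OF that] neg[of "- u"] by (metis minus_minus)
      ultimately show ?thesis using st by (intro exI[of _ "- s"] exI[of _ "- t"]) auto
    qed
    show "\<exists>\<epsilon>>0. \<exists>d. \<forall>s. \<bar>s\<bar> \<le> \<epsilon> \<longrightarrow> g (- (t + s)) = g (- t) + of_real s * d" if tX: "g (- t) \<in> X" for t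
    proof -
      obtain \<epsilon> d where "\<epsilon> > 0" and e: "\<forall>s. \<bar>s\<bar> \<le> \<epsilon> \<longrightarrow> g (- t + s) = g (- t) + of_real s * d"
        using local_affine[OF tX] by blast
      then show ?thesis using e[rule_format, of "- s" for s] by (intro exI[of _ \<epsilon>] conjI exI[of _ "- d"]) auto
    qed
  qed
qed

context double_curve
begin

lemma window_only_X:
  assumes "s \<in> {a..<a + m}" "t \<in> {a..<a + m}" "s \<noteq> t" "g s = g t"
  shows "g s \<in> X"
proof (rule only_X[OF assms(4)], rule allI, rule notI)
  fix j :: int assume "t = s + of_int j * m"
  then show False using window_unique[OF m_pos assms(1,2)] assms(3) by simp
qed

lemma window_double:
  assumes "p \<in> X"
  obtains s t where "s \<noteq> t" "{u \<in> {a..<a + m}. g u = p} = {s, t}"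
proof -
  obtain s t where st: "g s = p" "g t = p" "\<forall>j::int. t \<noteq> s + of_int j * m"
        "\<forall>u. g u = p \<longrightarrow> (\<exists>j::int. u = s + of_int j * m \<or> u = t + of_int j * m)" using double[OF assms] by blast
  obtain i j :: int where ij: "s + of_int i * m \<in> {a..<a + m}" "t + of_int j * m \<in> {a..<a + m}"
    using window_exists[OF m_pos, of s a] window_exists[OF m_pos, of t a] by blast
  show thesis
  proof (rule that)
    show "s + of_int i * m \<noteq> t + of_int j * m"
    proof
      assume "s + of_int i * m = t + of_int j * m"
      then have "t = s + of_int (i - j) * m" by (simp add: algebra_simps)
      then show False using st(3) by blast
    qed
    have "u = s + of_int i * m \<or> u = t + of_int j * m" if u: "u \<in> {a..<a + m}" "g u = p" for u
    proof -
      obtain k :: int where "u = s + of_int k * m \<or> u = t + of_int k * m" using st(4) u by blast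
      then have "u = s + of_int i * m + of_int (k - i) * m \<or> u = t + of_int j * m + of_int (k - j) * m"
        by (auto simp: algebra_simps)
      then show ?thesis using window_unique[OF m_pos] ij u by blast
    qed
    then show "{u \<in> {a..<a + m}. g u = p} = {s + of_int i * m, t + of_int j * m}"
      using st ij periodic by auto
  qed
qed

definition crossing_times :: "real \<Rightarrow> real set" where
  "crossing_times a = {t \<in> {a<..<a + m}. g t \<in> X}"

lemma finite_crossing_times: "finite (crossing_times a)"
proof -
  have "crossing_times a \<subseteq> (\<Union>p\<in>X. {u \<in> {a..<a + m}. g u = p})" by (auto simp: crossing_times_def)
  moreover have "finite {u \<in> {a..<a + m}. g u = p}" if "p \<in> X" for p
    by (rule window_double[OF that, of a]) simp
  ultimately show ?thesis using finite_X by (meson finite_UN_I finite_subset)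
qed

text \<open>Parallel strands through a common point would overlap in a segment, all of whose points
  lie in \<open>X\<close>, but \<open>X\<close> is finite. A zero velocity is impossible because a
  crossing has only two parameters in a period.\<close>

lemma affine_transversal:
  assumes st: "s \<in> {a<..<a + m}" "t \<in> {a<..<a + m}" "s \<noteq> t" "g s = g t"
    and e: "\<epsilon> > 0" "\<And>h. \<bar>h\<bar> \<le> \<epsilon> \<Longrightarrow> g (s + h) = g s + of_real h * d"
      "\<And>h. \<bar>h\<bar> \<le> \<epsilon> \<Longrightarrow> g (t + h) = g t + of_real h * e"
  shows "Im (cnj d * e) \<noteq> 0"
proof
  assume im: "Im (cnj d * e) = 0"
  have gX: "g s \<in> X" using window_only_X[of s a t] st by auto
  have nz: "d \<noteq> 0" if u: "u \<in> {a<..<a + m}" "g u \<in> X" "\<And>h. \<bar>h\<bar> \<le> \<epsilon> \<Longrightarrow> g (u + h) = g u + of_real h * d" for u d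
  proof
    assume "d = 0"
    define \<eta> where "\<eta> = Min {\<epsilon>, a + m - u}"
    have "\<eta> > 0" "\<eta> \<le> \<epsilon>" "\<eta> \<le> a + m - u" using e(1) u by (auto simp: \<eta>_def)
    have "{u..<u + \<eta>} \<subseteq> {v \<in> {a..<a + m}. g v = g u}"
    proof
      fix v assume v: "v \<in> {u..<u + \<eta>}"
      then have "g (u + (v - u)) = g u" using u(3)[of "v - u"] \<open>d = 0\<close> \<open>\<eta> \<le> \<epsilon>\<close> by simp
      then show "v \<in> {v \<in> {a..<a + m}. g v = g u}" using v u(1) \<open>\<eta> \<le> a + m - u\<close> by auto
    qed
    moreover have "finite {v \<in> {a..<a + m}. g v = g u}" by (rule window_double[OF u(2), of a]) simp
    moreover have "infinite {u..<u + \<eta>}" using \<open>\<eta> > 0\<close> by (simp add: infinite_Ico)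
    ultimately show False using finite_subset by blast
  qed
  have d0: "d \<noteq> 0" by (rule nz[OF st(1) gX e(2)])
  have e0: "e \<noteq> 0" using nz[OF st(2) _ e(3)] gX st by auto
  define c where "c = Re (cnj d * e)"
  define r where "r = c / (norm d)\<^sup>2"
  have 1: "cnj d * e = of_real c" using im by (simp add: complex_eq_iff c_def)
  have "of_real ((norm d)^2) * e = d * (cnj d * e)" by (simp only: complex_norm_square mult.assoc)
  then have "of_real ((norm d)^2) * e = d * of_real c" by (simp only: 1)
  then have "e = of_real r * d" using d0 by (simp add: r_def field_simps)
  then have er: "e = of_real r * d" .
  then have r0: "r \<noteq> 0" using e0 by auto
  \<comment> \<open>For \<open>0 < h < \<eta>\<close> each term secures one condition: the local
    formulas apply at \<open>h\<close> and at \<open>r * h\<close>, the parameters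
    \<open>s + r * h\<close> and \<open>t + h\<close> differ, and both stay in the window. The
    factor \<open>1 + \<bar>r\<bar>\<close> controls \<open>h + \<bar>r * h\<bar>\<close>.\<close>
  define \<eta> where "\<eta> = Min {\<epsilon>, \<epsilon> / \<bar>r\<bar>, \<bar>s - t\<bar> / (1 + \<bar>r\<bar>), (a + m - t), (a + m - s) / (1 + \<bar>r\<bar>), (s - a) / (1 + \<bar>r\<bar>)}"
  have "1 + \<bar>r\<bar> > 0" by linarith
  then have "\<epsilon> / \<bar>r\<bar> > 0" "\<bar>s - t\<bar> / (1 + \<bar>r\<bar>) > 0" "a + m - t > 0" "(a + m - s) / (1 + \<bar>r\<bar>) > 0"
    "(s - a) / (1 + \<bar>r\<bar>) > 0" using e(1) st r0 by (auto intro!: divide_pos_pos)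
  then have "\<eta> > 0" using e(1) unfolding \<eta>_def
    by (simp only: Min_gr_iff finite.emptyI finite_insert insert_not_empty not_False_eq_True ball_simps simp_thms)
  have le: "\<eta> \<le> \<epsilon>" "\<eta> \<le> \<epsilon> / \<bar>r\<bar>" "\<eta> \<le> \<bar>s - t\<bar> / (1 + \<bar>r\<bar>)" "\<eta> \<le> (a + m - t)" "\<eta> \<le> (a + m - s) / (1 + \<bar>r\<bar>)"
     "\<eta> \<le> (s - a) / (1 + \<bar>r\<bar>)"
    unfolding \<eta>_def by (rule Min_le; simp)+
  have "(\<lambda>h. g t + of_real h * e) ` {0<..<\<eta>} \<subseteq> X"
  proof clarify
    fix h assume h: "h \<in> {0<..<\<eta>}"
    have aux: "h * (1 + \<bar>r\<bar>) < c" if "\<eta> \<le> c / (1 + \<bar>r\<bar>)" for c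
    proof -
      have "h < c / (1 + \<bar>r\<bar>)" using h that by simp
      then show ?thesis using pos_less_divide_eq[of "1 + \<bar>r\<bar>" h c] by simp
    qed
    have "h * (1 + \<bar>r\<bar>) < \<bar>s - t\<bar>" "h * (1 + \<bar>r\<bar>) < a + m - s" "h * (1 + \<bar>r\<bar>) < s - a"
      using aux le by blast+
    have "h \<le> \<epsilon> / \<bar>r\<bar>" using h le(2) by simp
    then have "h * \<bar>r\<bar> \<le> \<epsilon>" using pos_le_divide_eq[of "\<bar>r\<bar>" h \<epsilon>] r0 by simp
    have b: "\<bar>r * h\<bar> \<le> \<epsilon>" using \<open>h * \<bar>r\<bar> \<le> \<epsilon>\<close> h by (simp add: abs_mult mult.commute)
    have split: "h * (1 + \<bar>r\<bar>) = h + \<bar>r * h\<bar>" using h by (simp add: abs_mult algebra_simps)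
    have gg: "g (s + r * h) = g (t + h)" using e(2)[OF b] e(3)[of h] h le st er by simp
    have "s + r * h \<in> {a..<a + m}" "t + h \<in> {a..<a + m}" "s + r * h \<noteq> t + h"
      using h le st \<open>h * (1 + \<bar>r\<bar>) < \<bar>s - t\<bar>\<close> \<open>h * (1 + \<bar>r\<bar>) < a + m - s\<close> \<open>h * (1 + \<bar>r\<bar>) < s - a\<close>
      unfolding split by auto
    then have "g (t + h) \<in> X" using window_only_X[OF _ _ _ gg] gg by metis
    then show "g t + of_real h * e \<in> X" using e(3)[of h] h le by simp
  qed
  moreover have "inj_on (\<lambda>h. g t + of_real h * e) {0<..<\<eta>}" using e0 by (auto simp: inj_on_def)
  ultimately have "finite {0<..<\<eta>}" using finite_X by (metis finite_imageD finite_subset)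
  then show False using \<open>\<eta> > 0\<close> by (simp add: infinite_Ioo)
qed

text \<open>The word says that the first \<open>n\<close> encounters are pairwise distinct
  crossings, and so are the last \<open>n\<close>. Hence both halves are injective arcs, and equal
  labels tell where they meet.\<close>

lemma straight_word_curve:
  assumes a: "g a \<notin> X" and w: "permutation_word w" "length w = card X"
    and word: "encounter_labels (crossings_met g m X a) = [1..<Suc (card X)] @ w"
  obtains G y z d e where "straight_curve G (length w) (crossing_order w) y z d e"
proof -
  define n where "n = length w"
  define \<tau> where "\<tau> = sorted_list_of_set (crossing_times a)"
  have set_tau: "set \<tau> = crossing_times a" and sorted_tau: "sorted_wrt (<) \<tau>"
    using finite_crossing_times[of a] by (auto simp: \<tau>_def strict_sorted_list_of_set)
  have labels: "encounter_labels (map g \<tau>) = [1..<Suc n] @ w"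
    using word w by (simp add: crossings_met_def \<tau>_def crossing_times_def n_def)
  have "length (encounter_labels (map g \<tau>)) = length \<tau>" by (simp add: encounter_labels_def)
  then have len: "length \<tau> = 2 * n" using labels by (simp add: n_def del: upt_Suc)
  have w_range: "j < n \<Longrightarrow> 1 \<le> w ! j \<and> w ! j \<le> n" for j
    using w(1) nth_mem[of j w] by (auto simp: permutation_word_def n_def)
  have distinct_w: "distinct w" using w(1) by (simp add: permutation_word_def)
  have same: "g (\<tau> ! i) = g (\<tau> ! j) \<longleftrightarrow> ([1..<Suc n] @ w) ! i = ([1..<Suc n] @ w) ! j" if "i < 2 * n" "j < 2 * n" for i j
    using encounter_labels_eq_iff[of i "map g \<tau>" j] that len labels by simp
  have lab1: "([1..<Suc n] @ w) ! i = Suc i" if "i < n" for i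
    using that by (simp add: nth_append del: upt_Suc)
  have lab2: "([1..<Suc n] @ w) ! i = w ! (i - n)" if "n \<le> i" for i
    using that by (simp add: nth_append del: upt_Suc)
  \<comment> \<open>The end of the slit, strictly between the \<open>n\<close>-th encounter and the
    next one. Without crossings it is the midpoint of the whole period.\<close>
  define \<mu> where "\<mu> = ((if n = 0 then a else \<tau> ! (n - 1)) + (if n = 0 then a + m else \<tau> ! n)) / 2"
  \<comment> \<open>All marked parameters in increasing order. The first \<open>n + 2\<close> belong
    to the slit and the last \<open>n + 2\<close> to the second half; \<open>\<mu>\<close>, at index
    \<open>Suc n\<close>, is shared.\<close>
  define R where "R = a # take n \<tau> @ [\<mu>] @ drop n \<tau> @ [a + m]"
  have tau_in: "t \<in> set \<tau> \<Longrightarrow> a < t \<and> t < a + m" for t using set_tau by (auto simp: crossing_times_def)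
  have mu_tau: "n > 0 \<Longrightarrow> \<tau> ! (n - 1) < \<mu> \<and> \<mu> < \<tau> ! n"
    using sorted_wrt_nth_less[OF sorted_tau, of "n - 1" n] len by (simp add: \<mu>_def)
  have mu_range: "a < \<mu>" "\<mu> < a + m"
  proof -
    consider "n = 0" | "n > 0" by blast
    then have "a < \<mu> \<and> \<mu> < a + m"
    proof cases
      case 1 then show ?thesis using m_pos by (simp add: \<mu>_def)
    next
      case 2
      then have "\<tau> ! (n - 1) \<in> set \<tau>" "\<tau> ! n \<in> set \<tau>" using len by auto
      then show ?thesis using mu_tau[OF 2] tau_in by fastforce
    qed
    then show "a < \<mu>" "\<mu> < a + m" by auto
  qed
  have before: "\<tau> ! i < \<mu>" if "i < n" for i
  proof -
    have "\<tau> ! i \<le> \<tau> ! (n - 1)"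
      using sorted_wrt_nth_less[OF sorted_tau, of i "n - 1"] that len
      by (cases "i = n - 1") (auto intro!: less_imp_le)
    then show ?thesis using mu_tau that by auto
  qed
  have after: "\<mu> < \<tau> ! i" if "n \<le> i" "i < 2 * n" for i
  proof -
    have "\<tau> ! n \<le> \<tau> ! i"
      using sorted_wrt_nth_less[OF sorted_tau, of n i] that len by (cases "i = n") auto
    then show ?thesis using mu_tau that by auto
  qed
  have in_take: "t \<in> set (take n \<tau>) \<Longrightarrow> t < \<mu>" for t using before len by (auto simp: in_set_conv_nth)
  have in_drop: "t \<in> set (drop n \<tau>) \<Longrightarrow> \<mu> < t" for t using after len by (auto simp: in_set_conv_nth)
  have sorted_R: "sorted_wrt (<) R"
  proof -
    have "sorted_wrt (<) (take n \<tau>)" "sorted_wrt (<) (drop n \<tau>)"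
      using sorted_tau by (auto intro: sorted_wrt_take sorted_wrt_drop)
    moreover have "\<And>t. t \<in> set (take n \<tau>) \<Longrightarrow> a < t \<and> t < \<mu> \<and> t < a + m"
      "\<And>t. t \<in> set (drop n \<tau>) \<Longrightarrow> a < t \<and> \<mu> < t \<and> t < a + m"
      using in_take in_drop tau_in by (meson in_set_takeD in_set_dropD)+
    moreover from this have "\<And>s t. s \<in> set (take n \<tau>) \<Longrightarrow> t \<in> set (drop n \<tau>) \<Longrightarrow> s < t"
      by (meson less_trans)
    ultimately show ?thesis unfolding R_def
      using mu_range m_pos by (auto simp: sorted_wrt_append)
  qed
  have len_R: "length R = 2 * n + 3" by (simp add: R_def len)
  have R_less: "i < j \<Longrightarrow> j < 2 * n + 3 \<Longrightarrow> R ! i < R ! j" for i j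
    using sorted_wrt_nth_less[OF sorted_R] len_R by simp
  have R0: "R ! 0 = a" and R1: "R ! Suc n = \<mu>" and R2: "R ! (2 * n + 2) = a + m"
    by (auto simp: R_def nth_append len nth_Cons split: nat.splits)
  have Ry: "R ! Suc i = \<tau> ! i" if "i < n" for i using that by (simp add: R_def nth_append len)
  have Rz: "R ! (n + 1 + Suc i) = \<tau> ! (n + i)" if "i < n" for i
    using that by (simp add: R_def nth_append len)
  define G where "G t = g (a + m * t)" for t
  define y where "y i = (R ! i - a) / m" for i
  define z where "z i = (R ! (n + 1 + i) - a) / m" for i
  have my: "a + m * y i = R ! i" "a + m * z i = R ! (n + 1 + i)" for i
    using m_pos by (auto simp: y_def z_def)
  have Gy: "G (y i) = g (R ! i)" and Gz: "G (z i) = g (R ! (n + 1 + i))" for i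
    unfolding G_def my by auto
  let ?x = "crossing_order w"
  have mu_z0: "a + m * z 0 = \<mu>" using my(2)[of 0] R1 by simp
  have idx: "\<exists>i<2*n. \<tau> ! i = t \<and> (t \<le> \<mu> \<longrightarrow> i < n) \<and> (\<mu> \<le> t \<longrightarrow> n \<le> i)" if "t \<in> {a..a + m}" "g t \<in> X" for t
  proof -
    have "g (a + m) = g a" using periodic[of a 1] by simp
    then have "t \<noteq> a" "t \<noteq> a + m" using that a by auto
    then have "t \<in> set \<tau>" using that set_tau by (auto simp: crossing_times_def)
    then obtain i where i: "i < 2 * n" "\<tau> ! i = t" using len by (auto simp: in_set_conv_nth)
    have "t \<le> \<mu> \<longrightarrow> i < n" "\<mu> \<le> t \<longrightarrow> n \<le> i"
      using after[of i] before[of i] i by (cases "i < n"; auto)+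
    then show ?thesis using i by blast
  qed
  have gam: "g (a + m) = g a" using periodic[of a 1] by simp
  \<comment> \<open>The window is closed at both ends, and these are the same point of the curve, so
    the pair of ends appears as a separate case.\<close>
  have coincide: "s = t \<or> (s = a \<and> t = a + m) \<or> (s = a + m \<and> t = a) \<or> g s \<in> X"
    if "s \<in> {a..a + m}" "t \<in> {a..a + m}" "g s = g t" for s t
  proof (cases "s = a + m \<or> t = a + m")
    case False
    then show ?thesis using window_only_X[of s a t] that by auto
  next
    case True
    then have "s = t \<or> (s = a + m \<and> g a = g t \<and> t \<in> {a..<a+m}) \<or> (t = a + m \<and> g s = g a \<and> s \<in> {a..<a+m})"
      using that gam by force
    moreover have "u = a \<or> g u \<in> X" if "u \<in> {a..<a+m}" "g u = g a" for u
      using window_only_X[of u a a] that m_pos by auto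
    ultimately show ?thesis using that gam by metis
  qed
  have scale: "a + m * t \<in> {a..a + m}" if "t \<in> {0..1}" for t
    using that m_pos mult_left_mono[of t 1 m] by auto
  have scale_le: "a + m * t \<le> \<mu> \<longleftrightarrow> t \<le> z 0" "\<mu> \<le> a + m * t \<longleftrightarrow> z 0 \<le> t" for t
    using mu_z0 m_pos by (metis add_le_cancel_left mult_le_cancel_left_pos)+
  have z01: "0 < z 0" "z 0 < 1"
    using mu_range m_pos R1 by (auto simp: z_def)
  have order_cases: "?x 0 = Suc n" "?x (Suc n) = 0" "\<And>i. i < n \<Longrightarrow> ?x (Suc i) = w ! i"
    by (auto simp: crossing_order_def n_def)
  have meet_w: "g (R ! (w ! j)) = g (R ! (n + 1 + Suc j))" if jn: "j < n" for j
  proof -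
    obtain k where k: "w ! j = Suc k" "k < n" using w_range[OF jn] by (cases "w ! j") auto
    have "g (\<tau> ! k) = g (\<tau> ! (n + j))"
      using same[of k "n + j"] k jn lab1[of k] lab2[of "n + j"] by simp
    then show ?thesis using Rz[OF jn] Ry[OF k(2)] k by simp
  qed
  have crossing: "\<exists>d e. Im (cnj d * e) \<noteq> 0 \<and> (\<exists>\<epsilon>>0. \<forall>s. \<bar>s\<bar> \<le> \<epsilon> \<longrightarrow>
        G (y (?x q) + s) = G (z q) + of_real s * d \<and> G (z q + s) = G (z q) + of_real s * e)"
    if q: "1 \<le> q" "q \<le> n" for q
  proof -
    obtain j where j: "q = Suc j" "j < n" using q by (cases q) auto
    obtain k where k: "w ! j = Suc k" "k < n" using w_range[OF j(2)] by (cases "w ! j") auto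
    define s where "s = R ! (w ! j)"
    define t where "t = R ! (n + 1 + Suc j)"
    have st: "s = \<tau> ! k" "t = \<tau> ! (n + j)"
      using Ry[OF k(2)] k Rz[OF j(2)] by (auto simp: s_def t_def)
    then have "s \<in> set \<tau>" "t \<in> set \<tau>" using k j len by auto
    then have win: "s \<in> {a<..<a + m}" "t \<in> {a<..<a + m}" and sX: "g s \<in> X" "g t \<in> X"
      using set_tau by (auto simp: crossing_times_def)
    have "s \<noteq> t" using R_less[of "w ! j" "n + 1 + Suc j"] k j by (simp add: s_def t_def)
    have gst: "g s = g t" using meet_w[OF j(2)] by (simp add: s_def t_def)
    obtain \<epsilon>1 d where 1: "\<epsilon>1 > 0" "\<forall>h. \<bar>h\<bar> \<le> \<epsilon>1 \<longrightarrow> g (s + h) = g s + of_real h * d"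
      using local_affine[OF sX(1)] by blast
    obtain \<epsilon>2 e where 2: "\<epsilon>2 > 0" "\<forall>h. \<bar>h\<bar> \<le> \<epsilon>2 \<longrightarrow> g (t + h) = g t + of_real h * e"
      using local_affine[OF sX(2)] by blast
    define \<epsilon> where "\<epsilon> = min \<epsilon>1 \<epsilon>2"
    have eps: "\<epsilon> > 0" "\<And>h. \<bar>h\<bar> \<le> \<epsilon> \<Longrightarrow> g (s + h) = g s + of_real h * d"
        "\<And>h. \<bar>h\<bar> \<le> \<epsilon> \<Longrightarrow> g (t + h) = g t + of_real h * e" using 1 2 by (auto simp: \<epsilon>_def)
    have im: "Im (cnj d * e) \<noteq> 0" by (rule affine_transversal[OF win \<open>s \<noteq> t\<close> gst eps])
    have "Im (cnj (of_real m * d) * (of_real m * e)) = m^2 * Im (cnj d * e)"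
      by (simp add: power2_eq_square algebra_simps)
    then have im': "Im (cnj (of_real m * d) * (of_real m * e)) \<noteq> 0" using im m_pos by simp
    have ys: "a + m * y (?x q) = s" "a + m * z q = t" using my order_cases(3)[OF j(2)] j by (auto simp: s_def t_def)
    have "G (y (?x q) + h) = G (z q) + of_real h * (of_real m * d) \<and> G (z q + h) = G (z q) + of_real h * (of_real m * e)"
      if "\<bar>h\<bar> \<le> \<epsilon> / m" for h
    proof -
      have h: "\<bar>m * h\<bar> \<le> \<epsilon>" using that m_pos by (simp add: abs_mult field_simps)
      have "a + m * (y (?x q) + h) = s + m * h" "a + m * (z q + h) = t + m * h"
        using ys by (auto simp: algebra_simps)
      then show ?thesis using eps(2,3)[OF h] gst ys by (simp add: G_def)
    qed
    moreover have "\<epsilon> / m > 0" using eps m_pos by simp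
    ultimately show ?thesis using im' by blast
  qed
  then obtain d e where de: "\<And>q. 1 \<le> q \<Longrightarrow> q \<le> n \<Longrightarrow> Im (cnj (d q) * e q) \<noteq> 0 \<and> (\<exists>\<epsilon>>0. \<forall>s. \<bar>s\<bar> \<le> \<epsilon> \<longrightarrow>
        G (y (?x q) + s) = G (z q) + of_real s * d q \<and> G (z q + s) = G (z q) + of_real s * e q)"
    by metis
  have "straight_curve G n ?x y z d e"
  proof
    show "path G" unfolding path_def G_def
      by (rule continuous_on_compose2[OF cont]) (auto intro: continuous_intros)
    show "y 0 = 0" "y (Suc n) = z 0" "z (Suc n) = 1"
      using R0 R2 m_pos by (auto simp: y_def z_def mult_2)
    show "y i < y j" if "i < j" "j \<le> Suc n" for i j
      using R_less[of i j] that m_pos by (simp add: y_def divide_strict_right_mono)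
    show "z i < z j" if "i < j" "j \<le> Suc n" for i j
      using R_less[of "n + 1 + i" "n + 1 + j"] that m_pos by (simp add: z_def divide_strict_right_mono)
    show "?x 0 = Suc n" "?x (Suc n) = 0" using order_cases by auto
    show "?x q \<le> Suc n" if "q \<le> Suc n" for q
    proof (cases q)
      case (Suc j)
      then show ?thesis using that w_range[of j] by (cases "j < n") (auto simp: crossing_order_def n_def[symmetric])
    qed (simp add: order_cases)
    show "inj_on ?x {..Suc n}"
    proof (rule inj_onI)
      fix p q assume pq: "p \<in> {..Suc n}" "q \<in> {..Suc n}" "?x p = ?x q"
      have c: "r = 0 \<and> ?x r = Suc n \<or> r = Suc n \<and> ?x r = 0 \<or> (1 \<le> r \<and> r \<le> n \<and> ?x r = w ! (r - 1) \<and> 1 \<le> ?x r \<and> ?x r \<le> n)"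
        if "r \<in> {..Suc n}" for r
      proof (cases r)
        case (Suc j)
        then show ?thesis using that w_range[of j] by (cases "j < n") (auto simp: crossing_order_def n_def[symmetric])
      qed (simp add: order_cases)
      have "p = q" if h: "w ! (p - 1) = w ! (q - 1)" "1 \<le> p" "p \<le> n" "1 \<le> q" "q \<le> n"
      proof -
        have "p - 1 < length w" "q - 1 < length w" using h unfolding n_def by linarith+
        then have "p - 1 = q - 1" using nth_eq_iff_index_eq[OF distinct_w] h(1) by blast
        then show ?thesis using h by linarith
      qed
      then show "p = q" using c[OF pq(1)] c[OF pq(2)] pq(3) by auto
    qed
    show "inj_on G {0..z 0}"
    proof (rule inj_onI)
      fix s t assume st: "s \<in> {0..z 0}" "t \<in> {0..z 0}" "G s = G t"
      have b: "a + m * s \<in> {a..a + m}" "a + m * t \<in> {a..a + m}" "a + m * s \<le> \<mu>" "a + m * t \<le> \<mu>"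
        using scale[of s] scale[of t] st z01 scale_le by auto
      have g: "g (a + m * s) = g (a + m * t)" using st by (simp add: G_def)
      from coincide[OF b(1,2) g] show "s = t"
      proof (elim disjE)
        assume X: "g (a + m * s) \<in> X"
        obtain i j where ij: "i < n" "j < n" "\<tau> ! i = a + m * s" "\<tau> ! j = a + m * t"
          using idx[OF b(1) X] idx[OF b(2)] X g b(3,4) by metis
        then have "i = j" using same[of i j] lab1[of i] lab1[of j] g by simp
        then show ?thesis using ij m_pos by simp
      qed (use b m_pos mu_range in auto)
    qed
    show "inj_on G {z 0..1}"
    proof (rule inj_onI)
      fix s t assume st: "s \<in> {z 0..1}" "t \<in> {z 0..1}" "G s = G t"
      have b: "a + m * s \<in> {a..a + m}" "a + m * t \<in> {a..a + m}" "\<mu> \<le> a + m * s" "\<mu> \<le> a + m * t"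
        using scale[of s] scale[of t] st z01 scale_le by auto
      have g: "g (a + m * s) = g (a + m * t)" using st by (simp add: G_def)
      from coincide[OF b(1,2) g] show "s = t"
      proof (elim disjE)
        assume X: "g (a + m * s) \<in> X"
        obtain i j where ij: "n \<le> i" "n \<le> j" "i < 2 * n" "j < 2 * n" "\<tau> ! i = a + m * s" "\<tau> ! j = a + m * t"
          using idx[OF b(1) X] idx[OF b(2)] X g b(3,4) by metis
        then have "w ! (i - n) = w ! (j - n)" using same[of i j] lab2[of i] lab2[of j] g by simp
        then have "i - n = j - n" using nth_eq_iff_index_eq[OF distinct_w, of "i - n" "j - n"] ij by (simp add: n_def)
        then have "i = j" using ij by simp
        then show ?thesis using ij m_pos by simp
      qed (use b m_pos mu_range in auto)
    qed
    show "\<exists>q\<le>Suc n. s = y (?x q) \<and> t = z q" if st: "s \<in> {0..z 0}" "t \<in> {z 0..1}" "G s = G t" for s t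
    proof -
      have b: "a + m * s \<in> {a..a + m}" "a + m * t \<in> {a..a + m}" "a + m * s \<le> \<mu>" "\<mu> \<le> a + m * t"
        using scale[of s] scale[of t] st z01 scale_le by auto
      have g: "g (a + m * s) = g (a + m * t)" using st by (simp add: G_def)
      have yz: "y (Suc n) = z 0" "y 0 = 0" "z (Suc n) = 1" using R0 R2 m_pos by (auto simp: y_def z_def mult_2)
      from coincide[OF b(1,2) g] show ?thesis
      proof (elim disjE)
        assume "a + m * s = a + m * t"
        then have "s = t" using m_pos by simp
        then show ?thesis using st yz order_cases by (intro exI[of _ 0]) auto
      next
        assume "a + m * s = a \<and> a + m * t = a + m"
        then have "s = 0" "t = 1" using m_pos by auto
        then show ?thesis using st yz order_cases by (intro exI[of _ "Suc n"]) auto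
      next
        assume "a + m * s = a + m \<and> a + m * t = a"
        then show ?thesis using b mu_range by auto
      next
        assume X: "g (a + m * s) \<in> X"
        obtain i j where ij: "i < n" "n \<le> j" "j < 2 * n" "\<tau> ! i = a + m * s" "\<tau> ! j = a + m * t"
          using idx[OF b(1) X] idx[OF b(2)] X g b(3,4) by metis
        then have "w ! (j - n) = Suc i" using same[of i j] lab1[of i] lab2[of j] g by simp
        moreover have "j - n < n" using ij by simp
        ultimately have "y (?x (Suc (j - n))) = s" "z (Suc (j - n)) = t"
          using order_cases(3)[of "j - n"] Ry[of i] Rz[of "j - n"] ij m_pos
          by (auto simp: y_def z_def)
        then show ?thesis using \<open>j - n < n\<close> by (intro exI[of _ "Suc (j - n)"]) auto
      qed
    qed
    show "G (y (?x q)) = G (z q)" if qn: "q \<le> Suc n" for q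
    proof -
      consider "q = 0" | "q = Suc n" | j where "q = Suc j" "j < n" using qn by (cases q) (auto simp: le_less)
      then show ?thesis
      proof cases
        case 1 then show ?thesis using order_cases by (simp add: Gy Gz)
      next
        case 2 then show ?thesis using order_cases R0 R2 gam by (simp add: Gy Gz mult_2)
      next
        case 3 then show ?thesis using order_cases meet_w[of j] by (simp add: Gy Gz)
      qed
    qed
    show "Im (cnj (d q) * e q) \<noteq> 0" if "1 \<le> q" "q \<le> n" for q using de that by blast
    show "\<exists>\<epsilon>>0. \<forall>s. \<bar>s\<bar> \<le> \<epsilon> \<longrightarrow>
        G (y (?x q) + s) = G (z q) + of_real s * d q \<and> G (z q + s) = G (z q) + of_real s * e q"
      if "1 \<le> q" "q \<le> n" for q using de that by blast
  qed
  then show thesis using that unfolding n_def by blast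
qed

end

section \<open>Polygons as periodic curves\<close>

text \<open>The edge formula also holds at the right end of the parameter interval, where
  \<open>closed_polygon\<close> already evaluates the next edge at \<open>frac t = 0\<close>. On
  closed intervals the edges can be glued continuously.\<close>

lemma closed_polygon_on_edge:
  fixes k :: int
  assumes P: "P \<noteq> []" and t: "of_int k \<le> t" "t \<le> of_int k + 1"
  shows "closed_polygon P t =
    linepath (P ! nat (k mod int (length P))) (P ! nat ((k + 1) mod int (length P))) (t - of_int k)"
proof -
  have succ: "Suc (nat (j mod int (length P))) mod length P = nat ((j + 1) mod int (length P))" for j
  proof -
    have "int (Suc (nat (j mod int (length P))) mod length P) = (j mod int (length P) + 1) mod int (length P)"
      using P by (simp add: zmod_int add.commute)
    then show ?thesis using P by (simp add: mod_add_left_eq nat_eq_iff)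
  qed
  show ?thesis
  proof (cases "t = of_int k + 1")
    case True
    then have "\<lfloor>t\<rfloor> = k + 1" "frac t = 0" by (auto simp: frac_def)
    then show ?thesis using True by (simp add: closed_polygon_def Let_def linepath_def)
  next
    case False
    then have "\<lfloor>t\<rfloor> = k" using t by linarith
    then show ?thesis by (simp add: closed_polygon_def Let_def succ frac_def)
  qed
qed

lemma closed_polygon_of_int:
  "P \<noteq> [] \<Longrightarrow> closed_polygon P (of_int k) \<in> set P"
  using closed_polygon_on_edge[of P k "of_int k"] by (simp add: linepath_def nat_less_iff)

lemma closed_polygon_periodic:
  "closed_polygon P (t + of_int j * real (length P)) = closed_polygon P t"
proof -
  have *: "t + of_int j * real (length P) = t + of_int (j * int (length P))" by simp
  have "\<lfloor>t + of_int (j * int (length P))\<rfloor> mod int (length P) = \<lfloor>t\<rfloor> mod int (length P)"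
    by (simp only: floor_add_int[symmetric] mod_mult_self1)
  moreover have "frac (t + of_int (j * int (length P))) = frac t" by (simp only: frac_def floor_add_int[symmetric] of_int_add add_diff_cancel_right)
  ultimately show ?thesis unfolding * closed_polygon_def by simp
qed

lemma continuous_on_closed_polygon:
  assumes P: "P \<noteq> []" shows "continuous_on S (closed_polygon P)"
proof -
  have "continuous_on {a..b} (closed_polygon P)" for a b
  proof -
    have "continuous_on (\<Union>k\<in>{\<lfloor>a\<rfloor>..\<lfloor>b\<rfloor>}. {of_int k..of_int k + 1}) (closed_polygon P)"
    proof (rule continuous_on_closed_Union)
      fix k assume "k \<in> {\<lfloor>a\<rfloor>..\<lfloor>b\<rfloor>}"
      have "continuous_on {of_int k..of_int k + 1} (\<lambda>t. linepath (P ! nat (k mod int (length P)))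
          (P ! nat ((k + 1) mod int (length P))) (t - of_int k))"
        unfolding linepath_def by (intro continuous_intros)
      then show "continuous_on {of_int k..of_int k + 1} (closed_polygon P)"
        by (rule continuous_on_eq) (use closed_polygon_on_edge[OF P] in auto)
    qed auto
    moreover have "{a..b} \<subseteq> (\<Union>k\<in>{\<lfloor>a\<rfloor>..\<lfloor>b\<rfloor>}. {of_int k..of_int k + 1})"
    proof
      fix t assume "t \<in> {a..b}"
      then have "\<lfloor>t\<rfloor> \<in> {\<lfloor>a\<rfloor>..\<lfloor>b\<rfloor>}" "t \<in> {of_int \<lfloor>t\<rfloor>..of_int \<lfloor>t\<rfloor> + 1}"
        by (auto simp: floor_mono)
      then show "t \<in> (\<Union>k\<in>{\<lfloor>a\<rfloor>..\<lfloor>b\<rfloor>}. {of_int k..of_int k + 1})" by blast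
    qed
    ultimately show ?thesis by (rule continuous_on_subset)
  qed
  then have "isCont (closed_polygon P) t" for t
    using continuous_on_interior[of "{t - 1..t + 1}" "closed_polygon P" t] by simp
  then show ?thesis by (simp add: continuous_at_imp_continuous_on)
qed

lemma regular_polygon_double_curve:
  assumes "regular_polygon P"
  shows "double_curve (closed_polygon P) (real (length P)) (multiple_points P)"
proof
  let ?m = "real (length P)" and ?c = "closed_polygon P"
  have P: "3 \<le> length P" "finite (multiple_points P)" "\<And>x. x \<in> multiple_points P \<Longrightarrow> card (polygon_fibre P x) = 2"
    "set P \<inter> multiple_points P = {}" using assms by (auto simp: regular_polygon_def)
  have P0: "P \<noteq> []" using P by auto
  show pos: "?m > 0" using P0 by simp
  show "continuous_on UNIV (?c)" by (rule continuous_on_closed_polygon[OF P0])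
  show "?c (t + of_int j * ?m) = ?c t" for t j
    by (rule closed_polygon_periodic)
  show "finite (multiple_points P)" by (rule P(2))
  have shift: "\<exists>j::int. u + of_int j * ?m \<in> polygon_fibre P (?c u)" for u
  proof -
    obtain j :: int where j: "u + of_int j * ?m \<in> {0..<0 + ?m}"
      using window_exists[OF pos, of u 0] by blast
    then have "u + of_int j * ?m \<in> polygon_fibre P (?c u)"
      by (simp add: polygon_fibre_def closed_polygon_periodic)
    then show ?thesis ..
  qed
  show "?c s \<in> multiple_points P"
    if e: "?c s = ?c t" and ne: "\<forall>j::int. t \<noteq> s + of_int j * ?m" for s t
  proof -
    obtain i where i: "s + of_int i * ?m \<in> polygon_fibre P (?c s)" using shift by blast
    obtain j where j: "t + of_int j * ?m \<in> polygon_fibre P (?c s)" using shift e by metis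
    have "s + of_int i * ?m \<noteq> t + of_int j * ?m"
    proof
      assume "s + of_int i * ?m = t + of_int j * ?m"
      then have "t = s + of_int (i - j) * ?m" by (simp add: algebra_simps)
      then show False using ne by blast
    qed
    then show ?thesis using i j unfolding multiple_points_def by blast
  qed
  show "\<exists>s t. ?c s = p \<and> ?c t = p \<and> (\<forall>j::int. t \<noteq> s + of_int j * ?m) \<and>
      (\<forall>u. ?c u = p \<longrightarrow> (\<exists>j::int. u = s + of_int j * ?m \<or> u = t + of_int j * ?m))"
    if p: "p \<in> multiple_points P" for p
  proof -
    obtain s t where st: "polygon_fibre P p = {s, t}" "s \<noteq> t" using P(3)[OF p] by (auto simp: card_2_iff)
    then have w: "s \<in> {0..<0 + ?m}" "t \<in> {0..<0 + ?m}" "?c s = p" "?c t = p"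
      unfolding polygon_fibre_def by auto
    have "t \<noteq> s + of_int j * ?m" for j
    proof
      assume "t = s + of_int j * ?m"
      then show False using window_unique[OF pos w(1,2)] st(2) by simp
    qed
    moreover have "\<exists>j::int. u = s + of_int j * ?m \<or> u = t + of_int j * ?m"
      if up: "?c u = p" for u
    proof -
      obtain j where "u + of_int j * ?m \<in> {s, t}" using shift[of u] unfolding up st(1) by blast
      then have "u = s + of_int (- j) * ?m \<or> u = t + of_int (- j) * ?m" by auto
      then show ?thesis by blast
    qed
    ultimately show ?thesis using w by blast
  qed
  show "\<exists>\<epsilon>>0. \<exists>d. \<forall>s. \<bar>s\<bar> \<le> \<epsilon> \<longrightarrow> ?c (t + s) = ?c t + of_real s * d"
    if t: "?c t \<in> multiple_points P" for t
  proof -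
    define k where "k = \<lfloor>t\<rfloor>"
    \<comment> \<open>A crossing is not a vertex, so its parameters are interior to edges, where the
      curve is affine.\<close>
    have "t \<noteq> of_int k" using closed_polygon_of_int[OF P0, of k] P(4) t by (metis IntI empty_iff)
    then have k: "of_int k < t" "t < of_int k + 1" unfolding k_def by linarith+
    define \<epsilon> where "\<epsilon> = min (t - of_int k) (of_int k + 1 - t)"
    define u where "u = P ! nat (k mod int (length P))"
    define v where "v = P ! nat ((k + 1) mod int (length P))"
    have edge: "?c x = linepath u v (x - of_int k)" if "of_int k \<le> x" "x \<le> of_int k + 1" for x
      using closed_polygon_on_edge[OF P0 that] by (simp only: u_def v_def)
    have "?c (t + s) = ?c t + of_real s * (v - u)" if "\<bar>s\<bar> \<le> \<epsilon>" for s
    proof -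
      have "of_int k \<le> t + s" "t + s \<le> of_int k + 1" using that by (auto simp: \<epsilon>_def)
      then have "?c (t + s) = linepath u v (t + s - of_int k)" by (rule edge)
      moreover have "?c t = linepath u v (t - of_int k)" by (rule edge) (use k in auto)
      ultimately show ?thesis by (simp add: linepath_def scaleR_conv_of_real ring_distribs)
    qed
    moreover have "\<epsilon> > 0" using k by (simp add: \<epsilon>_def)
    ultimately show ?thesis by blast
  qed
qed

text \<open>Chord \<open>k\<close> leaves its first point on the side given by \<open>up k\<close> and reaches its second point on the
  side opposite to the one on which chord \<open>k + 1\<close> leaves it. The last chord ends at the start of the
  slit; this point has position \<open>0\<close> provided that \<open>up (n + 1)\<close> is false.\<close>

definition chord_start :: "nat list \<Rightarrow> (nat \<Rightarrow> bool) \<Rightarrow> nat \<Rightarrow> nat" where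
  "chord_start w up k = position (length w) (crossing_order w k) (up k)"

definition chord_target :: "nat list \<Rightarrow> (nat \<Rightarrow> bool) \<Rightarrow> nat \<Rightarrow> nat" where
  "chord_target w up k = position (length w) (crossing_order w (Suc k)) (\<not> up (Suc k))"

definition planar_chords :: "nat list \<Rightarrow> (nat \<Rightarrow> bool) \<Rightarrow> bool" where
  "planar_chords w up \<longleftrightarrow> \<not> up (Suc (length w)) \<and>
     (\<forall>k\<le>length w. \<forall>l\<le>length w. k \<noteq> l \<longrightarrow>
        between (chord_start w up k) (chord_target w up k) (chord_start w up l) =
        between (chord_start w up k) (chord_target w up k) (chord_target w up l))"

lemma realizable_imp_planar_chords:
  assumes "classically_realizable w"
  shows "\<exists>up. planar_chords w up"
proof -
  obtain D where D: "knot_diagram D" and w: "permutation_word w" "length w = card (crossings D)"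
    and kw: "knot_word_of D ([1..<Suc (card (crossings D))] @ w)"
    using assms by (auto simp: classically_realizable_def straight_word_of_def)
  define m where "m = real (length (vertices D))"
  obtain g s where g: "g \<in> {closed_polygon (vertices D), \<lambda>t. closed_polygon (vertices D) (- t)}" "g s \<notin> crossings D"
    "encounter_labels (crossings_met g m (crossings D) s) = [1..<Suc (card (crossings D))] @ w"
    using kw unfolding knot_word_of_def m_def by metis
  have "double_curve (closed_polygon (vertices D)) m (crossings D)"
    using regular_polygon_double_curve D by (simp add: knot_diagram_def crossings_def m_def)
  then have "double_curve g m (crossings D)" using g(1) double_curve_reverse by auto
  then interpret double_curve g m "crossings D" .
  obtain G y z d e where "straight_curve G (length w) (crossing_order w) y z d e"
    by (rule straight_word_curve[OF g(2) w g(3)])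
  then interpret sc: straight_curve G "length w" "crossing_order w" y z d e .
  have "planar_chords w sc.leftwards"
    unfolding planar_chords_def chord_start_def chord_target_def
    using sc.chords_do_not_cross by (simp add: sc.leftwards_def)
  then show ?thesis by (rule exI[of "planar_chords w"])
qed


section \<open>From chord systems to diagrams\<close>

locale planar_word =
  fixes w :: "nat list" and up :: "nat \<Rightarrow> bool"
  assumes perm: "permutation_word w" and planar: "planar_chords w up"
begin

section \<open>Positions, feet and heights of the chords\<close>

definition N :: nat where "N = Suc (length w)"

abbreviation x where "x \<equiv> crossing_order w"
abbreviation S where "S \<equiv> chord_start w up"
abbreviation T where "T \<equiv> chord_target w up"

definition height :: "nat \<Rightarrow> real" where "height k = \<bar>real (S k) - real (T k)\<bar>"

text \<open>Since \<open>2 * N = 2 * n + 2\<close>, this recovers the number of the crossing from a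
  position; \<open>level_sign\<close> recovers the side, counting the end of the slit as
  left.\<close>

definition foot :: "nat \<Rightarrow> real" where "foot p = (if p \<le> N then real p else 2 * real N - real p)"

definition level_sign :: "nat \<Rightarrow> real" where "level_sign p = (if p \<le> N then 1 else - 1)"

lemma w_range: "j < length w \<Longrightarrow> 1 \<le> w ! j \<and> w ! j \<le> length w"
  using perm nth_mem[of j w] by (auto simp: permutation_word_def)

lemma x_simps: "x 0 = N" "x N = 0" "j < length w \<Longrightarrow> x (Suc j) = w ! j"
  by (auto simp: crossing_order_def N_def)

lemma x_range: "1 \<le> k \<Longrightarrow> k < N \<Longrightarrow> 1 \<le> x k \<and> x k < N"
  using w_range[of "k - 1"] x_simps(3)[of "k - 1"] by (cases k) (auto simp: N_def)

lemma x_le: "k \<le> N \<Longrightarrow> x k \<le> N"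
  using x_range[of k] x_simps by (cases "k = 0"; cases "k = N") auto

lemma x_inj: "k \<le> N \<Longrightarrow> l \<le> N \<Longrightarrow> x k = x l \<Longrightarrow> k = l"
proof -
  have d: "distinct w" using perm by (simp add: permutation_word_def)
  have in_range: "p = q" if "1 \<le> p" "p < N" "1 \<le> q" "q < N" "x p = x q" for p q
  proof -
    obtain i j where ij: "p = Suc i" "q = Suc j" using \<open>1 \<le> p\<close> \<open>1 \<le> q\<close> by (cases p; cases q) auto
    then have "i < length w" "j < length w" using that by (auto simp: N_def)
    then show ?thesis using that(5) ij x_simps(3) nth_eq_iff_index_eq[OF d] by simp
  qed
  assume "k \<le> N" "l \<le> N" "x k = x l"
  moreover have "r = 0 \<or> r = N \<or> 1 \<le> r \<and> r < N" if "r \<le> N" for r using that by linarith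
  ultimately show ?thesis using in_range[of k l] x_range[of k] x_range[of l] x_simps(1,2) N_def
    by (metis Zero_not_Suc not_one_le_zero less_irrefl)
qed

lemma x_permutes: "1 \<le> j \<Longrightarrow> j < N \<Longrightarrow> \<exists>q. 1 \<le> q \<and> q < N \<and> x q = j"
proof -
  assume j: "1 \<le> j" "j < N"
  then have "j \<in> set w" using perm by (auto simp: permutation_word_def N_def)
  then obtain i where "i < length w" "w ! i = j" by (auto simp: in_set_conv_nth)
  then show ?thesis using x_simps(3)[of i] by (intro exI[of _ "Suc i"]) (auto simp: N_def)
qed

lemma not_up_N: "\<not> up N" using planar by (simp add: planar_chords_def N_def)

lemma S_eq: "S k = (if up k then x k else 2 * N - x k)"
  by (simp add: chord_start_def position_def N_def)

lemma T_eq: "T k = (if up (Suc k) then 2 * N - x (Suc k) else x (Suc k))"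
  by (simp add: chord_target_def position_def N_def)

lemma foot_S: "k \<le> N \<Longrightarrow> foot (S k) = x k" and foot_T: "k < N \<Longrightarrow> foot (T k) = x (Suc k)"
  using x_le[of k] x_le[of "Suc k"] by (auto simp: foot_def S_eq T_eq of_nat_diff)

lemma level_sign_S: "1 \<le> k \<Longrightarrow> k < N \<Longrightarrow> level_sign (S k) = (if up k then 1 else - 1)"
  using x_range[of k] by (auto simp: level_sign_def S_eq)

lemma level_sign_T: "k < N \<Longrightarrow> level_sign (T k) = (if up (Suc k) then - 1 else 1)"
  using x_range[of "Suc k"] x_le[of "Suc k"] not_up_N by (cases "Suc k = N") (auto simp: level_sign_def T_eq x_simps)

lemma level_sign_cases: "level_sign p = 1 \<or> level_sign p = - 1"
  by (simp add: level_sign_def)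

lemma ST_bounds: "k < N \<Longrightarrow> S k \<le> 2 * N" "k < N \<Longrightarrow> T k \<le> 2 * N"
  using x_le[of k] x_le[of "Suc k"] by (auto simp: S_eq T_eq)

lemma S_inj: "k < N \<Longrightarrow> l < N \<Longrightarrow> S k = S l \<Longrightarrow> k = l"
  using foot_S[of k] foot_S[of l] x_inj[of k l] by simp

lemma T_inj: "k < N \<Longrightarrow> l < N \<Longrightarrow> T k = T l \<Longrightarrow> k = l"
  using foot_T[of k] foot_T[of l] x_inj[of "Suc k" "Suc l"] by simp

text \<open>A common foot forces \<open>k = Suc l\<close>, and then the two chords use opposite
  sides of this crossing.\<close>

lemma S_neq_T: "k < N \<Longrightarrow> l < N \<Longrightarrow> S k \<noteq> T l"
proof
  assume kl: "k < N" "l < N" and e: "S k = T l"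
  then have "k = Suc l" using foot_S[of k] foot_T[of l] x_inj[of k "Suc l"] by simp
  then show False using level_sign_S[of k] level_sign_T[of l] kl e by (auto split: if_splits)
qed

lemma height_ge_1: "k < N \<Longrightarrow> 1 \<le> height k"
  using S_neq_T[of k k] unfolding height_def by linarith

text \<open>All chord ends have distinct positions, so an end of \<open>l\<close> in the closed span
  of \<open>k\<close> lies strictly inside, and planarity puts the other end inside as well.\<close>

lemma nested:
  assumes kl: "k < N" "l < N" "k \<noteq> l" and r: "r = S l \<or> r = T l" "min (S k) (T k) \<le> r" "r \<le> max (S k) (T k)"
  shows "height l < height k"
proof -
  have "S l \<noteq> S k" "S l \<noteq> T k" "T l \<noteq> S k" "T l \<noteq> T k"
    using S_inj[of k l] T_inj[of k l] S_neq_T[of l k] S_neq_T[of k l] kl by auto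
  then have "between (S k) (T k) r" using r unfolding between_def by (metis le_neq_implies_less max_def min_def)
  moreover have "between (S k) (T k) (S l) = between (S k) (T k) (T l)"
    using planar kl by (auto simp: planar_chords_def N_def)
  ultimately have "between (S k) (T k) (S l)" "between (S k) (T k) (T l)" using r by auto
  then show ?thesis unfolding between_def height_def by linarith
qed

text \<open>Of two overlapping intervals one contains the left end of the other, and then
  \<open>nested\<close> makes the other one shorter.\<close>

lemma overlapping_heights:
  assumes kl: "k < N" "l < N" "k \<noteq> l"
    and u: "real (min (S k) (T k)) \<le> u" "u \<le> real (max (S k) (T k))"
      "real (min (S l) (T l)) \<le> u" "u \<le> real (max (S l) (T l))"
  shows "height k \<noteq> height l"
proof -
  have a: "min (S k) (T k) \<le> max (S l) (T l)" "min (S l) (T l) \<le> max (S k) (T k)"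
    using order_trans[OF u(1,4)] order_trans[OF u(3,2)] by linarith+
  then consider "min (S k) (T k) \<le> min (S l) (T l)" "min (S l) (T l) \<le> max (S k) (T k)"
    | "min (S l) (T l) \<le> min (S k) (T k)" "min (S k) (T k) \<le> max (S l) (T l)" by linarith
  then show ?thesis
  proof cases
    case 1
    have "min (S l) (T l) = S l \<or> min (S l) (T l) = T l" by linarith
    then show ?thesis using nested[OF kl _ 1] by simp
  next
    case 2
    have "min (S k) (T k) = S k \<or> min (S k) (T k) = T k" by linarith
    then show ?thesis using nested[OF kl(2,1) kl(3)[symmetric] _ 2] by simp
  qed
qed

text \<open>A chord whose feet lie on the same side of the slit is a single horizontal line, cut into three
  edges so that every chord has four corners.\<close>

definition corner :: "nat \<Rightarrow> nat \<Rightarrow> complex" where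
  "corner k j =
     (if j = 0 then Complex (foot (S k)) (level_sign (S k) * height k)
      else if j = 3 then Complex (foot (T k)) (level_sign (T k) * height k)
      else if level_sign (S k) = level_sign (T k)
        then Complex (foot (S k) + (foot (T k) - foot (S k)) * (real j / 3)) (level_sign (S k) * height k)
      else Complex (real N + height k) ((if j = 1 then level_sign (S k) else level_sign (T k)) * height k))"

text \<open>With this numbering edge \<open>0\<close> is the slit, edge \<open>1 + 4 * k\<close> is
  the vertical line \<open>vert k\<close> at the slit point \<open>x k\<close>, and the edges
  \<open>2 + 4 * k + j\<close> with \<open>j < 3\<close> draw chord \<open>k\<close>.\<close>

definition vertex :: "nat \<Rightarrow> complex" where
  "vertex i = (if i = 0 then 0 else if i = 1 then Complex (real N) 0 else corner ((i - 2) div 4) ((i - 2) mod 4))"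

definition polygon :: "complex list" where "polygon = map vertex [0..<4 * N + 2]"

abbreviation curve :: "real \<Rightarrow> complex" where "curve \<equiv> closed_polygon polygon"

definition chord_arc :: "nat \<Rightarrow> nat \<Rightarrow> real \<Rightarrow> complex" where
  "chord_arc k j r = linepath (corner k j) (corner k (Suc j)) r"

definition vert_start :: "nat \<Rightarrow> real" where
  "vert_start k = (if k = 0 then 0 else level_sign (T (k - 1)) * height (k - 1))"

definition vert_end :: "nat \<Rightarrow> real" where
  "vert_end k = (if k = N then 0 else level_sign (S k) * height k)"

definition vert :: "nat \<Rightarrow> real \<Rightarrow> complex" where
  "vert k r = Complex (real (x k)) (vert_start k + (vert_end k - vert_start k) * r)"

lemma chord_arc_same:
  "level_sign (S k) = level_sign (T k) \<Longrightarrow> j < 3 \<Longrightarrow>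
    chord_arc k j r = Complex (foot (S k) + (foot (T k) - foot (S k)) * ((real j + r) / 3)) (level_sign (S k) * height k)"
  by (auto simp: chord_arc_def corner_def linepath_def complex_eq_iff field_simps less_Suc_eq numeral_3_eq_3)

lemma chord_arc_around:
  assumes "level_sign (S k) \<noteq> level_sign (T k)"
  shows "chord_arc k 0 r = Complex (foot (S k) + (real N + height k - foot (S k)) * r) (level_sign (S k) * height k)"
    "chord_arc k 1 r = Complex (real N + height k) (level_sign (S k) * height k * (1 - 2 * r))"
    "chord_arc k 2 r = Complex (real N + height k - (real N + height k - foot (T k)) * r) (- (level_sign (S k) * height k))"
proof -
  have t: "level_sign (T k) = - level_sign (S k)" using assms level_sign_cases[of "S k"] level_sign_cases[of "T k"] by auto
  show "chord_arc k 0 r = Complex (foot (S k) + (real N + height k - foot (S k)) * r) (level_sign (S k) * height k)"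
    "chord_arc k 1 r = Complex (real N + height k) (level_sign (S k) * height k * (1 - 2 * r))"
    "chord_arc k 2 r = Complex (real N + height k - (real N + height k - foot (T k)) * r) (- (level_sign (S k) * height k))"
    using assms by (auto simp: t chord_arc_def corner_def linepath_def complex_eq_iff algebra_simps)
qed

text \<open>The inverse of folding the half-plane above the positions around the slit. Points beyond the end of
  the slit lie between the positions of the end and of the last crossing on the right.\<close>

definition strip_position :: "complex \<Rightarrow> real" where
  "strip_position p = (if Re p > N then real N + 1/2 else if Im p > 0 then Re p else 2 * real N - Re p)"

section \<open>Where pieces of the drawing can meet\<close>

lemma foot_range: "p \<le> 2 * N \<Longrightarrow> 0 \<le> foot p \<and> foot p \<le> real N"
  by (auto simp: foot_def)

text \<open>The column \<open>Re p = N + height k\<close> in \<open>corner\<close> is chosen so that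
  a chord keeps constant height also around the end of the slit. Such a chord leads from a position
  at most \<open>N\<close> to one above \<open>N\<close>, so its span contains the value
  \<open>N + 1/2\<close> given to all points beyond the slit.\<close>

lemma chord_arc_bounds:
  assumes k: "k < N" and j: "j < 3" and r: "0 \<le> r" "r \<le> 1"
  shows "max \<bar>Im (chord_arc k j r)\<bar> (Re (chord_arc k j r) - real N) = height k"
    and "real (min (S k) (T k)) \<le> strip_position (chord_arc k j r)"
    and "strip_position (chord_arc k j r) \<le> real (max (S k) (T k))"
proof -
  have h: "height k \<ge> 1" using height_ge_1[OF k] .
  note b = ST_bounds[OF k] foot_range[OF ST_bounds(1)[OF k]] foot_range[OF ST_bounds(2)[OF k]]
  have conv: "min a c \<le> a + (c - a) * t \<and> a + (c - a) * t \<le> max a c" if "0 \<le> t" "t \<le> 1" for a c t :: real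
  proof -
    have "a + (c - a) * t \<in> closed_segment a c" using that
      by (auto simp: in_segment algebra_simps intro!: exI[of _ t])
    then show ?thesis by (auto simp: closed_segment_eq_real_ivl split: if_splits)
  qed
  have "max \<bar>Im (chord_arc k j r)\<bar> (Re (chord_arc k j r) - real N) = height k \<and>
    real (min (S k) (T k)) \<le> strip_position (chord_arc k j r) \<and> strip_position (chord_arc k j r) \<le> real (max (S k) (T k))"
  proof (cases "level_sign (S k) = level_sign (T k)")
    case True
    define X where "X = foot (S k) + (foot (T k) - foot (S k)) * ((real j + r) / 3)"
    have X: "min (foot (S k)) (foot (T k)) \<le> X" "X \<le> max (foot (S k)) (foot (T k))"
      using conv[of "(real j + r) / 3" "foot (S k)" "foot (T k)"] j r by (auto simp: X_def)
    have "X \<le> real N" using X b by linarith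
    have a: "chord_arc k j r = Complex X (level_sign (S k) * height k)" unfolding X_def by (rule chord_arc_same[OF True j])
    show ?thesis
    proof (cases "S k \<le> N")
      case True1: True
      then have "T k \<le> N" using True by (auto simp: level_sign_def split: if_splits)
      then show ?thesis using True1 X h \<open>X \<le> real N\<close> by (auto simp: a strip_position_def level_sign_def foot_def)
    next
      case False
      then have "\<not> T k \<le> N" using True by (auto simp: level_sign_def split: if_splits)
      then show ?thesis using False X h \<open>X \<le> real N\<close> by (auto simp: a strip_position_def level_sign_def foot_def min_def max_def split: if_splits)
    qed
  next
    case False
    note ar = chord_arc_around[OF False]
    have d: "S k \<le> N \<and> N < T k \<or> T k \<le> N \<and> N < S k" using False by (auto simp: level_sign_def split: if_splits)
    have r0: "0 \<le> (real N + height k - f) * r" "(real N + height k - f) * r \<le> real N + height k - f" if "0 \<le> f" "f \<le> real N" for f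
      using r h that by (auto intro!: mult_left_le)
    have rr: "\<bar>1 - 2 * r\<bar> \<le> 1" using r by auto
    consider "j = 0" | "j = 1" | "j = 2" using j by linarith
    then show ?thesis
    proof cases
      case 1
      define X where "X = foot (S k) + (real N + height k - foot (S k)) * r"
      have "foot (S k) \<le> X" "X \<le> real N + height k" using r0[of "foot (S k)"] b by (auto simp: X_def)
      then show ?thesis using d h unfolding 1 ar X_def[symmetric] strip_position_def level_sign_def
        by (auto simp: foot_def split: if_splits)
    next
      case 2
      have "\<bar>level_sign (S k) * height k * (1 - 2 * r)\<bar> \<le> height k"
        using rr h mult_left_mono[OF rr, of "height k"] by (simp add: abs_mult level_sign_def)
      then show ?thesis using d h unfolding 2 ar strip_position_def by auto
    next
      case 3
      define X where "X = real N + height k - (real N + height k - foot (T k)) * r"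
      have "foot (T k) \<le> X" "X \<le> real N + height k" using r0[of "foot (T k)"] b by (auto simp: X_def)
      then show ?thesis using d h unfolding 3 ar X_def[symmetric] strip_position_def level_sign_def
        by (auto simp: foot_def split: if_splits)
    qed
  qed
  then show "max \<bar>Im (chord_arc k j r)\<bar> (Re (chord_arc k j r) - real N) = height k"
    and "real (min (S k) (T k)) \<le> strip_position (chord_arc k j r)"
    and "strip_position (chord_arc k j r) \<le> real (max (S k) (T k))" by auto
qed

text \<open>The exceptional value \<open>r' = 1\<close> for \<open>j' = 2\<close> includes the last
  corner of the chord, which is the start of the next vertical edge;
  \<open>vert_chord_arc_disjoint\<close> relies on it.\<close>

lemma chord_arc_inj:
  assumes k: "k < N" and j: "j < 3" "j' < 3" and r: "0 \<le> r" "r < 1" "0 \<le> r'" "r' \<le> 1" "r' < 1 \<or> j' = 2"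
    and e: "chord_arc k j r = chord_arc k j' r'"
  shows "j = j' \<and> r = r'"
proof (cases "level_sign (S k) = level_sign (T k)")
  case True
  have "foot (S k) \<noteq> foot (T k)"
  proof
    assume "foot (S k) = foot (T k)"
    then have "k = Suc k" using foot_S[of k] foot_T[of k] x_inj[of k "Suc k"] k by simp
    then show False by simp
  qed
  then have "real j + r = real j' + r'" using e unfolding chord_arc_same[OF True j(1)] chord_arc_same[OF True j(2)] by simp
  then have "real j < real j' + 1 + 1" "real j' < real j + 1 + (if r' = 1 then 1 else 0)" using r by auto
  then show ?thesis using \<open>real j + r = real j' + r'\<close> r j by (cases "j = j'") (auto split: if_splits)
next
  case False
  note ar = chord_arc_around[OF False]
  have h: "height k \<ge> 1" using height_ge_1[OF k] .
  note b = foot_range[OF ST_bounds(1)[OF k]] foot_range[OF ST_bounds(2)[OF k]]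
  have c: "j = 0 \<or> j = 1 \<or> j = 2" "j' = 0 \<or> j' = 1 \<or> j' = 2" using j by linarith+
  have nz: "real N + height k - foot (S k) \<noteq> 0" "real N + height k - foot (T k) \<noteq> 0" using b h by auto
  have one: "(real N + height k - f) * s = real N + height k - f \<longleftrightarrow> s = 1" if "real N + height k - f \<noteq> 0" for f s
    using that by auto
  have ls: "level_sign (S k) * height k \<noteq> 0" using h level_sign_cases[of "S k"] by auto
  show ?thesis using c
  proof (elim disjE)
    assume jj: "j = 0" "j' = 0" then show ?thesis using e nz unfolding jj ar by simp
  next
    assume jj: "j = 0" "j' = 1"
    then have "foot (S k) + (real N + height k - foot (S k)) * r = real N + height k" using e unfolding jj ar by simp
    then have "(real N + height k - foot (S k)) * r = real N + height k - foot (S k)" by linarith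
    then show ?thesis using one[OF nz(1), of r] r jj by simp
  next
    assume jj: "j = 0" "j' = 2" then show ?thesis using e ls unfolding jj ar by simp
  next
    assume jj: "j = 1" "j' = 0"
    then have "foot (S k) + (real N + height k - foot (S k)) * r' = real N + height k" using e unfolding jj ar by simp
    then have "(real N + height k - foot (S k)) * r' = real N + height k - foot (S k)" by linarith
    then show ?thesis using one[OF nz(1), of r'] r jj by simp
  next
    assume jj: "j = 1" "j' = 1" then show ?thesis using e ls unfolding jj ar by simp
  next
    assume jj: "j = 1" "j' = 2"
    then have "level_sign (S k) * height k * (1 - 2 * r) = level_sign (S k) * height k * (- 1)"
      using e unfolding jj ar by simp
    then have "1 - 2 * r = - 1" using ls mult_cancel_left by blast
    then show ?thesis using r by simp
  next
    assume jj: "j = 2" "j' = 0" then show ?thesis using e ls unfolding jj ar by simp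
  next
    assume jj: "j = 2" "j' = 1"
    then have "level_sign (S k) * height k * (1 - 2 * r') = level_sign (S k) * height k * (- 1)"
      using e unfolding jj ar by simp
    then have "1 - 2 * r' = - 1" using ls mult_cancel_left by blast
    then show ?thesis using r jj by simp
  next
    assume jj: "j = 2" "j' = 2" then show ?thesis using e nz unfolding jj ar by simp
  qed
qed

text \<open>A common point would give both chords the same height and a common position in their
  spans.\<close>

lemma chord_arc_disjoint:
  assumes "k < N" "l < N" "k \<noteq> l" "j < 3" "j' < 3" "0 \<le> r" "r \<le> 1" "0 \<le> r'" "r' \<le> 1"
  shows "chord_arc k j r \<noteq> chord_arc l j' r'"
  using overlapping_heights[OF assms(1-3), of "strip_position (chord_arc k j r)"]
    chord_arc_bounds[OF assms(1,4,6,7)] chord_arc_bounds[OF assms(2,5,8,9)] by auto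

text \<open>A common point puts the slit point \<open>x k\<close> under chord \<open>l\<close>. The
  chord to which the vertical edge leads on this side of the slit is then nested in
  \<open>l\<close>, hence lower, so the edge stops before reaching \<open>l\<close>. If that chord
  is \<open>l\<close> itself, only the corner where the edge starts remains, and this is excluded by
  \<open>r' < 1\<close>.\<close>

lemma vert_chord_arc_disjoint:
  assumes k: "k \<le> N" "l < N" and j: "j < 3" and r: "0 \<le> r" "r < 1" "0 \<le> r'" "r' < 1"
  shows "vert k r \<noteq> chord_arc l j r'"
proof
  assume e: "vert k r = chord_arc l j r'"
  define Y where "Y = Im (vert k r)"
  note b = chord_arc_bounds[OF k(2) j r(3) less_imp_le[OF r(4)], folded e]
  have hl: "height l \<ge> 1" by (rule height_ge_1[OF k(2)])
  have X: "Re (vert k r) = real (x k)" "real (x k) \<le> real N" using x_le[OF k(1)] by (auto simp: vert_def)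
  have Y: "\<bar>Y\<bar> = height l" using b(1) hl X by (auto simp: Y_def max_def split: if_splits)
  have Yr: "Y = vert_start k + (vert_end k - vert_start k) * r" by (simp add: Y_def vert_def)
  have sp: "strip_position (vert k r) = real p" if "p \<le> 2 * N" "foot p = real (x k)" "level_sign p * Y > 0" for p
    using that X unfolding strip_position_def Y_def[symmetric] by (auto simp: level_sign_def foot_def split: if_splits)
  have bound: "min (S l) (T l) \<le> p" "p \<le> max (S l) (T l)"
    if "p \<le> 2 * N" "foot p = real (x k)" "level_sign p * Y > 0" for p
    using b(2,3) unfolding sp[OF that] by linarith+
  \<comment> \<open>A vertical edge crosses the slit or has an end on it, so its two ends are not
    strictly on the same side. Hence the end on the side of \<open>Y\<close> is unique, and the part
    of the edge on this side is no higher than that end.\<close>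
  have start: "vert_start k * vert_end k \<le> 0"
  proof (cases "k = 0 \<or> k = N")
    case False
    then have "1 \<le> k" "k < N" using k by auto
    then have "level_sign (T (k - 1)) = - level_sign (S k)" using level_sign_S[of k] level_sign_T[of "k - 1"] by auto
    then have "vert_start k * vert_end k = - (level_sign (S k))\<^sup>2 * (height (k - 1) * height k)"
      using \<open>1 \<le> k\<close> \<open>k < N\<close> by (simp add: vert_start_def vert_end_def power2_eq_square)
    also have "\<dots> \<le> 0" by (simp add: height_def)
    finally show ?thesis .
  qed (auto simp: vert_start_def vert_end_def)
  have "Y \<noteq> 0" using Y hl by auto
  have Yc: "Y = (1 - r) * vert_start k + r * vert_end k" using Yr by (simp add: algebra_simps)
  have "Y * vert_start k > 0 \<or> Y * vert_end k > 0"
  proof (rule ccontr)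
    assume "\<not> (Y * vert_start k > 0 \<or> Y * vert_end k > 0)"
    then have "Y * vert_start k \<le> 0" "Y * vert_end k \<le> 0" by linarith+
    then have "(1 - r) * (Y * vert_start k) + r * (Y * vert_end k) \<le> 0"
      using r by (intro add_nonpos_nonpos) (simp_all only: mult_nonneg_nonpos diff_ge_0_iff_ge less_imp_le)
    moreover have "Y * Y = (1 - r) * (Y * vert_start k) + r * (Y * vert_end k)"
      by (subst (2) Yc) (simp add: algebra_simps)
    ultimately show False using \<open>Y \<noteq> 0\<close> by (metis not_square_less_zero order_less_le mult_eq_0_iff order.antisym)
  qed
  then show False
  proof
    assume pos: "Y * vert_end k > 0"
    then have "k < N" using k by (auto simp: vert_end_def split: if_splits)
    have ve: "vert_end k = level_sign (S k) * height k" using \<open>k < N\<close> by (simp add: vert_end_def)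
    have hk: "height k \<ge> 1" by (rule height_ge_1[OF \<open>k < N\<close>])
    have "height k * (level_sign (S k) * Y) > 0" using pos unfolding ve by (simp add: mult_ac)
    then have sg: "level_sign (S k) * Y > 0" by (rule zero_less_mult_pos) (use hk in simp)
    have "Y * vert_start k \<le> 0" using start pos by (auto simp: mult_le_0_iff zero_less_mult_iff)
    then have "Y * Y \<le> r * (Y * vert_end k)"
      using r mult_nonneg_nonpos[of "1 - r" "Y * vert_start k"] by (subst (2) Yc) (simp add: algebra_simps)
    also have "\<dots> < Y * vert_end k" using mult_strict_right_mono[OF r(2) pos] by simp
    finally have "\<bar>Y\<bar> * \<bar>Y\<bar> < \<bar>Y\<bar> * \<bar>vert_end k\<bar>" using pos by (simp flip: abs_mult)
    moreover have "0 < \<bar>Y\<bar>" using \<open>Y \<noteq> 0\<close> by simp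
    ultimately have "\<bar>Y\<bar> < \<bar>vert_end k\<bar>" using mult_less_cancel_left_pos by blast
    also have "\<bar>vert_end k\<bar> = height k" using hk level_sign_cases[of "S k"] by (auto simp: ve)
    finally have less: "height l < height k" using Y by simp
    then have "k \<noteq> l" by auto
    then have "height k < height l"
      using nested[OF k(2) \<open>k < N\<close> not_sym, of "S k"] bound[OF ST_bounds(1)[OF \<open>k < N\<close>] _ sg] foot_S[of k] k by auto
    then show False using less by simp
  next
    assume pos: "Y * vert_start k > 0"
    then obtain i where i: "k = Suc i" "i < N" using k by (cases k) (auto simp: vert_start_def)
    have vs: "vert_start k = level_sign (T i) * height i" using i by (simp add: vert_start_def)
    have hk: "height i \<ge> 1" by (rule height_ge_1[OF i(2)])
    have "height i * (level_sign (T i) * Y) > 0" using pos unfolding vs by (simp add: mult_ac)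
    then have sg: "level_sign (T i) * Y > 0" by (rule zero_less_mult_pos) (use hk in simp)
    have ft: "foot (T i) = real (x k)" using foot_T[OF i(2)] i by simp
    show False
    proof (cases "i = l")
      case False
      then have less: "height i < height l"
        using nested[OF k(2) i(2), of "T i"] bound[OF ST_bounds(2)[OF i(2)] ft sg] by auto
      have "Y * vert_end k \<le> 0" using start pos by (auto simp: mult_le_0_iff zero_less_mult_iff)
      then have "Y * Y \<le> (1 - r) * (Y * vert_start k)"
        using r mult_nonneg_nonpos[of r "Y * vert_end k"] by (subst (2) Yc) (simp add: algebra_simps)
      also have "\<dots> \<le> Y * vert_start k" using r pos by (simp add: mult_left_le_one_le)
      finally have "\<bar>Y\<bar> * \<bar>Y\<bar> \<le> \<bar>Y\<bar> * \<bar>vert_start k\<bar>" using pos by (simp flip: abs_mult)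
      moreover have "0 < \<bar>Y\<bar>" using \<open>Y \<noteq> 0\<close> by simp
      ultimately have "\<bar>Y\<bar> \<le> \<bar>vert_start k\<bar>" using mult_le_cancel_left_pos by blast
      also have "\<bar>vert_start k\<bar> = height i" using hk level_sign_cases[of "T i"] by (auto simp: vs)
      finally show False using less Y by simp
    next
      case True
      have "Y = level_sign (T i) * height i" using Y sg True level_sign_cases[of "T i"] by (auto simp: abs_if split: if_splits)
      then have "vert k r = corner l 3" using True X(1) ft by (simp add: corner_def complex_eq_iff Y_def)
      also have "\<dots> = chord_arc l 2 1" by (simp add: chord_arc_def linepath_def numeral_3_eq_3)
      finally have "chord_arc l j r' = chord_arc l 2 1" using e by simp
      then show False using chord_arc_inj[OF k(2) j, of 2 r' 1] r by simp
    qed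
  qed
qed

lemma vert_inj:
  assumes "k \<le> N" "l \<le> N" "vert k r = vert l r'"
  shows "k = l \<and> r = r'"
proof -
  have "k = l" using assms x_inj[of k l] by (simp add: vert_def)
  moreover have "vert_end k \<noteq> vert_start k"
  proof (cases "k = 0 \<or> k = N")
    case True
    then show ?thesis using height_ge_1[of 0] height_ge_1[of "N - 1"] level_sign_cases[of "S 0"] level_sign_cases[of "T (N - 1)"]
      by (auto simp: vert_end_def vert_start_def N_def)
  next
    case False
    then have "1 \<le> k" "k < N" using assms by auto
    then have "level_sign (T (k - 1)) = - level_sign (S k)" using level_sign_S[of k] level_sign_T[of "k - 1"] by auto
    moreover have "k - 1 < N" using \<open>k < N\<close> by linarith
    ultimately show ?thesis using \<open>1 \<le> k\<close> \<open>k < N\<close> height_ge_1[of k] height_ge_1[of "k - 1"] level_sign_cases[of "S k"]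
      by (auto simp: vert_end_def vert_start_def)
  qed
  ultimately show ?thesis using assms by (simp add: vert_def)
qed

definition slit_point :: "real \<Rightarrow> complex" where "slit_point r = Complex (real N * r) 0"

lemma slit_chord_arc_disjoint:
  assumes "k < N" "j < 3" "0 \<le> r'" "r' \<le> 1" "r \<le> 1"
  shows "slit_point r \<noteq> chord_arc k j r'"
proof
  assume "slit_point r = chord_arc k j r'"
  then have "Re (chord_arc k j r') = real N * r" "Im (chord_arc k j r') = 0" by (auto simp: slit_point_def dest: sym)
  then have "height k \<le> 0"
    using chord_arc_bounds(1)[OF assms(1-4)] assms(5) mult_left_mono[of r 1 "real N"] by simp
  then show False using height_ge_1[OF assms(1)] by simp
qed

text \<open>The zero of the linear interpolation between \<open>vert_start k\<close> and
  \<open>vert_end k\<close>, that is, the parameter at which the vertical edge passes the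
  slit.\<close>

definition crossing_param :: "nat \<Rightarrow> real" where
  "crossing_param k = vert_start k / (vert_start k - vert_end k)"

lemma crossing_param:
  assumes "1 \<le> k" "k < N"
  shows "0 < crossing_param k" "crossing_param k < 1" "vert k r = Complex X 0 \<longleftrightarrow> X = real (x k) \<and> r = crossing_param k"
proof -
  have "level_sign (T (k - 1)) = - level_sign (S k)" using level_sign_S[of k] level_sign_T[of "k - 1"] assms by auto
  then have v: "vert_start k = - level_sign (S k) * height (k - 1)" "vert_end k = level_sign (S k) * height k"
    using assms by (auto simp: vert_end_def vert_start_def)
  have "k - 1 < N" using assms by linarith
  then have h: "height (k - 1) \<ge> 1" "height k \<ge> 1" using height_ge_1 assms by blast+
  have ls: "level_sign (S k) = 1 \<or> level_sign (S k) = - 1" by (rule level_sign_cases)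
  have c: "crossing_param k = height (k - 1) / (height (k - 1) + height k)"
    using ls
  proof
    assume "level_sign (S k) = 1"
    then have "crossing_param k = - height (k - 1) / - (height (k - 1) + height k)"
      by (simp add: crossing_param_def v)
    then show ?thesis by (simp only: minus_divide_divide)
  qed (simp add: crossing_param_def v)
  show "0 < crossing_param k" "crossing_param k < 1" using h by (auto simp: c)
  have "vert_start k - vert_end k \<noteq> 0" using ls h by (auto simp: v)
  then show "vert k r = Complex X 0 \<longleftrightarrow> X = real (x k) \<and> r = crossing_param k"
    by (auto simp: vert_def crossing_param_def field_simps)
qed

text \<open>The half-open ranges exclude the ends of the slit, where the vertical edges
  \<open>0\<close> and \<open>N\<close> meet it in a vertex. All other vertical edges cross it
  once.\<close>

lemma slit_vert:
  assumes k: "k \<le> N" and r: "0 \<le> r" "r < 1" "0 \<le> r'" "r' < 1" and e: "slit_point r = vert k r'"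
  shows "1 \<le> k \<and> k < N \<and> r = real (x k) / real N \<and> r' = crossing_param k"
proof -
  have n0: "real N > 0" by (simp add: N_def)
  have "k \<noteq> 0"
  proof
    assume "k = 0"
    then have "real N * r = real N" using e by (simp add: slit_point_def vert_def x_simps)
    then show False using r n0 by simp
  qed
  moreover have "k \<noteq> N"
  proof
    assume k: "k = N"
    then have "vert_start k * (1 - r') = 0" using e by (simp add: slit_point_def vert_def vert_end_def algebra_simps)
    moreover have "vert_start k \<noteq> 0" using k height_ge_1[of "N - 1"] level_sign_cases[of "T (N - 1)"]
      by (auto simp: vert_start_def N_def)
    ultimately show False using r by simp
  qed
  ultimately have k: "1 \<le> k" "k < N" using k by auto
  have "real N * r = real (x k) \<and> r' = crossing_param k"
    using e crossing_param(3)[OF k, of r' "real N * r"] unfolding slit_point_def by metis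
  then show ?thesis using k n0 by (simp add: field_simps)
qed

section \<open>Parameters of the drawn polygon\<close>

lemma length_polygon: "length polygon = 4 * N + 2"
  by (simp add: polygon_def)

lemma polygon_nth: "i < 4 * N + 2 \<Longrightarrow> polygon ! i = vertex i"
  by (simp add: polygon_def del: upt_Suc)

lemma polygon_edge:
  assumes "i < 4 * N + 2" "0 \<le> r" "r < 1"
  shows "curve (real i + r) = linepath (vertex i) (vertex (Suc i mod (4 * N + 2))) r"
proof -
  have "\<lfloor>real i + r\<rfloor> = int i" using assms by linarith
  moreover have "frac (real i + r) = r" using assms by (simp add: frac_def \<open>\<lfloor>real i + r\<rfloor> = int i\<close>)
  moreover have "nat (int i mod int (4 * N + 2)) = i" using assms by simp
  moreover have "polygon ! i = vertex i" "polygon ! (Suc i mod (4 * N + 2)) = vertex (Suc i mod (4 * N + 2))"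
    using assms by (auto intro!: polygon_nth)
  ultimately show ?thesis unfolding closed_polygon_def length_polygon Let_def by (simp only:)
qed

lemma vertex_simps: "vertex 0 = 0" "vertex (Suc 0) = Complex (real N) 0"
  "j < 4 \<Longrightarrow> vertex (2 + 4 * k + j) = corner k j"
  by (auto simp: vertex_def)

lemma polygon_slit: "0 \<le> r \<Longrightarrow> r < 1 \<Longrightarrow> curve r = slit_point r"
  using polygon_edge[of 0 r] by (simp add: vertex_simps slit_point_def linepath_def complex_eq_iff)

lemma polygon_chord_arc:
  assumes "k < N" "j < 3" "0 \<le> r" "r < 1"
  shows "curve (real (2 + 4 * k + j) + r) = chord_arc k j r"
proof -
  have "Suc (2 + 4 * k + j) mod (4 * N + 2) = 2 + 4 * k + Suc j" using assms by simp
  then show ?thesis using polygon_edge[of "2 + 4 * k + j" r] assms vertex_simps(3)[of j k] vertex_simps(3)[of "Suc j" k]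
    by (simp add: chord_arc_def)
qed

lemma polygon_vert:
  assumes "k \<le> N" "0 \<le> r" "r < 1"
  shows "curve (real (1 + 4 * k) + r) = vert k r"
proof -
  have a: "vertex (1 + 4 * k) = Complex (real (x k)) (vert_start k)"
  proof (cases k)
    case 0 then show ?thesis by (simp add: vertex_simps vert_start_def x_simps)
  next
    case (Suc i)
    have "vertex (1 + 4 * k) = corner i 3" using vertex_simps(3)[of 3 i] Suc by simp
    then show ?thesis using Suc assms foot_T[of i] by (simp add: corner_def vert_start_def)
  qed
  have b: "vertex (Suc (1 + 4 * k) mod (4 * N + 2)) = Complex (real (x k)) (vert_end k)"
  proof (cases "k = N")
    case True then show ?thesis by (simp add: vertex_simps vert_end_def x_simps complex_eq_iff)
  next
    case False
    then have "Suc (1 + 4 * k) mod (4 * N + 2) = 2 + 4 * k + 0" using assms by simp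
    then show ?thesis using False assms foot_S[of k] by (simp only: vertex_simps(3)) (simp add: corner_def vert_end_def)
  qed
  show ?thesis using polygon_edge[of "1 + 4 * k" r] assms unfolding a b
    by (simp add: vert_def linepath_def complex_eq_iff algebra_simps)
qed

lemma param_cases:
  assumes "t \<in> {0..<real (4 * N + 2)}"
  obtains (slit) "0 \<le> t" "t < 1" "curve t = slit_point t"
  | (vert) k r where "k \<le> N" "0 \<le> r" "r < 1" "t = real (1 + 4 * k) + r" "curve t = vert k r"
  | (chord_arc) k j r where "k < N" "j < 3" "0 \<le> r" "r < 1" "t = real (2 + 4 * k + j) + r" "curve t = chord_arc k j r"
proof -
  define i where "i = nat \<lfloor>t\<rfloor>"
  define r where "r = frac t"
  have t: "t = real i + r" "0 \<le> r" "r < 1" using assms by (auto simp: i_def r_def frac_def frac_lt_1[unfolded frac_def])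
  then have "real i < real (4 * N + 2)" using assms by simp
  then have i: "i < 4 * N + 2" by linarith
  consider "i = 0" | "i \<ge> 1" by linarith
  then show thesis
  proof cases
    case 1 then show thesis using slit polygon_slit[of r] t by simp
  next
    case 2
    define k where "k = (i - 1) div 4"
    define j where "j = (i - 1) mod 4"
    have ij: "i = 1 + 4 * k + j" "j < 4" using 2 by (auto simp: k_def j_def)
    show thesis
    proof (cases j)
      case 0
      then have "k \<le> N" using i ij by simp
      then show thesis using vert[of k r] polygon_vert[of k r] t ij 0 by simp
    next
      case (Suc j')
      then have "k < N" "j' < 3" "i = 2 + 4 * k + j'" using i ij by auto
      then show thesis using chord_arc[of k j' r] polygon_chord_arc[of k j' r] t by simp
    qed
  qed
qed

text \<open>Edges are taken without their final vertex, so consecutive edges do not count as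
  meeting; the disjointness lemmas then leave only pairs of the slit and a vertical edge.\<close>

lemma polygon_meets:
  assumes s: "s \<in> {0..<real (4 * N + 2)}" and t: "t \<in> {0..<real (4 * N + 2)}" and st: "s < t"
    and e: "curve s = curve t"
  shows "\<exists>k. 1 \<le> k \<and> k < N \<and> s = real (x k) / real N \<and> t = real (1 + 4 * k) + crossing_param k"
  using s
proof (cases rule: param_cases)
  case slit
  show ?thesis using t
  proof (cases rule: param_cases)
    case slit': slit
    then have "real N * s = real N * t" using e slit by (simp add: slit_point_def)
    then show ?thesis using st by (simp add: N_def)
  next
    case (vert k r)
    then show ?thesis using slit_vert[of k s r] slit e by auto
  next
    case (chord_arc k j r)
    then show ?thesis using slit_chord_arc_disjoint[of k j r s] slit e by simp
  qed
next
  case s: (vert k r)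
  show ?thesis using t
  proof (cases rule: param_cases)
    case slit
    then show ?thesis using s st by simp
  next
    case (vert l r')
    then show ?thesis using vert_inj[of k l r r'] s e st by simp
  next
    case (chord_arc l j r')
    then show ?thesis using vert_chord_arc_disjoint[of k l j r r'] s e by simp
  qed
next
  case s: (chord_arc k j r)
  show ?thesis using t
  proof (cases rule: param_cases)
    case slit
    then show ?thesis using s st by simp
  next
    case (vert l r')
    then show ?thesis using vert_chord_arc_disjoint[of l k j r' r] s e by simp
  next
    case (chord_arc l j' r')
    then show ?thesis using chord_arc_disjoint[of k l j j' r r'] chord_arc_inj[of k j j' r r'] s e st by (cases "k = l") auto
  qed
qed

end

section \<open>The word of the drawn polygon\<close>

text \<open>In a word that begins with \<open>1, ..., n\<close> the entries before the first
  \<open>v\<close> are exactly \<open>1, ..., v - 1\<close>, so every entry is its own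
  label.\<close>

lemma encounter_labels_straight:
  assumes f: "inj f" and w: "set w \<subseteq> {1..n}"
  shows "encounter_labels (map f ([1..<Suc n] @ w)) = [1..<Suc n] @ w"
proof -
  have label: "Suc (card (set (takeWhile (\<lambda>y. y \<noteq> f v) (map f ([1..<Suc n] @ w))))) = v" if v: "v \<in> {1..n}" for v
  proof -
    have "[1..<Suc n] @ w = [1..<v] @ v # ([Suc v..<Suc n] @ w)"
      using v by (simp add: upt_conv_Cons[symmetric] upt_add_eq_append[symmetric] del: upt_Suc)
        (metis append_assoc le_SucI less_Suc_eq_le upt_add_eq_append le_add_diff_inverse)
    then have "takeWhile (\<lambda>y. y \<noteq> f v) (map f ([1..<Suc n] @ w)) = map f [1..<v]"
      by (simp only: map_append list.map) (subst takeWhile_append2, use f in \<open>auto dest: injD\<close>)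
    then have "set (takeWhile (\<lambda>y. y \<noteq> f v) (map f ([1..<Suc n] @ w))) = f ` {1..<v}" by simp
    then show ?thesis using v f by (simp add: card_image inj_on_subset)
  qed
  have "set ([1..<Suc n] @ w) \<subseteq> {1..n}" using w by auto
  then have "map (\<lambda>v. Suc (card (set (takeWhile (\<lambda>y. y \<noteq> f v) (map f ([1..<Suc n] @ w)))))) ([1..<Suc n] @ w)
      = map (\<lambda>v. v) ([1..<Suc n] @ w)"
    using label by (intro map_cong refl) blast
  then show ?thesis by (simp only: encounter_labels_def map_map o_def list.map_ident)
qed

context planar_word
begin

definition slit_time :: "nat \<Rightarrow> real" where "slit_time j = real j / real N"

definition vert_time :: "nat \<Rightarrow> real" where "vert_time q = real (1 + 4 * q) + crossing_param q"

lemma slit_time: "1 \<le> j \<Longrightarrow> j < N \<Longrightarrow> 0 < slit_time j \<and> slit_time j < 1"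
  by (simp add: slit_time_def)

lemma vert_time: "1 \<le> q \<Longrightarrow> q < N \<Longrightarrow> real (1 + 4 * q) < vert_time q \<and> vert_time q < real (2 + 4 * q)"
  using crossing_param[of q] by (simp add: vert_time_def)

lemma slit_time_range: "1 \<le> j \<Longrightarrow> j < N \<Longrightarrow> slit_time j \<in> {0<..<real (4 * N + 2)}"
  using slit_time[of j] by auto

lemma vert_time_range: "1 \<le> q \<Longrightarrow> q < N \<Longrightarrow> vert_time q \<in> {1<..<real (4 * N + 2)}"
  using vert_time[of q] by auto

lemma polygon_slit_time: "1 \<le> j \<Longrightarrow> j < N \<Longrightarrow> curve (slit_time j) = of_nat j"
  using polygon_slit[of "slit_time j"] slit_time[of j]
  by (simp add: slit_point_def slit_time_def complex_eq_iff)

lemma polygon_vert_time: "1 \<le> q \<Longrightarrow> q < N \<Longrightarrow> curve (vert_time q) = of_nat (x q)"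
  using polygon_vert[of q "crossing_param q"] crossing_param[of q]
  by (simp add: vert_time_def complex_eq_iff)

lemma polygon_fibre_crossing:
  assumes q: "1 \<le> q" "q < N"
  shows "polygon_fibre polygon (of_nat (x q)) = {slit_time (x q), vert_time q}"
proof -
  have j: "1 \<le> x q" "x q < N" using x_range q by auto
  note st = polygon_slit_time[OF j] slit_time[OF j] slit_time_range[OF j]
  note vt = polygon_vert_time[OF q] vert_time[OF q] vert_time_range[OF q]
  have "u = slit_time (x q) \<or> u = vert_time q"
    if u: "u \<in> {0..<real (4 * N + 2)}" "curve u = of_nat (x q)" for u
  proof -
    have s: "slit_time (x q) \<in> {0..<real (4 * N + 2)}" using st(3) by auto
    consider "u < slit_time (x q)" | "u = slit_time (x q)" | "slit_time (x q) < u" by linarith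
    then show ?thesis
    proof cases
      case 1
      then obtain k where "1 \<le> k" "k < N" "slit_time (x q) = real (1 + 4 * k) + crossing_param k"
        using polygon_meets[OF u(1) s] u(2) st by auto
      then show ?thesis using st(2) crossing_param(1)[of k] by auto
    next
      case 3
      then obtain k where k: "1 \<le> k" "k < N" "slit_time (x q) = real (x k) / real N" "u = real (1 + 4 * k) + crossing_param k"
        using polygon_meets[OF s u(1)] u(2) st by auto
      then have "x k = x q" by (simp add: slit_time_def N_def)
      then have "k = q" using x_inj[of k q] k q by simp
      then show ?thesis using k by (simp add: vert_time_def)
    qed auto
  qed
  then show ?thesis unfolding polygon_fibre_def length_polygon
    using st vt by auto
qed

lemma multiple_points_polygon: "multiple_points polygon = of_nat ` {1..<N}"
proof
  show "multiple_points polygon \<subseteq> of_nat ` {1..<N}"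
  proof
    fix p assume "p \<in> multiple_points polygon"
    then obtain s t where st: "s \<in> polygon_fibre polygon p" "t \<in> polygon_fibre polygon p" "s \<noteq> t"
      by (auto simp: multiple_points_def)
    define a where "a = min s t"
    define b where "b = max s t"
    have ab: "a \<in> polygon_fibre polygon p" "b \<in> polygon_fibre polygon p" "a < b"
      using st by (auto simp: a_def b_def min_def max_def)
    then obtain k where k: "1 \<le> k" "k < N" "a = real (x k) / real N"
      using polygon_meets[of a b] by (auto simp: polygon_fibre_def length_polygon)
    then have "p = of_nat (x k)" using ab polygon_slit_time[of "x k"] x_range[of k]
      by (simp add: polygon_fibre_def slit_time_def)
    then show "p \<in> of_nat ` {1..<N}" using x_range[of k] k by auto
  qed
  show "of_nat ` {1..<N} \<subseteq> multiple_points polygon"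
  proof clarify
    fix j assume "j \<in> {1..<N}"
    then obtain q where q: "1 \<le> q" "q < N" "x q = j" using x_permutes[of j] by auto
    have "slit_time j \<noteq> vert_time q" using slit_time[of j] vert_time[of q] x_range[of q] q by auto
    then show "of_nat j \<in> multiple_points polygon"
      unfolding multiple_points_def using polygon_fibre_crossing[OF q(1,2)] q(3) by blast
  qed
qed

lemma crossing_point_cases:
  assumes "p \<in> multiple_points polygon"
  obtains q where "1 \<le> q" "q < N" "p = of_nat (x q)" "polygon_fibre polygon p = {slit_time (x q), vert_time q}"
    "slit_time (x q) < 1" "1 < vert_time q"
proof -
  obtain j where j: "1 \<le> j" "j < N" "p = of_nat j" using assms by (auto simp: multiple_points_polygon)
  then obtain q where q: "1 \<le> q" "q < N" "x q = j" using x_permutes by blast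
  show thesis
    using that[OF q(1,2)] j q polygon_fibre_crossing[OF q(1,2)] slit_time[OF j(1,2)] vert_time_range[OF q(1,2)] by auto
qed

lemma regular_polygon_polygon: "regular_polygon polygon"
  unfolding regular_polygon_def
proof (intro conjI ballI)
  show "3 \<le> length polygon" by (simp add: length_polygon N_def)
  show "finite (multiple_points polygon)" by (simp add: multiple_points_polygon)
  show "card (polygon_fibre polygon p) = 2" if "p \<in> multiple_points polygon" for p
    using that by (rule crossing_point_cases) auto
  show "set polygon \<inter> multiple_points polygon = {}"
  proof (rule ccontr)
    assume "set polygon \<inter> multiple_points polygon \<noteq> {}"
    then obtain p where p: "p \<in> set polygon" "p \<in> multiple_points polygon" by blast
    obtain i where i: "i < 4 * N + 2" "p = polygon ! i" using p(1) by (auto simp: in_set_conv_nth length_polygon)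
    have "curve (real i) = p"
      using polygon_edge[of i 0] i polygon_nth[of i] by (simp add: linepath_def)
    then have fib: "real i \<in> polygon_fibre polygon p" using i unfolding polygon_fibre_def length_polygon by auto
    obtain q where q: "1 \<le> q" "q < N" "p = of_nat (x q)" "polygon_fibre polygon p = {slit_time (x q), vert_time q}"
      by (rule crossing_point_cases[OF p(2)])
    \<comment> \<open>Vertices have integral parameters, whereas the parameters of crossings lie
      strictly between consecutive integers.\<close>
    have "real i = slit_time (x q) \<or> real i = vert_time q" using fib q by simp
    then show False
    proof
      assume "real i = slit_time (x q)"
      then have "0 < real i" "real i < 1" using slit_time[of "x q"] x_range q by auto
      then show False by (cases i) auto
    next
      assume "real i = vert_time q"
      then have "real (1 + 4 * q) < real i" "real i < real (2 + 4 * q)" using vert_time q by auto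
      then show False unfolding of_nat_less_iff by linarith
    qed
  qed
qed

lemma crossings_met_polygon:
  "crossings_met curve (real (length polygon)) (multiple_points polygon) 0
    = map of_nat ([1..<N] @ w)"
proof -
  define ts where "ts = map slit_time [1..<N] @ map vert_time [1..<N]"
  have "vert_time p < vert_time q" if "1 \<le> p" "p < q" "q < N" for p q
  proof -
    have "vert_time p < real (2 + 4 * p)" "real (1 + 4 * q) < vert_time q" using vert_time[of p] vert_time[of q] that by auto
    moreover have "real (2 + 4 * p) \<le> real (1 + 4 * q)" using that by linarith
    ultimately show ?thesis by linarith
  qed
  moreover have "slit_time p < slit_time q" if "p < q" for p q
    using that by (simp add: slit_time_def N_def divide_strict_right_mono)
  moreover have "slit_time p < vert_time q" if "1 \<le> p" "p < N" "1 \<le> q" "q < N" for p q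
    using slit_time[of p] vert_time_range[of q] that by auto
  ultimately have "sorted_wrt (<) ts"
    unfolding ts_def sorted_wrt_append sorted_wrt_map
    by (auto intro!: sorted_wrt_mono_rel[OF _ sorted_wrt_upt])
  then have ts: "sorted_list_of_set (set ts) = ts"
    by (simp add: strict_sorted_iff sorted_list_of_set.idem_if_sorted_distinct)
  have "{t \<in> {0<..<0 + real (length polygon)}. curve t \<in> multiple_points polygon} = set ts"
  proof (intro equalityI subsetI)
    fix t assume t: "t \<in> {t \<in> {0<..<0 + real (length polygon)}. curve t \<in> multiple_points polygon}"
    then obtain q where q: "1 \<le> q" "q < N"
      "polygon_fibre polygon (curve t) = {slit_time (x q), vert_time q}"
      using crossing_point_cases by blast
    moreover have "t \<in> polygon_fibre polygon (curve t)" using t by (simp add: polygon_fibre_def)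
    ultimately have "t = slit_time (x q) \<or> t = vert_time q" by simp
    then show "t \<in> set ts" using q x_range[OF q(1,2)] by (auto simp: ts_def)
  next
    fix t assume "t \<in> set ts"
    then consider j where "1 \<le> j" "j < N" "t = slit_time j" | q where "1 \<le> q" "q < N" "t = vert_time q"
      by (auto simp: ts_def)
    then show "t \<in> {t \<in> {0<..<0 + real (length polygon)}. curve t \<in> multiple_points polygon}"
    proof cases
      case 1
      then show ?thesis using slit_time_range[of j] polygon_slit_time[of j]
        by (simp add: length_polygon multiple_points_polygon)
    next
      case 2
      then show ?thesis using vert_time_range[of q] polygon_vert_time[of q] x_range[of q]
        by (simp add: length_polygon multiple_points_polygon)
    qed
  qed
  then have "crossings_met curve (real (length polygon)) (multiple_points polygon) 0
      = map curve ts"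
    by (simp only: crossings_met_def ts)
  also have "\<dots> = map of_nat [1..<N] @ map (of_nat \<circ> x) [1..<N]"
    by (simp add: ts_def polygon_slit_time polygon_vert_time)
  also have "map (of_nat \<circ> x) [1..<N] = map of_nat (map x [1..<N])" by simp
  also have "map x [1..<N] = w"
    by (rule nth_equalityI) (auto simp: N_def crossing_order_def simp del: upt_Suc)
  finally show ?thesis by simp
qed

lemma realizable: "classically_realizable w"
proof -
  \<comment> \<open>Any choice of over-strands makes a diagram; here the slit passes over
    everywhere, which selects one of the two parameters of each crossing.\<close>
  define D where "D = \<lparr>vertices = polygon, over = slit_time ` {1..<N}\<rparr>"
  have cr: "crossings D = multiple_points polygon" and v: "vertices D = polygon"
    by (auto simp: D_def crossings_def)
  have card: "card (crossings D) = length w"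
    by (simp add: cr multiple_points_polygon card_image inj_on_def N_def)
  have "knot_diagram D"
    unfolding knot_diagram_def cr v
  proof (intro conjI ballI)
    show "regular_polygon polygon" by (rule regular_polygon_polygon)
    show "over D \<subseteq> (\<Union>p\<in>multiple_points polygon. polygon_fibre polygon p)"
    proof
      fix t assume "t \<in> over D"
      then obtain j where j: "j \<in> {1..<N}" "t = slit_time j" by (auto simp: D_def)
      then have "t \<in> polygon_fibre polygon (of_nat j)"
        using slit_time_range[of j] polygon_slit_time[of j] by (auto simp: polygon_fibre_def length_polygon)
      then show "t \<in> (\<Union>p\<in>multiple_points polygon. polygon_fibre polygon p)"
        using j by (auto simp: multiple_points_polygon)
    qed
    fix p assume "p \<in> multiple_points polygon"
    then obtain q where q: "1 \<le> q" "q < N" "polygon_fibre polygon p = {slit_time (x q), vert_time q}" "1 < vert_time q"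
      by (rule crossing_point_cases)
    show "\<exists>!t. t \<in> over D \<inter> polygon_fibre polygon p"
    proof (rule ex1I[of _ "slit_time (x q)"])
      show "slit_time (x q) \<in> over D \<inter> polygon_fibre polygon p" using q x_range[of q] by (auto simp: D_def)
      fix t assume t: "t \<in> over D \<inter> polygon_fibre polygon p"
      then obtain j where "1 \<le> j" "j < N" "t = slit_time j" by (auto simp: D_def)
      then have "t \<noteq> vert_time q" using slit_time[of j] q by auto
      then show "t = slit_time (x q)" using t q by auto
    qed
  qed
  moreover have "knot_word_of D ([1..<Suc (card (crossings D))] @ w)"
    unfolding knot_word_of_def
  proof (intro exI conjI)
    show "curve \<in> {closed_polygon (vertices D), \<lambda>t. closed_polygon (vertices D) (- t)}"
      by (simp add: v)
    show "curve 0 \<notin> crossings D"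
      using polygon_slit[of 0] by (auto simp: cr multiple_points_polygon slit_point_def complex_eq_iff)
    have "set w \<subseteq> {1..length w}" using perm by (simp add: permutation_word_def)
    then show "[1..<Suc (card (crossings D))] @ w =
        encounter_labels (crossings_met curve (real (length (vertices D))) (crossings D) 0)"
      unfolding cr v crossings_met_polygon unfolding card[unfolded cr]
      using encounter_labels_straight[of "of_nat :: nat \<Rightarrow> complex" w "length w"]
      by (simp add: inj_on_def N_def del: upt_Suc)
  qed
  ultimately show ?thesis
    using perm card unfolding classically_realizable_def straight_word_of_def by auto
qed

end

theorem realizable_iff_planar_chords:
  assumes "permutation_word w"
  shows "classically_realizable w \<longleftrightarrow> (\<exists>up. planar_chords w up)"
  using assms realizable_imp_planar_chords planar_word.realizable planar_word.intro by blast


section \<open>Recursiveness of the criterion\<close>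

lemma recursive_cong:
  "recursive k f \<Longrightarrow> (\<And>xs. length xs = k \<Longrightarrow> f xs = g xs) \<Longrightarrow> recursive k g"
  using recursive.ext by blast

lemma recursive_lift1:
  assumes "recursive 1 (\<lambda>xs. F (xs ! 0))" "recursive k f"
  shows "recursive k (\<lambda>xs. F (f xs))"
  using recursive.comp[of "[f]" "\<lambda>xs. F (xs ! 0)" k] assms by simp

lemma recursive_lift2:
  assumes "recursive 2 (\<lambda>xs. F (xs ! 0) (xs ! 1))" "recursive k f" "recursive k g"
  shows "recursive k (\<lambda>xs. F (f xs) (g xs))"
  using recursive.comp[of "[f, g]" "\<lambda>xs. F (xs ! 0) (xs ! 1)" k] assms by (simp add: numeral_2_eq_2)

lemma recursive_Suc: "recursive k f \<Longrightarrow> recursive k (\<lambda>xs. Suc (f xs))"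
  by (rule recursive_lift1[OF recursive.succ])

lemma recursive_const: "recursive k (\<lambda>xs. c)"
  by (induction c) (auto intro: recursive.zero recursive_Suc)

lemma map_nth_interval: "length xs = i + k \<Longrightarrow> map (\<lambda>g. g xs) (map (\<lambda>j xs. xs ! j) [i..<i + k]) = drop i xs"
  by (rule nth_equalityI) auto

text \<open>The rule \<open>comp\<close> substitutes functions for single arguments, so passing to a
  sublist of the arguments is composition with projections.\<close>

lemma recursive_drop:
  assumes "recursive k f" shows "recursive (i + k) (\<lambda>xs. f (drop i xs))"
proof -
  have "recursive (i + k) (\<lambda>xs. f (map (\<lambda>g. g xs) (map (\<lambda>j xs. xs ! j) [i..<i + k])))"
    by (rule recursive.comp) (use assms in \<open>auto intro: recursive.proj\<close>)
  then show ?thesis by (rule recursive_cong) (simp only: map_nth_interval)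
qed

lemma recursive_Cons:
  assumes "recursive (Suc k) F" "recursive k f"
  shows "recursive k (\<lambda>xs. F (f xs # xs))"
proof -
  have "recursive k (\<lambda>xs. F (map (\<lambda>g. g xs) (f # map (\<lambda>j xs. xs ! j) [0..<0 + k])))"
    by (rule recursive.comp) (use assms in \<open>auto intro: recursive.proj\<close>)
  then show ?thesis
  proof (rule recursive_cong)
    fix xs :: "nat list" assume "length xs = k"
    then show "F (map (\<lambda>g. g xs) (f # map (\<lambda>j xs. xs ! j) [0..<0 + k])) = F (f xs # xs)"
      using map_nth_interval[of xs 0 k] by simp
  qed
qed

text \<open>The rule \<open>prim_rec\<close> takes the counter as first argument;
  \<open>recursive_Cons\<close> supplies there a bound computed from the parameters.\<close>

lemma recursive_rec_nat:
  assumes "recursive k c" "recursive k f" "recursive (Suc (Suc k)) (\<lambda>ys. g (ys ! 0) (ys ! 1) (tl (tl ys)))"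
  shows "recursive k (\<lambda>xs. rec_nat (f xs) (\<lambda>i r. g i r xs) (c xs))"
  using recursive_Cons[OF recursive.prim_rec[OF assms(2,3)] assms(1)] by simp

lemma recursive_tl_nth: "Suc j < k \<Longrightarrow> recursive k (\<lambda>xs. tl xs ! j)"
  by (rule recursive_cong[OF recursive.proj[of "Suc j"]]) (auto simp: nth_tl)

lemma recursive_tl_tl_nth: "Suc (Suc j) < k \<Longrightarrow> recursive k (\<lambda>xs. tl (tl xs) ! j)"
  by (rule recursive_cong[OF recursive.proj[of "Suc (Suc j)"]]) (auto simp: nth_tl)

lemma recursive_tl: "recursive k f \<Longrightarrow> recursive (Suc k) (\<lambda>xs. f (tl xs))"
  using recursive_drop[of k f 1] by (simp add: drop_Suc)

lemma recursive_tl_tl: "recursive k f \<Longrightarrow> recursive (Suc (Suc k)) (\<lambda>xs. f (tl (tl xs)))"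
  using recursive_drop[of k f 2] by (simp add: drop_Suc numeral_2_eq_2)

lemmas recursive_intros = recursive.proj recursive_tl_nth recursive_tl_tl_nth recursive_tl recursive_tl_tl
  recursive_Suc recursive_const

section \<open>Recursive arithmetic\<close>

lemma rec_nat_add: "rec_nat a (\<lambda>i r. Suc r) b = a + b"
  by (induction b) auto

lemma recursive_add: "recursive k f \<Longrightarrow> recursive k g \<Longrightarrow> recursive k (\<lambda>xs. f xs + g xs)"
proof (rule recursive_lift2[where F = "(+)"])
  have "recursive 2 (\<lambda>xs. rec_nat (xs ! 0) (\<lambda>i r. Suc r) (xs ! 1))"
    by (intro recursive_rec_nat recursive_intros) auto
  then show "recursive 2 (\<lambda>xs. xs ! 0 + xs ! 1)" by (simp add: rec_nat_add)
qed

lemma rec_nat_mult: "rec_nat 0 (\<lambda>i r. r + a) b = a * b" for a b :: nat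
  by (induction b) auto

lemma recursive_mult: "recursive k f \<Longrightarrow> recursive k g \<Longrightarrow> recursive k (\<lambda>xs. f xs * g xs)"
proof (rule recursive_lift2[where F = "(*)"])
  have "recursive 2 (\<lambda>xs. rec_nat 0 (\<lambda>i r. r + xs ! 0) (xs ! 1))"
    by (intro recursive_rec_nat recursive_add recursive_intros) auto
  then show "recursive 2 (\<lambda>xs. xs ! 0 * xs ! 1)" by (simp add: rec_nat_mult)
qed

lemma rec_nat_pred: "rec_nat 0 (\<lambda>i r. i) a = a - 1"
  by (cases a) auto

lemma recursive_pred: "recursive k f \<Longrightarrow> recursive k (\<lambda>xs. f xs - 1)"
proof (rule recursive_lift1[where F = "\<lambda>a. a - 1"])
  have "recursive 1 (\<lambda>xs. rec_nat 0 (\<lambda>i r. i) (xs ! 0))"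
    by (intro recursive_rec_nat recursive_intros) auto
  then show "recursive 1 (\<lambda>xs. xs ! 0 - 1)" by (simp only: rec_nat_pred)
qed

lemma rec_nat_diff: "rec_nat a (\<lambda>i r. r - 1) b = a - b" for a b :: nat
  by (induction b) auto

lemma recursive_diff: "recursive k f \<Longrightarrow> recursive k g \<Longrightarrow> recursive k (\<lambda>xs. f xs - g xs)"
proof (rule recursive_lift2[where F = "(-)"])
  have "recursive 2 (\<lambda>xs. rec_nat (xs ! 0) (\<lambda>i r. r - 1) (xs ! 1))"
    by (intro recursive_rec_nat recursive_pred recursive_intros) auto
  then show "recursive 2 (\<lambda>xs. xs ! 0 - xs ! 1)" by (simp only: rec_nat_diff)
qed

section \<open>Decidable predicates and bounded search\<close>

definition decidable :: "nat \<Rightarrow> (nat list \<Rightarrow> bool) \<Rightarrow> bool" where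
  "decidable k P \<longleftrightarrow> recursive k (\<lambda>xs. if P xs then 1 else 0)"

lemma decidable_le: "recursive k f \<Longrightarrow> recursive k g \<Longrightarrow> decidable k (\<lambda>xs. f xs \<le> g xs)"
  unfolding decidable_def
  by (rule recursive_cong[of k "\<lambda>xs. 1 - (f xs - g xs)"]) (auto intro: recursive_diff recursive_const)

lemma decidable_less: "recursive k f \<Longrightarrow> recursive k g \<Longrightarrow> decidable k (\<lambda>xs. f xs < g xs)"
  using decidable_le[of k "\<lambda>xs. Suc (f xs)" g] recursive_Suc by (simp add: Suc_le_eq)

lemma decidable_not: "decidable k P \<Longrightarrow> decidable k (\<lambda>xs. \<not> P xs)"
  unfolding decidable_def
  by (rule recursive_cong[of k "\<lambda>xs. 1 - (if P xs then 1 else 0)"]) (auto intro: recursive_diff recursive_const)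

lemma decidable_conj: "decidable k P \<Longrightarrow> decidable k Q \<Longrightarrow> decidable k (\<lambda>xs. P xs \<and> Q xs)"
  unfolding decidable_def
  by (rule recursive_cong[of k "\<lambda>xs. (if P xs then 1 else 0) * (if Q xs then 1 else 0)"]) (auto intro: recursive_mult)

lemma decidable_disj: "decidable k P \<Longrightarrow> decidable k Q \<Longrightarrow> decidable k (\<lambda>xs. P xs \<or> Q xs)"
  using decidable_not[OF decidable_conj[OF decidable_not decidable_not]] by simp

lemma decidable_imp: "decidable k P \<Longrightarrow> decidable k Q \<Longrightarrow> decidable k (\<lambda>xs. P xs \<longrightarrow> Q xs)"
  unfolding imp_conv_disj by (intro decidable_disj decidable_not)

lemma decidable_iff: "decidable k P \<Longrightarrow> decidable k Q \<Longrightarrow> decidable k (\<lambda>xs. P xs = Q xs)"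
  unfolding iff_conv_conj_imp by (intro decidable_conj decidable_imp)

lemma decidable_eq: "recursive k f \<Longrightarrow> recursive k g \<Longrightarrow> decidable k (\<lambda>xs. f xs = g xs)"
  unfolding eq_iff[of "f _"] by (intro decidable_conj decidable_le)

lemma recursive_if:
  "decidable k P \<Longrightarrow> recursive k f \<Longrightarrow> recursive k g \<Longrightarrow> recursive k (\<lambda>xs. if P xs then f xs else g xs)"
  unfolding decidable_def
  by (rule recursive_cong[of k "\<lambda>xs. (if P xs then 1 else 0) * f xs + (1 - (if P xs then 1 else 0)) * g xs"])
    (auto intro!: recursive_add recursive_mult recursive_diff recursive_const)

lemma rec_nat_Ex: "rec_nat 0 (\<lambda>i r. if r \<noteq> 0 \<or> P i then 1 else 0) b = (if \<exists>i<b. P i then 1 else 0 :: nat)"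
  by (induction b) (auto simp: less_Suc_eq)

text \<open>The search is a primitive recursion over the bound whose accumulated value is a flag.
  The step function receives this flag at index 1, between candidate and parameters, and the
  composition with projections skips it.\<close>

lemma decidable_Ex_less:
  assumes "recursive k b" "decidable (Suc k) (\<lambda>ys. P (ys ! 0) (tl ys))"
  shows "decidable k (\<lambda>xs. \<exists>i<b xs. P i xs)"
proof -
  let ?F = "\<lambda>ys. if P (ys ! 0) (tl ys) then 1 else 0 :: nat"
  have "recursive (Suc (Suc k)) (\<lambda>xs. ?F (map (\<lambda>g. g xs) ((\<lambda>xs. xs ! 0) # map (\<lambda>j xs. xs ! j) [2..<2 + k])))"
  proof (rule recursive.comp)
    have "length ((\<lambda>xs. xs ! 0) # map (\<lambda>j xs. xs ! j) [2..<2 + k] :: (nat list \<Rightarrow> nat) list) = Suc k"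
      by (simp only: list.size(4) length_map length_upt diff_add_inverse add_Suc_right add_0_right)
    then show "recursive (length ((\<lambda>xs. xs ! 0) # map (\<lambda>j xs. xs ! j) [2..<2 + k] :: (nat list \<Rightarrow> nat) list)) ?F"
      using assms(2) by (simp only: decidable_def)
  qed (auto intro: recursive.proj)
  then have "decidable (Suc (Suc k)) (\<lambda>ys. P (ys ! 0) (tl (tl ys)))"
    unfolding decidable_def
  proof (rule recursive_cong)
    fix xs :: "nat list" assume "length xs = Suc (Suc k)"
    then have "map (\<lambda>g. g xs) (map (\<lambda>j xs. xs ! j) [2..<2 + k]) = drop 2 xs"
      by (intro map_nth_interval) simp
    also have "drop 2 xs = tl (tl xs)" by (simp add: drop_Suc numeral_2_eq_2)
    finally show "?F (map (\<lambda>g. g xs) ((\<lambda>xs. xs ! 0) # map (\<lambda>j xs. xs ! j) [2..<2 + k]))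
        = (if P (xs ! 0) (tl (tl xs)) then 1 else 0)"
      by (simp only: list.map nth_Cons_0 list.sel)
  qed
  then have "decidable (Suc (Suc k)) (\<lambda>ys. ys ! 1 \<noteq> 0 \<or> P (ys ! 0) (tl (tl ys)))"
    by (intro decidable_disj decidable_not decidable_eq recursive_intros) auto
  then have "recursive k (\<lambda>xs. rec_nat 0 (\<lambda>i r. if r \<noteq> 0 \<or> P i xs then 1 else 0) (b xs))"
    unfolding decidable_def by (intro recursive_rec_nat recursive_const assms(1))
  then show ?thesis unfolding decidable_def by (simp only: rec_nat_Ex)
qed

lemma decidable_All_less:
  assumes "recursive k b" "decidable (Suc k) (\<lambda>ys. P (ys ! 0) (tl ys))"
  shows "decidable k (\<lambda>xs. \<forall>i<b xs. P i xs)"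
  using decidable_not[OF decidable_Ex_less[OF assms(1) decidable_not[OF assms(2)]]] by simp

lemma recursive_Least:
  assumes "decidable (Suc k) (\<lambda>ys. P (ys ! 0) (tl ys))" "\<And>xs. length xs = k \<Longrightarrow> \<exists>i. P i xs"
  shows "recursive k (\<lambda>xs. LEAST i. P i xs)"
proof -
  let ?f = "\<lambda>ys. 1 - (if P (ys ! 0) (tl ys) then 1 else 0) :: nat"
  have "recursive (Suc k) ?f"
    using assms(1) unfolding decidable_def by (intro recursive_diff recursive_const)
  moreover have *: "?f (i # xs) = 0 \<longleftrightarrow> P i xs" for i xs by simp
  ultimately have "recursive k (\<lambda>xs. LEAST i. ?f (i # xs) = 0)"
    using assms(2) by (intro recursive.minimize) auto
  then show ?thesis unfolding * .
qed

section \<open>Codes of pairs and lists\<close>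

lemma rec_nat_triangle: "rec_nat 0 (\<lambda>i r. r + Suc i) n = triangle n"
  by (induction n) auto

lemma recursive_prod_encode:
  assumes "recursive k f" "recursive k g"
  shows "recursive k (\<lambda>xs. prod_encode (f xs, g xs))"
proof -
  have "recursive 1 (\<lambda>xs. rec_nat 0 (\<lambda>i r. r + Suc i) (xs ! 0))"
    by (intro recursive_rec_nat recursive_add recursive_intros) auto
  then have "recursive 1 (\<lambda>xs. triangle (xs ! 0))" by (simp only: rec_nat_triangle)
  from recursive_lift1[OF this recursive_add[OF assms]] show ?thesis
    unfolding prod_encode_def by (simp add: recursive_add assms)
qed

text \<open>The components are found by search. They do not exceed the code, which bounds the inner
  quantifier, and every number is the code of a pair, which makes the minimization total.\<close>

lemma recursive_prod_decode:
  assumes "recursive k f"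
  shows "recursive k (\<lambda>xs. fst (prod_decode (f xs)))" "recursive k (\<lambda>xs. snd (prod_decode (f xs)))"
proof -
  have less: "fst (prod_decode c) < Suc c" "snd (prod_decode c) < Suc c" for c
    using le_prod_encode_1[of "fst (prod_decode c)" "snd (prod_decode c)"]
      le_prod_encode_2[of "snd (prod_decode c)" "fst (prod_decode c)"] by auto
  have eq: "prod_encode (a, b) = c \<longleftrightarrow> a = fst (prod_decode c) \<and> b = snd (prod_decode c)" for a b c
    by (metis fst_conv prod.collapse prod_decode_inverse prod_encode_inverse snd_conv)
  have a: "(LEAST a. \<exists>b<Suc c. prod_encode (a, b) = c) = fst (prod_decode c)" for c
    unfolding eq by (rule Least_equality) (use less in auto)
  have b: "(LEAST b. \<exists>a<Suc c. prod_encode (a, b) = c) = snd (prod_decode c)" for c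
    unfolding eq by (rule Least_equality) (use less in auto)
  have "recursive 1 (\<lambda>xs. LEAST a. \<exists>b<Suc (xs ! 0). prod_encode (a, b) = xs ! 0)"
  proof (rule recursive_Least)
    show "decidable (Suc 1) (\<lambda>ys. \<exists>b<Suc (tl ys ! 0). prod_encode (ys ! 0, b) = tl ys ! 0)"
      by (intro decidable_Ex_less decidable_eq recursive_prod_encode recursive_intros) auto
  qed (use less eq in blast)
  then have "recursive 1 (\<lambda>xs. fst (prod_decode (xs ! 0)))" unfolding a .
  then show "recursive k (\<lambda>xs. fst (prod_decode (f xs)))" by (rule recursive_lift1[OF _ assms])
  have "recursive 1 (\<lambda>xs. LEAST b. \<exists>a<Suc (xs ! 0). prod_encode (a, b) = xs ! 0)"
  proof (rule recursive_Least)
    show "decidable (Suc 1) (\<lambda>ys. \<exists>a<Suc (tl ys ! 0). prod_encode (a, ys ! 0) = tl ys ! 0)"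
      by (intro decidable_Ex_less decidable_eq recursive_prod_encode recursive_intros) auto
  qed (use less eq in blast)
  then have "recursive 1 (\<lambda>xs. snd (prod_decode (xs ! 0)))" unfolding b .
  then show "recursive k (\<lambda>xs. snd (prod_decode (f xs)))" by (rule recursive_lift1[OF _ assms])
qed

text \<open>\<open>list_encode\<close> sends \<open>[]\<close> to \<open>0\<close> and
  \<open>x # xs\<close> to the successor of the code of the pair of \<open>x\<close> and the code of
  \<open>xs\<close>, so each step of the recursion takes the tail of a list on its code.\<close>

definition drop_code :: "nat \<Rightarrow> nat \<Rightarrow> nat" where
  "drop_code c i = rec_nat c (\<lambda>i r. snd (prod_decode (r - 1)) * (if r = 0 then 0 else 1)) i"

lemma drop_code_list_encode: "drop_code (list_encode xs) i = list_encode (drop i xs)"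
proof (induction i)
  case 0
  then show ?case by (simp add: drop_code_def)
next
  case (Suc i)
  have "drop_code (list_encode xs) (Suc i) =
      snd (prod_decode (list_encode (drop i xs) - 1)) * (if list_encode (drop i xs) = 0 then 0 else 1)"
    using Suc by (simp add: drop_code_def)
  also have "\<dots> = list_encode (drop (Suc i) xs)"
    by (cases "drop i xs") (auto simp: drop_Suc simp flip: tl_drop)
  finally show ?case .
qed

lemma list_encode_eq_0: "list_encode xs = 0 \<longleftrightarrow> xs = []"
  by (cases xs) auto

definition length_code :: "nat \<Rightarrow> nat" where "length_code c = (LEAST i. drop_code c i = 0)"

lemma length_code_list_encode: "length_code (list_encode xs) = length xs"
  unfolding length_code_def drop_code_list_encode list_encode_eq_0 by (rule Least_equality) auto

definition nth_code :: "nat \<Rightarrow> nat \<Rightarrow> nat" where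
  "nth_code c i = fst (prod_decode (drop_code c i - 1))"

lemma nth_code_list_encode: "i < length xs \<Longrightarrow> nth_code (list_encode xs) i = xs ! i"
  unfolding nth_code_def drop_code_list_encode by (simp flip: Cons_nth_drop_Suc)

lemma recursive_drop_code:
  assumes "recursive k f" "recursive k g" shows "recursive k (\<lambda>xs. drop_code (f xs) (g xs))"
  unfolding drop_code_def
  by (intro recursive_rec_nat recursive_mult recursive_prod_decode recursive_diff recursive_if decidable_eq
      recursive_intros assms) auto

lemma recursive_length_code:
  assumes "recursive k f" shows "recursive k (\<lambda>xs. length_code (f xs))"
proof (rule recursive_lift1[OF _ assms])
  \<comment> \<open>The coding is onto, so the minimization in \<open>length_code\<close> is
    total.\<close>
  have "\<exists>i. drop_code c i = 0" for c
    using drop_code_list_encode[of "list_decode c" "length (list_decode c)"] by auto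
  then show "recursive 1 (\<lambda>xs. length_code (xs ! 0))"
    unfolding length_code_def
    by (intro recursive_Least decidable_eq recursive_drop_code recursive_intros) auto
qed

lemma recursive_nth_code:
  "recursive k f \<Longrightarrow> recursive k g \<Longrightarrow> recursive k (\<lambda>xs. nth_code (f xs) (g xs))"
  unfolding nth_code_def by (intro recursive_prod_decode recursive_diff recursive_drop_code recursive_const)

section \<open>Binary digits\<close>

text \<open>Step \<open>i\<close> adds the parity of \<open>i\<close>, which the inner recursion
  produces by alternating between \<open>0\<close> and \<open>1\<close>.\<close>

lemma rec_nat_half: "rec_nat 0 (\<lambda>i r. r + rec_nat 0 (\<lambda>i r. 1 - r) i) n = n div (2 :: nat)"
proof -
  have par: "rec_nat 0 (\<lambda>i r. 1 - r) n = n mod (2 :: nat)" for n by (induction n) (auto simp: mod_Suc)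
  show ?thesis unfolding par by (induction n) (auto simp: div_Suc mod_Suc)
qed

lemma recursive_half:
  assumes "recursive k f" shows "recursive k (\<lambda>xs. f xs div 2)"
proof (rule recursive_lift1[OF _ assms])
  have "recursive 1 (\<lambda>xs. rec_nat 0 (\<lambda>i r. r + rec_nat 0 (\<lambda>i r. 1 - r) i) (xs ! 0))"
    by (intro recursive_rec_nat recursive_add recursive_diff recursive_intros) auto
  then show "recursive 1 (\<lambda>xs. xs ! 0 div 2)" by (simp only: rec_nat_half)
qed

text \<open>The parity of \<open>b div 2 ^ i\<close>, expressed by iterated halving and truncated
  subtraction so that its recursiveness can be read off.\<close>

definition code_bit :: "nat \<Rightarrow> nat \<Rightarrow> bool" where
  "code_bit b i \<longleftrightarrow> rec_nat b (\<lambda>i r. r div 2) i - 2 * (rec_nat b (\<lambda>i r. r div 2) i div 2) = 1"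

lemma code_bit: "code_bit b i = bit b i"
proof -
  have half: "rec_nat b (\<lambda>i r. r div 2) i = b div 2 ^ i" by (induction i) (simp_all add: mult.commute flip: div_mult2_eq)
  show ?thesis unfolding code_bit_def half bit_iff_odd by (metis minus_mult_div_eq_mod odd_iff_mod_2_eq_one)
qed

lemma decidable_code_bit:
  assumes "recursive k f" "recursive k g" shows "decidable k (\<lambda>xs. code_bit (f xs) (g xs))"
  unfolding code_bit_def
  by (intro decidable_eq recursive_diff recursive_mult recursive_half recursive_rec_nat recursive_intros assms) auto

lemma rec_nat_pow2: "rec_nat 1 (\<lambda>i r. r + r) n = (2 :: nat) ^ n"
  by (induction n) auto

lemma recursive_pow2:
  assumes "recursive k f" shows "recursive k (\<lambda>xs. 2 ^ f xs)"
proof -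
  have "recursive k (\<lambda>xs. rec_nat 1 (\<lambda>i r. r + r) (f xs))"
    by (intro recursive_rec_nat recursive_add recursive_intros assms) auto
  then show ?thesis by (simp only: rec_nat_pow2)
qed

section \<open>The planarity condition on codes\<close>

text \<open>This and the following definitions transcribe \<open>planar_chords\<close> for the code
  \<open>c\<close> of a word and a number \<open>b\<close> whose binary digits are the choice of
  sides. They agree with the originals for codes of lists and indices in range.\<close>

definition order_code :: "nat \<Rightarrow> nat \<Rightarrow> nat" where
  "order_code c q =
     (if q = 0 then Suc (length_code c) else if q = Suc (length_code c) then 0 else nth_code c (q - 1))"

definition start_code :: "nat \<Rightarrow> nat \<Rightarrow> nat \<Rightarrow> nat" where
  "start_code c b k =
     (if code_bit b k then order_code c k else 2 * length_code c + 2 - order_code c k)"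

definition target_code :: "nat \<Rightarrow> nat \<Rightarrow> nat \<Rightarrow> nat" where
  "target_code c b k =
     (if \<not> code_bit b (Suc k) then order_code c (Suc k) else 2 * length_code c + 2 - order_code c (Suc k))"

definition planar_code :: "nat \<Rightarrow> nat \<Rightarrow> bool" where
  "planar_code c b \<longleftrightarrow> \<not> code_bit b (Suc (length_code c)) \<and>
     (\<forall>k<Suc (length_code c). \<forall>l<Suc (length_code c). k \<noteq> l \<longrightarrow>
        between (start_code c b k) (target_code c b k) (start_code c b l) =
        between (start_code c b k) (target_code c b k) (target_code c b l))"

lemma planar_code_list_encode: "planar_code (list_encode w) b = planar_chords w (bit b)"
proof -
  have ord: "order_code (list_encode w) q = crossing_order w q" if "q \<le> Suc (length w)" for q
    using that by (auto simp: order_code_def crossing_order_def length_code_list_encode nth_code_list_encode)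
  have "start_code (list_encode w) b k = chord_start w (bit b) k"
    "target_code (list_encode w) b k = chord_target w (bit b) k" if "k < Suc (length w)" for k
    using that ord[of k] ord[of "Suc k"]
    by (auto simp: start_code_def target_code_def chord_start_def chord_target_def position_def
        code_bit length_code_list_encode)
  then show ?thesis
    unfolding planar_code_def planar_chords_def length_code_list_encode code_bit less_Suc_eq_le by auto
qed

lemma recursive_order_code:
  "recursive k f \<Longrightarrow> recursive k g \<Longrightarrow> recursive k (\<lambda>xs. order_code (f xs) (g xs))"
  unfolding order_code_def
  by (intro recursive_if decidable_eq recursive_nth_code recursive_length_code recursive_diff recursive_intros)

lemma recursive_start_code:
  "recursive k f \<Longrightarrow> recursive k g \<Longrightarrow> recursive k h \<Longrightarrow> recursive k (\<lambda>xs. start_code (f xs) (g xs) (h xs))"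
  unfolding start_code_def
  by (intro recursive_if decidable_code_bit recursive_order_code recursive_length_code recursive_diff
      recursive_add recursive_mult recursive_const)

lemma recursive_target_code:
  "recursive k f \<Longrightarrow> recursive k g \<Longrightarrow> recursive k h \<Longrightarrow> recursive k (\<lambda>xs. target_code (f xs) (g xs) (h xs))"
  unfolding target_code_def
  by (intro recursive_if decidable_not decidable_code_bit recursive_order_code recursive_length_code recursive_diff
      recursive_add recursive_mult recursive_const recursive_Suc)

lemma decidable_between:
  "recursive k f \<Longrightarrow> recursive k g \<Longrightarrow> recursive k h \<Longrightarrow> decidable k (\<lambda>xs. between (f xs) (g xs) (h xs))"
  unfolding between_def min_def max_def
  by (intro decidable_conj decidable_less recursive_if decidable_le)

lemma decidable_planar_code:
  assumes "recursive k f" "recursive k g"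
  shows "decidable k (\<lambda>xs. planar_code (f xs) (g xs))"
proof -
  have "decidable 2 (\<lambda>xs. planar_code (xs ! 0) (xs ! 1))"
    unfolding planar_code_def
    by (intro decidable_conj decidable_not decidable_All_less decidable_imp decidable_iff decidable_between
        decidable_eq decidable_code_bit recursive_start_code recursive_target_code recursive_length_code
        recursive_intros) auto
  then show ?thesis using recursive_lift2[of "\<lambda>a b. if planar_code a b then 1 else 0"] assms
    unfolding decidable_def by simp
qed

text \<open>The condition consults \<open>up\<close> only at \<open>0, ..., n + 1\<close>, where
  \<open>n\<close> is the length of the word, so a choice of sides is a number with
  \<open>n + 2\<close> binary digits and the search becomes bounded.\<close>

lemma planar_chords_bits:
  "(\<exists>up. planar_chords w up) \<longleftrightarrow> (\<exists>b<(2 :: nat) ^ (length w + 2). planar_chords w (bit b))"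
proof
  assume "\<exists>up. planar_chords w up"
  then obtain up where up: "planar_chords w up" ..
  define b :: nat where "b = horner_sum of_bool 2 (map up [0..<length w + 2])"
  have b: "b < 2 ^ (length w + 2)" using horner_sum_of_bool_2_less[of "map up [0..<length w + 2]"] by (simp add: b_def)
  have bits: "bit b i = up i" if "i \<le> Suc (length w)" for i
    using that by (simp add: b_def bit_horner_sum_bit_iff del: upt_Suc)
  have "planar_chords w (bit b)"
    using up unfolding planar_chords_def chord_start_def chord_target_def by (simp add: bits)
  with b show "\<exists>b<(2 :: nat) ^ (length w + 2). planar_chords w (bit b)" by blast
qed blast

theorem theorem4p2:
  "\<exists>f. recursive 1 f \<and>
     (\<forall>w. permutation_word w \<longrightarrow>
        f [list_encode w] = (if classically_realizable w then 1 else 0))"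
proof -
  \<comment> \<open>The search is bounded for every input, so \<open>f\<close> is total; its value
    expresses realizability on the codes of permutation words.\<close>
  define f :: "nat list \<Rightarrow> nat" where
    "f = (\<lambda>xs. if \<exists>b<2 ^ (length_code (xs ! 0) + 2). planar_code (xs ! 0) b then 1 else 0)"
  have "decidable 1 (\<lambda>xs. \<exists>b<2 ^ (length_code (xs ! 0) + 2). planar_code (xs ! 0) b)"
    by (intro decidable_Ex_less decidable_planar_code recursive_pow2 recursive_add recursive_length_code
        recursive_intros) auto
  then have "recursive 1 f" by (simp only: decidable_def f_def)
  moreover have "f [list_encode w] = (if classically_realizable w then 1 else 0)" if "permutation_word w" for w
    unfolding realizable_iff_planar_chords[OF that] planar_chords_bits
    by (simp only: f_def nth_Cons_0 length_code_list_encode planar_code_list_encode)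
  ultimately show ?thesis by blast
qed

end
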